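(* Let $0<\alpha<\tfrac12$, let $L:\mathbb R\to(0,\infty)$ be slowly varying, and let $\mu$ be a probability measure on $\mathbb N$ with $\mu(\{n,n+1,\ldots\})\sim n^{-\alpha}L(n)$ as $n\to\infty$ and $\gcd\{n\in\mathbb N:\mu(\{n\})>0\}=1$. Let $Y$ be a real-valued random variable (the colouring). Assume that one of the following conditions (A) or (B) holds: (A) $Y=\xi-(2p-1)$, where $\mathbf P(\xi=+1)=p$ and $\mathbf P(\xi=-1)=1-p$ for some $p\in(0,1)$. (B) The renewal weights $q_n$ of $\mu$ satisfy $$q_n\sim\frac{1}{\Gamma(\alpha)\Gamma(1-\alpha)}\,\frac{n^{\alpha-1}}{L(n)}\quad\text{as } n\to\infty,$$ and $\mathbf E[Y]=0$, $0<\mathbf E[Y^4]<\infty$. Let $S_n=\sum_{i=1}^nY_i$, where $Y_i$ is the colour of the component of $i$ in the random graph $\mathcal G_\mu$ whose components are coloured by independent copies of $Y$. Then, for any fixed $d\in\mathbb N$ and fixed $0<t_1<\cdots<t_d<\infty$, the sequence of random vectors $\left(S_{\lfloor t_1n\rfloor},\ldots,S_{\lfloor t_dn\rfloor}\right)_{n\in\mathbb N}$ is asymptotically Gaussian as $n\to\infty$.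
   Context: Here $\mathbb N=\{1,2,\ldots\}$, and $f(n)\sim g(n)$ for real sequences means $f(n)/g(n)\to1$. Random graph: let $(R_i)_{i\in\mathbb Z}$ be i.i.d. with distribution $\mu$. $\mathcal G_\mu$ is the random directed graph with vertex set $\mathbb Z$ and edge set $\{(i,i-R_i):i\in\mathbb Z\}$. For $i,j\in\mathbb Z$ write $i\sim j$ if $i$ and $j$ belong to the same connected component of $\mathcal G_\mu$ (edge directions ignored). Renewal weights: $q_n:=\mathbf P(\tilde R_1+\cdots+\tilde R_j=n\text{ for some }j\ge0)$, $n\ge 0$, with $\tilde R_1,\tilde R_2,\ldots$ independent with distribution $\mu$ (so $q_0=1$). Colouring: each connected component of $\mathcal G_\mu$ is coloured by an independent copy of $Y$ (the colours being independent of each other and of $\mathcal G_\mu$); $Y_i$ denotes the colour of the component containing $i$. A sequence of centered $\mathbb R^d$-valued random vectors $X_n=(X_n^1,\ldots,X_n^d)$ with finite second moments is called asymptotically Gaussian if for every $(\beta_1,\ldots,\beta_d)\in\mathbb R^d\setminus\{0\}$ the linear combination $V_n:=\sum_{g=1}^d\beta_gX_n^g$ has positive variance for all sufficiently large $n$, and $V_n/\sqrt{\mathbf{Var}[V_n]}$ converges in distribution to a standard normal random variable. *)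

theory Defs
  imports "HOL-Probability.Probability" "HOL-Library.Landau_Symbols"
begin

definition slowly_varying :: "(real \<Rightarrow> real) \<Rightarrow> bool" where
  "slowly_varying L \<longleftrightarrow> (\<forall>c>0. ((\<lambda>x. L (c * x) / L x) \<longlongrightarrow> 1) at_top)"

definition renewal_weight :: "nat pmf \<Rightarrow> nat \<Rightarrow> real" where
  "renewal_weight \<mu> n =
     measure (\<Pi>\<^sub>M k\<in>(UNIV :: nat set). measure_pmf \<mu>) {r. \<exists>j. (\<Sum>k<j. r k) = n}"

definition graph_edges :: "(int \<Rightarrow> nat) \<Rightarrow> (int \<times> int) set" where
  "graph_edges r = {(i, i - int (r i)) | i. True}"

definition same_component :: "(int \<Rightarrow> nat) \<Rightarrow> int \<Rightarrow> int \<Rightarrow> bool" where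
  "same_component r i j \<longleftrightarrow> (i, j) \<in> (graph_edges r \<union> (graph_edges r)\<inverse>)\<^sup>*"

definition distinct_components :: "(int \<Rightarrow> nat) \<Rightarrow> int set \<Rightarrow> bool" where
  "distinct_components r J \<longleftrightarrow> (\<forall>i\<in>J. \<forall>j\<in>J. i \<noteq> j \<longrightarrow> \<not> same_component r i j)"

definition iid_jumps :: "'w measure \<Rightarrow> nat pmf \<Rightarrow> (int \<Rightarrow> 'w \<Rightarrow> nat) \<Rightarrow> bool" where
  "iid_jumps M \<mu> R \<longleftrightarrow>
     prob_space.indep_vars M (\<lambda>_. count_space UNIV) R UNIV \<and>
     (\<forall>i. distr M (count_space UNIV) (R i) = measure_pmf \<mu>)"

text \<open>
  The components are random sets, so their colours cannot be indexed by the components in a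
  measurable way. Instead, \<open>C i\<close> is the colour of the component containing the vertex \<open>i\<close>:
  vertices of the same component have the same colour, and, whatever event \<open>B\<close> of the graph one
  restricts to, the colours at finitely many vertices \<open>J\<close> lying in pairwise distinct components
  are independent of each other and of the graph, each with law \<open>\<nu>\<close>. The graph and \<open>R\<close> carry the
  same information, as the edge leaving \<open>i\<close> determines \<open>R i\<close>.
\<close>
definition component_colouring ::
    "'w measure \<Rightarrow> (int \<Rightarrow> 'w \<Rightarrow> nat) \<Rightarrow> real measure \<Rightarrow> (int \<Rightarrow> 'w \<Rightarrow> real) \<Rightarrow> bool" where
  "component_colouring M R \<nu> C \<longleftrightarrow>
     (\<forall>i. C i \<in> borel_measurable M) \<and>
     (\<forall>\<omega>\<in>space M. \<forall>i j. same_component (\<lambda>k. R k \<omega>) i j \<longrightarrow> C i \<omega> = C j \<omega>) \<and>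
     (\<forall>J D. \<forall>B \<in> sets (\<Pi>\<^sub>M k\<in>(UNIV :: int set). count_space (UNIV :: nat set)).
        finite J \<longrightarrow> (\<forall>j\<in>J. D j \<in> sets borel) \<longrightarrow>
        measure M {\<omega>\<in>space M. (\<lambda>k. R k \<omega>) \<in> B \<and> distinct_components (\<lambda>k. R k \<omega>) J
                     \<and> (\<forall>j\<in>J. C j \<omega> \<in> D j)}
        = measure M {\<omega>\<in>space M. (\<lambda>k. R k \<omega>) \<in> B \<and> distinct_components (\<lambda>k. R k \<omega>) J}
          * (\<Prod>j\<in>J. measure \<nu> (D j)))"

text \<open>\<open>X n g\<close> with \<open>g \<in> {1..d}\<close> is the \<open>g\<close>-th coordinate of the \<open>n\<close>-th random vector.\<close>
definition asymptotically_gaussian ::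
    "'w measure \<Rightarrow> nat \<Rightarrow> (nat \<Rightarrow> nat \<Rightarrow> 'w \<Rightarrow> real) \<Rightarrow> bool" where
  "asymptotically_gaussian M d X \<longleftrightarrow>
     (\<forall>n. \<forall>g\<in>{1..d}. X n g \<in> borel_measurable M \<and> integrable M (\<lambda>\<omega>. (X n g \<omega>)\<^sup>2)
                       \<and> prob_space.expectation M (X n g) = 0) \<and>
     (\<forall>\<beta> :: nat \<Rightarrow> real. (\<exists>g\<in>{1..d}. \<beta> g \<noteq> 0) \<longrightarrow>
        (let V = (\<lambda>n \<omega>. \<Sum>g=1..d. \<beta> g * X n g \<omega>) in
           (\<forall>\<^sub>F n in sequentially. prob_space.variance M (V n) > 0) \<and>
           weak_conv_m (\<lambda>n. distr M borel (\<lambda>\<omega>. V n \<omega> / sqrt (prob_space.variance M (V n))))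
             std_normal_distribution))"

definition colour_sum :: "(int \<Rightarrow> 'w \<Rightarrow> real) \<Rightarrow> nat \<Rightarrow> 'w \<Rightarrow> real" where
  "colour_sum C n \<omega> = (\<Sum>i=1..n. C (int i) \<omega>)"

end

theory Submission imports Defs begin

text \<open>
  Given the graph, the colours of different components are independent and centred. A linear
  combination of the partial sums is \<open>V = (\<Sum>i. b i * Y i)\<close> for a step function \<open>b\<close>, hence, given the graph,
  a sum of independent terms \<open>w c * Y c\<close>, one for each component \<open>c\<close>, where \<open>w c\<close> is the sum of \<open>b\<close>
  over \<open>c\<close>. Under either alternative on the colouring, the law of the colours is centred and not
  degenerate and has a finite fourth moment, so \<open>V\<close> is asymptotically Gaussian as soon as

  \<^item> the sum \<open>Z = (\<Sum>c. (w c)\<^sup>2)\<close>, to which the conditional variance is proportional, concentrates about its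
    mean \<open>m\<close>, and
  \<^item> no component contributes a positive fraction of it, in the sense that the expectation of
    \<open>\<Sum>c. (w c) ^ 4\<close> is of smaller order than \<open>m\<^sup>2\<close> (lemma \<open>char_estimate\<close>).

  Both reduce to one estimate on the graph: the expected number of quadruples of vertices of the window
  \<open>{1..n}\<close> that lie in one component is of smaller order than the square of \<open>n / H n\<^sup>2\<close>, the order of \<open>m\<close>,
  where \<open>H n\<close> is the probability of a jump of size at least \<open>n\<close>. The reduction of the
  concentration to this estimate rests on \<open>separate_product\<close>: if \<open>i, j\<close> are connected, and so
  are \<open>k, l\<close>, but the two components differ, then the two connections use disjoint sets of jumps, so the
  probability is at most the product of the two connection probabilities. Hence the covariance of the two
  connection events is at most the probability that all four vertices are connected.

  Two vertices lie in one component iff their ancestral lines meet. Ancestral lines are studied by revealing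
  the jump of the highest vertex first, and probabilities are compared with explicit functions of the
  vertices that are (super)harmonic for this step (\<open>coalescence_comparison\<close>). For two vertices this gives
  the exact formula \<open>P(i ~ j) = (\<Sum>z. q (i - z) * q (j - z)) / Q\<close>, where \<open>q\<close> is the sequence of renewal weights
  and \<open>Q = (\<Sum>k. (q k)\<^sup>2)\<close> (\<open>meet_eq_coal\<close>). For four vertices it gives the bound
  by a sum over binary trees with an edge weight \<open>q\<close> (\<open>coal_le_tree4\<close>).

  The analytic input is \<open>energy_bound\<close>: if \<open>u z\<close> is the sum of \<open>q (i - z)\<close> over the window, then
  \<open>(\<Sum>z. (u z)\<^sup>2)\<close> is at most a constant times \<open>n / H n\<^sup>2\<close>. By Parseval it is an integral of the squared Dirichlet
  kernel divided by \<open>\<bar>1 - \<phi>\<bar>\<^sup>2\<close>, where \<open>\<phi>\<close> is the characteristic function of the jumps. Regular variation and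
  aperiodicity give \<open>\<bar>1 - \<phi> \<theta>\<bar> \<ge> c * H (1 / \<theta>)\<close>, and \<open>\<alpha> < 1 / 2\<close> makes the integral converge at the origin. In
  particular \<open>q\<close> is square summable, so its autocorrelations vanish at infinity; together with the
  Cauchy-Schwarz inequality this makes the tree sums of smaller order than the square of the energy
  (\<open>tree_sums_negligible\<close>).

  For the matching lower bound on \<open>m\<close> the exact formula is essential: \<open>Q * m\<close> is the sum over \<open>z\<close> of the squares
  of \<open>\<Sum>i. b i * q (i - z)\<close>, and for \<open>z\<close> in the last interval on which \<open>b\<close> does not vanish there is no
  cancellation, whatever the signs of \<open>b\<close> elsewhere (\<open>quadratic_form_lower\<close>).
\<close>

section \<open>Jump tails and renewal weights\<close>

definition tail :: "nat pmf \<Rightarrow> nat \<Rightarrow> real" where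
  "tail \<mu> n = measure_pmf.prob \<mu> {n..}"

fun renewal :: "nat pmf \<Rightarrow> nat \<Rightarrow> real" where
  "renewal \<mu> n = (if n = 0 then 1 else \<Sum>k<n. pmf \<mu> (n - k) * renewal \<mu> k)"

declare renewal.simps [simp del]

lemma renewal_0 [simp]: "renewal \<mu> 0 = 1"
  by (simp add: renewal.simps)

lemma renewal_pos: "n > 0 \<Longrightarrow> renewal \<mu> n = (\<Sum>k<n. pmf \<mu> (n - k) * renewal \<mu> k)"
  by (subst renewal.simps) simp

lemma renewal_nonneg: "0 \<le> renewal \<mu> n"
proof (induction n rule: less_induct)
  case (less n)
  then show ?case
    by (cases "n = 0") (auto simp: renewal_pos intro!: sum_nonneg)
qed

lemma tail_nonneg: "0 \<le> tail \<mu> n"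
  by (simp add: tail_def)

lemma tail_le_1: "tail \<mu> n \<le> 1"
  by (simp add: tail_def)

lemma tail_antimono: "m \<le> n \<Longrightarrow> tail \<mu> n \<le> tail \<mu> m"
  unfolding tail_def by (intro measure_pmf.finite_measure_mono) auto

lemma tail_Suc: "tail \<mu> n = pmf \<mu> n + tail \<mu> (Suc n)"
proof -
  have "{n..} = {n} \<union> {Suc n..}" by auto
  then have "tail \<mu> n = measure_pmf.prob \<mu> {n} + measure_pmf.prob \<mu> {Suc n..}"
    unfolding tail_def by (simp only:) (rule measure_pmf.finite_measure_Union, auto)
  then show ?thesis by (simp add: tail_def measure_pmf_single)
qed

lemma tail_1: "pmf \<mu> 0 = 0 \<Longrightarrow> tail \<mu> 1 = 1"
proof -
  assume "pmf \<mu> 0 = 0"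
  moreover have "tail \<mu> 0 = 1" by (simp add: tail_def)
  ultimately show ?thesis using tail_Suc[of \<mu> 0] by simp
qed

text \<open>
  The renewal process started at \<open>0\<close> has exactly one last point \<open>k\<close> in \<open>{0..n}\<close>, after which it jumps beyond \<open>n\<close>.
\<close>
lemma renewal_last_before:
  assumes "pmf \<mu> 0 = 0"
  shows "(\<Sum>k\<le>n. renewal \<mu> k * tail \<mu> (Suc n - k)) = 1"
proof (induction n)
  case 0
  then show ?case using tail_1[OF assms] by simp
next
  case (Suc n)
  have "(\<Sum>k\<le>Suc n. renewal \<mu> k * tail \<mu> (Suc (Suc n) - k))
      = renewal \<mu> (Suc n) + (\<Sum>k\<le>n. renewal \<mu> k * tail \<mu> (Suc (Suc n) - k))"
    using tail_1[OF assms] by simp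
  also have "(\<Sum>k\<le>n. renewal \<mu> k * tail \<mu> (Suc (Suc n) - k))
      = (\<Sum>k\<le>n. renewal \<mu> k * tail \<mu> (Suc n - k) - pmf \<mu> (Suc n - k) * renewal \<mu> k)"
  proof (intro sum.cong refl)
    fix k assume "k \<in> {..n}"
    then have "tail \<mu> (Suc n - k) = pmf \<mu> (Suc n - k) + tail \<mu> (Suc (Suc n) - k)"
      by (subst tail_Suc) (simp add: Suc_diff_le)
    then show "renewal \<mu> k * tail \<mu> (Suc (Suc n) - k)
      = renewal \<mu> k * tail \<mu> (Suc n - k) - pmf \<mu> (Suc n - k) * renewal \<mu> k"
      by (simp add: algebra_simps)
  qed
  also have "\<dots> = 1 - renewal \<mu> (Suc n)"
    by (simp add: sum_subtractf Suc renewal_pos lessThan_Suc_atMost)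
  finally show ?case by simp
qed

lemma renewal_le_1:
  assumes "pmf \<mu> 0 = 0"
  shows "renewal \<mu> n \<le> 1"
proof -
  have "renewal \<mu> n * tail \<mu> (Suc n - n) \<le> (\<Sum>k\<le>n. renewal \<mu> k * tail \<mu> (Suc n - k))"
    by (rule member_le_sum) (auto intro: mult_nonneg_nonneg renewal_nonneg tail_nonneg)
  then show ?thesis using tail_1[OF assms] renewal_last_before[OF assms, of n] by simp
qed

text \<open>
  Sum \<open>renewal_last_before\<close> over all levels up to \<open>n\<close>: the point \<open>k\<close> is followed by at most the total of the first
  \<open>n + 1\<close> tails. So the expected number of renewals up to \<open>n\<close> is at least \<open>n\<close> over the truncated mean of a jump.
\<close>
lemma renewal_sum_lower:
  assumes "pmf \<mu> 0 = 0"
  shows "real (Suc n) \<le> (\<Sum>k\<le>n. renewal \<mu> k) * (\<Sum>i=1..Suc n. tail \<mu> i)"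
proof -
  have "real (Suc n) = (\<Sum>N\<le>n. \<Sum>k\<le>N. renewal \<mu> k * tail \<mu> (Suc N - k))"
    using renewal_last_before[OF assms] by simp
  also have "\<dots> = (\<Sum>k\<le>n. \<Sum>N=k..n. renewal \<mu> k * tail \<mu> (Suc N - k))"
    by (subst (1 2) sum.Sigma)
       (auto intro!: sum.reindex_bij_witness[of _ "\<lambda>(k, N). (N, k)" "\<lambda>(N, k). (k, N)"])
  also have "\<dots> \<le> (\<Sum>k\<le>n. renewal \<mu> k * (\<Sum>i=1..Suc n. tail \<mu> i))"
  proof (intro sum_mono)
    fix k assume k: "k \<in> {..n}"
    have "(\<Sum>N=k..n. tail \<mu> (Suc N - k)) = (\<Sum>i=1..Suc n - k. tail \<mu> i)"
      using k by (intro sum.reindex_bij_witness[of _ "\<lambda>i. i + k - 1" "\<lambda>N. Suc N - k"]) auto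
    also have "\<dots> \<le> (\<Sum>i=1..Suc n. tail \<mu> i)"
      by (rule sum_mono2) (auto intro: tail_nonneg)
    finally show "(\<Sum>N=k..n. renewal \<mu> k * tail \<mu> (Suc N - k))
        \<le> renewal \<mu> k * (\<Sum>i=1..Suc n. tail \<mu> i)"
      by (simp add: sum_distrib_left[symmetric] mult_left_mono renewal_nonneg)
  qed
  finally show ?thesis by (simp add: sum_distrib_right)
qed

text \<open>
  Potter's bound. A decay by at most the factor \<open>2 powr (- a)\<close> under doubling of the argument, from some
  argument on, gives a decay no faster than the power \<open>- a\<close> by iteration; the constant \<open>\<kappa>\<close> absorbs the
  rounding to powers of two and the initial arguments.
\<close>
lemma potter_from_doubling:
  fixes H :: "nat \<Rightarrow> real"
  assumes anti: "\<And>m n. m \<le> n \<Longrightarrow> H n \<le> H m" and pos: "\<And>n. 0 < H n" and le1: "\<And>n. H n \<le> 1"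
    and a: "0 < a"
    and dbl: "\<forall>\<^sub>F n in sequentially. 2 powr (-a) * H n \<le> H (2 * n)"
  shows "\<exists>\<kappa>>0. \<forall>n\<ge>1. \<forall>x\<ge>n. \<kappa> * (real n / real x) powr a * H n \<le> H x"
proof -
  obtain n0 where n0: "\<And>n. n \<ge> n0 \<Longrightarrow> 2 powr (-a) * H n \<le> H (2 * n)" and n01: "1 \<le> n0"
    using dbl unfolding eventually_sequentially by (metis nat_le_linear le_trans)
  let ?c = "2 powr (-a)"
  have main: "?c * (real n / real x) powr a * H n \<le> H x" if "n \<ge> n0" "n \<le> x" for n x
    using that
  proof (induction "x - n" arbitrary: n rule: less_induct)
    case less
    have n1: "1 \<le> n" using less n01 by simp
    show ?case
    proof (cases "x \<le> 2 * n")
      case True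
      have "(real n / real x) powr a \<le> 1 powr a"
        using n1 less a by (intro powr_mono2) auto
      then have "?c * (real n / real x) powr a * H n \<le> ?c * 1 * H n"
        using pos[of n] by (intro mult_right_mono mult_left_mono) auto
      also have "\<dots> \<le> H (2 * n)" using n0[of n] less by simp
      also have "\<dots> \<le> H x" using True by (rule anti)
      finally show ?thesis .
    next
      case False
      have "?c * (real (2 * n) / real x) powr a * H (2 * n) \<le> H x"
        using False less n1 by (intro less.hyps) auto
      moreover have "(real (2 * n) / real x) powr a = 2 powr a * (real n / real x) powr a"
        by (simp add: powr_mult powr_divide)
      moreover have "2 powr a * ?c = 1" by (simp add: powr_minus)
      ultimately have "?c * (2 powr a * (real n / real x) powr a) * H (2 * n) \<le> H x" by simp
      moreover have "?c * (2 powr a * (real n / real x) powr a) * H (2 * n)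
          = (2 powr a * ?c) * ((real n / real x) powr a * H (2 * n))" by (simp only: mult_ac)
      ultimately have "(real n / real x) powr a * H (2 * n) \<le> H x"
        using \<open>2 powr a * ?c = 1\<close> by simp
      moreover have "(real n / real x) powr a * (?c * H n) \<le> (real n / real x) powr a * H (2 * n)"
        using n0[of n] less by (intro mult_left_mono) auto
      ultimately show ?thesis by (simp add: mult_ac)
    qed
  qed
  have "?c * H n0 * (real n / real x) powr a * H n \<le> H x" if "1 \<le> n" "n \<le> x" for n x
  proof -
    have c1: "?c \<le> 1" using a powr_mono[of "-a" 0 "2::real"] by simp
    have p1: "(real n / real x) powr a \<le> 1 powr a"
      using that a by (intro powr_mono2) auto
    consider "n0 \<le> n" | "n < n0" "x \<le> n0" | "n < n0" "n0 < x" by linarith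
    then show ?thesis
    proof cases
      case 1
      have "?c * H n0 * (real n / real x) powr a * H n = H n0 * (?c * (real n / real x) powr a * H n)"
        by simp
      also have "\<dots> \<le> 1 * (?c * (real n / real x) powr a * H n)"
        using pos[of n] by (intro mult_right_mono le1) auto
      also have "\<dots> \<le> H x" using main[OF 1 that(2)] by simp
      finally show ?thesis .
    next
      case 2
      have "?c * H n0 * (real n / real x) powr a * H n \<le> 1 * H n0 * 1 * 1"
        using pos c1 p1 le1 by (intro mult_mono) (auto simp: less_imp_le)
      also have "\<dots> \<le> H x" using anti[OF 2(2)] by simp
      finally show ?thesis .
    next
      case 3
      have "?c * H n0 * (real n / real x) powr a * H n \<le> ?c * H n0 * (real n0 / real x) powr a * 1"
      proof (rule mult_mono)
        have "(real n / real x) powr a \<le> (real n0 / real x) powr a"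
          using 3 a by (intro powr_mono2 divide_right_mono) auto
        then show "?c * H n0 * (real n / real x) powr a \<le> ?c * H n0 * (real n0 / real x) powr a"
          using less_imp_le[OF pos] by (intro mult_left_mono) auto
      qed (use le1 less_imp_le[OF pos] in auto)
      also have "\<dots> \<le> H x" using main[of n0 x] 3 by (simp add: mult_ac)
      finally show ?thesis .
    qed
  qed
  moreover have "0 < ?c * H n0" using pos by simp
  ultimately show ?thesis by blast
qed

lemma sum_inverse_sqrt_le: "(\<Sum>i=1..n. 1 / sqrt (real i)) \<le> 2 * sqrt (real n)"
proof (induction n)
  case (Suc n)
  have "sqrt (real n) * sqrt (real (Suc n)) \<le> (real n + real (Suc n)) / 2"
    using arith_geo_mean_sqrt[of "real n" "real (Suc n)"] by (simp add: real_sqrt_mult)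
  moreover have "sqrt (real (Suc n)) * sqrt (real (Suc n)) = real (Suc n)" by simp
  ultimately have "2 * sqrt (real n) * sqrt (real (Suc n)) + 1 \<le> 2 * sqrt (real (Suc n)) * sqrt (real (Suc n))"
    by (simp only: mult.assoc) simp
  then have "2 * sqrt (real n) + 1 / sqrt (real (Suc n)) \<le> 2 * sqrt (real (Suc n))"
    by (simp add: field_simps)
  then show ?case using Suc by simp
qed simp

section \<open>Bessel's inequality for trigonometric series\<close>

lemma cis_uniform:
  fixes c :: "nat \<Rightarrow> complex"
  assumes "summable (\<lambda>k. norm (c k))"
  shows "uniform_limit A (\<lambda>n \<theta>. \<Sum>k<n. c k * cis (real k * \<theta>)) (\<lambda>\<theta>. \<Sum>k. c k * cis (real k * \<theta>)) sequentially"
  by (rule Weierstrass_m_test_ev[where M = "\<lambda>k. norm (c k)"]) (auto simp: norm_mult assms)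

lemma integral_cis_period:
  fixes m :: int
  shows "((\<lambda>\<theta>. cis (real_of_int m * \<theta>)) has_integral of_real (if m = 0 then 2 * pi else 0)) {-pi..pi}"
proof (cases "m = 0")
  case True
  have "((\<lambda>\<theta>::real. 1::complex) has_integral (of_real (pi - (-pi)))) {-pi..pi}"
    using has_integral_const_real[of "1::complex" "-pi" pi] by (simp add: scaleR_conv_of_real)
  then show ?thesis using True by simp
next
  case False
  define F where "F \<theta> = cis (real_of_int m * \<theta>) / (\<i> * of_int m)" for \<theta>
  have "((\<lambda>\<theta>. cis (real_of_int m * \<theta>)) has_integral (F pi - F (-pi))) {-pi..pi}"
  proof (rule fundamental_theorem_of_calculus)
    fix x assume "x \<in> {-pi..pi}"
    have *: "- (\<i> * (z * \<i>)) = z" for z :: complex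
      by (simp add: mult.commute[of z] flip: mult.assoc)
    show "(F has_vector_derivative cis (real_of_int m * x)) (at x within {-pi..pi})"
      unfolding F_def cis_conv_exp using False
      by (auto intro!: derivative_eq_intros has_vector_derivative_real_field simp: *)
  qed simp
  moreover have "F pi = F (-pi)"
  proof -
    have "sin (real_of_int m * pi) = 0" by (auto simp: sin_zero_iff_int2)
    then have "cis (real_of_int m * pi) = cis (real_of_int m * (- pi))" by (simp add: complex_eq_iff)
    then show ?thesis by (simp only: F_def)
  qed
  ultimately show ?thesis using False by simp
qed

lemma trig_poly_norm_integral:
  fixes c :: "nat \<Rightarrow> real"
  shows "((\<lambda>\<theta>. (norm (\<Sum>k<n. of_real (c k) * cis (real k * \<theta>)))\<^sup>2) has_integral
           (2 * pi * (\<Sum>k<n. (c k)\<^sup>2))) {-pi..pi}"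
proof -
  have "((\<lambda>\<theta>. \<Sum>k<n. \<Sum>l<n. of_real (c k * c l) * cis (real_of_int (int k - int l) * \<theta>)) has_integral
          (\<Sum>k<n. \<Sum>l<n. of_real (c k * c l) * of_real (if int k - int l = 0 then 2 * pi else 0))) {-pi..pi}"
    by (intro has_integral_sum has_integral_mult_right integral_cis_period) auto
  moreover have "(\<Sum>k<n. \<Sum>l<n. of_real (c k * c l) * of_real (if int k - int l = 0 then 2 * pi else 0))
      = (of_real (2 * pi * (\<Sum>k<n. (c k)\<^sup>2)) :: complex)"
  proof -
    have "(\<Sum>l<n. of_real (c k * c l) * of_real (if int k - int l = 0 then 2 * pi else 0))
        = (of_real (2 * pi * (c k)\<^sup>2) :: complex)" if "k < n" for k
    proof -
      have "(\<Sum>l<n. of_real (c k * c l) * of_real (if int k - int l = 0 then 2 * pi else 0))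
          = (\<Sum>l<n. if l = k then (of_real (2 * pi * (c k)\<^sup>2) :: complex) else 0)"
        by (intro sum.cong) (auto simp: power2_eq_square)
      then show ?thesis using that by simp
    qed
    then show ?thesis by (simp add: sum_distrib_left)
  qed
  moreover have "(\<Sum>k<n. \<Sum>l<n. of_real (c k * c l) * cis (real_of_int (int k - int l) * \<theta>))
      = (of_real ((norm (\<Sum>k<n. of_real (c k) * cis (real k * \<theta>)))\<^sup>2) :: complex)" for \<theta>
  proof -
    have "of_real ((norm (\<Sum>k<n. of_real (c k) * cis (real k * \<theta>)))\<^sup>2)
        = (\<Sum>k<n. of_real (c k) * cis (real k * \<theta>)) * cnj (\<Sum>k<n. of_real (c k) * cis (real k * \<theta>))"
      by (rule complex_norm_square)
    also have "\<dots> = (\<Sum>k<n. \<Sum>l<n. of_real (c k * c l) * (cis (real k * \<theta>) * cis (- (real l * \<theta>))))"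
      by (simp add: sum_product cis_cnj mult_ac)
    also have "\<dots> = (\<Sum>k<n. \<Sum>l<n. of_real (c k * c l) * cis (real_of_int (int k - int l) * \<theta>))"
      by (simp add: cis_mult algebra_simps)
    finally show ?thesis by simp
  qed
  ultimately have "((\<lambda>\<theta>. of_real ((norm (\<Sum>k<n. of_real (c k) * cis (real k * \<theta>)))\<^sup>2) :: complex)
      has_integral of_real (2 * pi * (\<Sum>k<n. (c k)\<^sup>2))) {-pi..pi}"
    by simp
  from has_integral_linear[OF this bounded_linear_Re] show ?thesis by (simp add: o_def)
qed

text \<open>
  Partial sums satisfy Parseval's identity and converge uniformly. The point \<open>0\<close> is excluded because the majorants used
  below are singular there.
\<close>
lemma bessel:
  fixes c :: "nat \<Rightarrow> real"
  assumes c: "summable (\<lambda>k. \<bar>c k\<bar>)"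
    and g: "(g has_integral J) {-pi..pi}"
    and le: "\<And>\<theta>. \<theta> \<in> {-pi..pi} \<Longrightarrow> \<theta> \<noteq> 0 \<Longrightarrow> (norm (\<Sum>k. of_real (c k) * cis (real k * \<theta>)))\<^sup>2 \<le> g \<theta>"
  shows "(\<Sum>k<n. (c k)\<^sup>2) \<le> J / (2 * pi)"
proof -
  let ?f = "\<lambda>n \<theta>. \<Sum>k<n. of_real (c k) * cis (real k * \<theta>)"
  let ?F = "\<lambda>\<theta>. \<Sum>k. of_real (c k) * cis (real k * \<theta>)"
  have u: "uniform_limit {-pi..pi} (\<lambda>n \<theta>. norm (?f n \<theta>)) (\<lambda>\<theta>. norm (?F \<theta>)) sequentially"
    by (intro uniform_limit_norm cis_uniform) (simp add: c)
  have "norm (?F \<theta>) \<le> (\<Sum>k. \<bar>c k\<bar>)" for \<theta>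
    using summable_norm[of "\<lambda>k. of_real (c k) * cis (real k * \<theta>)"] c by (simp add: norm_mult)
  then have b: "bounded ((\<lambda>\<theta>. norm (?F \<theta>)) ` {-pi..pi})"
    by (intro boundedI[where B = "\<Sum>k. \<bar>c k\<bar>"]) auto
  have u2: "uniform_limit {-pi..pi} (\<lambda>n \<theta>. (norm (?f n \<theta>))\<^sup>2) (\<lambda>\<theta>. (norm (?F \<theta>))\<^sup>2) sequentially"
    unfolding power2_eq_square by (intro uniform_lim_mult u b)
  have cont: "continuous_on {-pi..pi} (\<lambda>\<theta>. (norm (?f n \<theta>))\<^sup>2)" for n
    unfolding cis_conv_exp by (intro continuous_intros)
  from uniform_limit_integral[OF u2 cont] obtain I K where
    I: "\<And>n. ((\<lambda>\<theta>. (norm (?f n \<theta>))\<^sup>2) has_integral I n) {-pi..pi}"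
    and K: "((\<lambda>\<theta>. (norm (?F \<theta>))\<^sup>2) has_integral K) {-pi..pi}" and lim: "I \<longlonglongrightarrow> K"
    by auto
  have Ieq: "I n = 2 * pi * (\<Sum>k<n. (c k)\<^sup>2)" for n
    using has_integral_unique[OF I trig_poly_norm_integral] .
  have "I n \<le> K"
    by (rule incseq_le[OF _ lim]) (auto simp: Ieq incseq_def intro!: sum_mono2)
  also have "K \<le> J"
  proof (rule has_integral_le[OF K])
    show "((g(0 := (norm (?F 0))\<^sup>2)) has_integral J) {-pi..pi}"
      by (rule has_integral_spike_finite[OF _ _ g, of "{0}"]) auto
  qed (auto intro: le)
  finally show ?thesis by (simp add: Ieq field_simps)
qed

section \<open>The characteristic function of the jump law\<close>

lemma pmf_sum_tail: "(\<Sum>k=x..<x + m. pmf \<mu> k) = tail \<mu> x - tail \<mu> (x + m)"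
proof (induction m)
  case (Suc m)
  then show ?case using tail_Suc[of \<mu> "x + m"] by simp
qed simp

lemma tail_tendsto_0: "tail \<mu> \<longlonglongrightarrow> 0"
proof -
  have "(\<lambda>n. measure_pmf.prob \<mu> {n..}) \<longlonglongrightarrow> measure_pmf.prob \<mu> (\<Inter>n. {n..})"
    by (rule measure_pmf.finite_Lim_measure_decseq) (auto simp: decseq_def)
  moreover have "(\<Inter>n::nat. {n..}) = {}"
  proof (rule equals0I)
    fix y :: nat assume "y \<in> (\<Inter>n. {n..})"
    then have "y \<in> {Suc y..}" by (rule INT_D) simp
    then show False by simp
  qed
  ultimately show ?thesis by (simp add: tail_def[abs_def])
qed

lemma pmf_nat_sums: "pmf \<mu> sums (1::real)"
proof -
  have "(\<lambda>n. 1 - tail \<mu> n) \<longlonglongrightarrow> 1 - 0" by (intro tendsto_intros tail_tendsto_0)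
  moreover have "(\<Sum>k<n. pmf \<mu> k) = 1 - tail \<mu> n" for n
    using pmf_sum_tail[of \<mu> 0 n] by (simp add: tail_def atLeast0LessThan)
  ultimately show ?thesis by (simp add: sums_def)
qed

text \<open>
  On \<open>{0..1}\<close> by the mean value theorem, on the rest of the quarter period by monotonicity of the sine.
\<close>
lemma sin_lower_linear:
  assumes "0 \<le> x" "x \<le> pi / 2"
  shows "cos 1 / 2 * x \<le> sin x"
proof (cases "x \<le> 1")
  case True
  show ?thesis
  proof (cases "x = 0")
    case False
    then have "\<exists>z>0. z < x \<and> sin x - sin 0 = (x - 0) * cos z"
      using assms by (intro MVT2) (auto intro!: derivative_eq_intros)
    then obtain z where z: "0 < z" "z < x" "sin x = x * cos z" by auto
    have "cos 1 \<le> cos z"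
      using z True pi_gt3 by (intro cos_monotone_0_pi_le) auto
    moreover have "0 < cos (1::real)" using pi_gt3 by (intro cos_gt_zero) auto
    ultimately have "cos 1 / 2 \<le> cos z" by simp
    then show ?thesis using z assms(1) mult_left_mono[of "cos 1 / 2" "cos z" x] by (simp add: mult.commute)
  qed simp
next
  case False
  have "\<exists>z>0. z < 1 \<and> sin 1 - sin 0 = (1 - 0) * cos (z::real)"
    by (intro MVT2) (auto intro!: derivative_eq_intros)
  then obtain z :: real where z: "0 < z" "z < 1" "sin 1 = cos z" by auto
  have "cos 1 \<le> cos z"
    using z pi_gt3 by (intro cos_monotone_0_pi_le) auto
  also have "cos z = sin 1" using z by simp
  also have "\<dots> \<le> sin x"
    using False assms pi_gt3 by (intro sin_monotone_2pi_le) auto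
  finally have *: "cos 1 \<le> sin x" .
  have "0 < cos (1::real)" using pi_gt3 by (intro cos_gt_zero) auto
  moreover have "x \<le> 2" using assms pi_less_4 by simp
  ultimately have "cos 1 / 2 * x \<le> cos 1 / 2 * 2" by (intro mult_left_mono) auto
  with * show ?thesis by simp
qed

lemma norm_one_minus_cis:
  assumes "\<bar>\<theta>\<bar> \<le> pi"
  shows "cos 1 / 2 * \<bar>\<theta>\<bar> \<le> norm (1 - cis \<theta>)"
proof -
  have "(norm (1 - cis \<theta>))\<^sup>2 = (1 - cos \<theta>)\<^sup>2 + (sin \<theta>)\<^sup>2"
    by (simp add: cmod_power2)
  also have "\<dots> = 2 - 2 * cos \<theta>"
    using sin_cos_squared_add[of \<theta>] by (simp add: power2_eq_square algebra_simps)
  also have "cos \<theta> = 1 - 2 * (sin (\<theta> / 2))\<^sup>2"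
    using cos_double_sin[of "\<theta> / 2"] by simp
  finally have "(norm (1 - cis \<theta>))\<^sup>2 = (2 * sin (\<bar>\<theta>\<bar> / 2))\<^sup>2"
    by (cases "\<theta> \<ge> 0") (auto simp: power2_eq_square)
  moreover have "0 \<le> sin (\<bar>\<theta>\<bar> / 2)" using assms by (intro sin_ge_zero) auto
  ultimately have "norm (1 - cis \<theta>) = 2 * sin (\<bar>\<theta>\<bar> / 2)"
    by (metis mult_nonneg_nonneg norm_ge_zero power2_eq_imp_eq zero_le_numeral)
  moreover have "cos 1 / 2 * (\<bar>\<theta>\<bar> / 2) \<le> sin (\<bar>\<theta>\<bar> / 2)"
    using assms by (intro sin_lower_linear) auto
  ultimately show ?thesis by simp
qed

lemma dirichlet_kernel_bounds:
  assumes "\<bar>\<theta>\<bar> \<le> pi" "\<theta> \<noteq> 0"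
  shows "norm (\<Sum>i<n. cis (real i * \<theta>)) \<le> real n"
    and "norm (\<Sum>i<n. cis (real i * \<theta>)) \<le> 4 / (cos 1 * \<bar>\<theta>\<bar>)"
proof -
  show "norm (\<Sum>i<n. cis (real i * \<theta>)) \<le> real n"
    using norm_sum[of "\<lambda>i. cis (real i * \<theta>)" "{..<n}"] by simp
  have c: "0 < cos (1::real)" using pi_gt3 by (intro cos_gt_zero) auto
  have l: "0 < cos 1 / 2 * \<bar>\<theta>\<bar>" using c assms by simp
  have ne: "cis \<theta> \<noteq> 1" using norm_one_minus_cis[OF assms(1)] l by auto
  have "(\<Sum>i<n. cis (real i * \<theta>)) = (\<Sum>i<n. cis \<theta> ^ i)"
    by (intro sum.cong refl) (simp only: Complex.DeMoivre of_nat_mult)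
  also have "\<dots> = (1 - cis \<theta> ^ n) / (1 - cis \<theta>)"
    using ne by (simp add: sum_gp_strict)
  finally have "norm (\<Sum>i<n. cis (real i * \<theta>)) = norm (1 - cis \<theta> ^ n) / norm (1 - cis \<theta>)"
    by (simp add: norm_divide)
  also have "\<dots> \<le> 2 / (cos 1 / 2 * \<bar>\<theta>\<bar>)"
  proof (intro frac_le l norm_one_minus_cis assms)
    have "norm (1 - cis \<theta> ^ n) \<le> norm (1::complex) + norm (cis \<theta> ^ n)" by (rule norm_triangle_ineq4)
    then show "norm (1 - cis \<theta> ^ n) \<le> 2" by (simp add: norm_power)
  qed simp
  finally show "norm (\<Sum>i<n. cis (real i * \<theta>)) \<le> 4 / (cos 1 * \<bar>\<theta>\<bar>)" by simp
qed

text \<open>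
  The real part of one minus the characteristic function of \<open>\<mu>\<close>.
\<close>
definition symbol_gap :: "nat pmf \<Rightarrow> real \<Rightarrow> real" where
  "symbol_gap \<mu> \<theta> = (\<Sum>k. pmf \<mu> k * (1 - cos (real k * \<theta>)))"

lemma symbol_gap_summable: "summable (\<lambda>k. pmf \<mu> k * (1 - cos (real k * \<theta>)))"
proof (rule summable_comparison_test')
  show "summable (\<lambda>k. pmf \<mu> k * 2)" using pmf_nat_sums[of \<mu>] by (intro summable_mult2) (simp add: sums_iff)
  show "norm (pmf \<mu> k * (1 - cos (real k * \<theta>))) \<le> pmf \<mu> k * 2" for k
    using cos_ge_minus_one[of "real k * \<theta>"] by (auto simp: abs_mult intro!: mult_left_mono)
qed

lemma symbol_gap_term_nonneg: "0 \<le> pmf \<mu> k * (1 - cos (real k * \<theta>))"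
  by (intro mult_nonneg_nonneg) auto

lemma symbol_gap_continuous: "continuous_on A (symbol_gap \<mu>)"
proof -
  have "uniform_limit A (\<lambda>n \<theta>. \<Sum>k<n. pmf \<mu> k * (1 - cos (real k * \<theta>)))
      (\<lambda>\<theta>. \<Sum>k. pmf \<mu> k * (1 - cos (real k * \<theta>))) sequentially"
  proof (rule Weierstrass_m_test_ev[where M = "\<lambda>k. pmf \<mu> k * 2"])
    show "summable (\<lambda>k. pmf \<mu> k * 2)" using pmf_nat_sums[of \<mu>] by (intro summable_mult2) (simp add: sums_iff)
    have "norm (pmf \<mu> k * (1 - cos (real k * \<theta>))) \<le> pmf \<mu> k * 2" for k \<theta>
      using cos_ge_minus_one[of "real k * \<theta>"] by (auto simp: abs_mult intro!: mult_left_mono)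
    then show "\<forall>\<^sub>F n in sequentially. \<forall>x\<in>A. norm (pmf \<mu> n * (1 - cos (real n * x))) \<le> pmf \<mu> n * 2"
      by simp
  qed
  then show ?thesis
    unfolding symbol_gap_def[abs_def]
    by (rule uniform_limit_theorem[rotated]) (auto intro!: always_eventually continuous_intros)
qed

lemma symbol_gap_even: "symbol_gap \<mu> (- \<theta>) = symbol_gap \<mu> \<theta>"
  by (simp add: symbol_gap_def)

text \<open>
  If the gap vanished at \<open>\<theta>\<close>, then \<open>k * \<theta>\<close> would be a multiple of \<open>2 * pi\<close> for every possible jump \<open>k\<close>. The
  integers with this property form a subgroup, which contains \<open>1\<close> because the possible jumps have no common
  divisor.
\<close>
lemma symbol_gap_pos:
  assumes gcd: "Gcd {n. pmf \<mu> n > 0} = 1" and \<theta>: "0 < \<bar>\<theta>\<bar>" "\<bar>\<theta>\<bar> \<le> pi"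
  shows "0 < symbol_gap \<mu> \<theta>"
proof (rule ccontr)
  assume "\<not> 0 < symbol_gap \<mu> \<theta>"
  moreover have "0 \<le> symbol_gap \<mu> \<theta>"
    unfolding symbol_gap_def by (intro suminf_nonneg symbol_gap_summable symbol_gap_term_nonneg)
  ultimately have "symbol_gap \<mu> \<theta> = 0" by simp
  then have z: "pmf \<mu> k * (1 - cos (real k * \<theta>)) = 0" for k
    unfolding symbol_gap_def
    by (subst (asm) suminf_eq_zero_iff) (auto intro: symbol_gap_summable symbol_gap_term_nonneg)
  define D where "D = {k::nat. \<exists>n::int. real k * \<theta> = n * 2 * pi}"
  have supp: "k \<in> D" if "pmf \<mu> k > 0" for k
    using z[of k] that by (simp add: D_def flip: cos_one_2pi_int)
  have "\<exists>k>0. pmf \<mu> k > 0"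
  proof (rule ccontr)
    assume "\<not> ?thesis"
    then have "{n. pmf \<mu> n > 0} \<subseteq> {0}" by auto
    then have "Gcd {n. pmf \<mu> n > 0} = 0" by (auto simp: Gcd_0_iff)
    then show False using gcd by simp
  qed
  then obtain k0 where k0: "0 < k0" "k0 \<in> D" using supp by auto
  \<comment> \<open>The generator of the subgroup of all \<open>k\<close> for which \<open>k * \<theta>\<close> is a multiple of the period.\<close>
  define s where "s = (LEAST s. 0 < s \<and> s \<in> D)"
  have s: "0 < s" "s \<in> D" and s_le: "\<And>k. 0 < k \<Longrightarrow> k \<in> D \<Longrightarrow> s \<le> k"
    using LeastI[of "\<lambda>s. 0 < s \<and> s \<in> D" k0] Least_le[of "\<lambda>s. 0 < s \<and> s \<in> D"] k0
    by (auto simp: s_def)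
  have "s dvd k" if k: "pmf \<mu> k > 0" for k
  proof -
    obtain n m :: int where n: "real k * \<theta> = n * 2 * pi" and m: "real s * \<theta> = m * 2 * pi"
      using supp[OF k] s by (auto simp: D_def)
    have "real (k mod s) = real k - real (k div s) * real s"
      by (metis add_diff_cancel_left' mod_div_decomp of_nat_add of_nat_mult)
    then have "real (k mod s) * \<theta> = real k * \<theta> - real (k div s) * (real s * \<theta>)"
      by (simp only: left_diff_distrib mult.assoc)
    also have "\<dots> = of_int (n - int (k div s) * m) * 2 * pi"
      unfolding n m by (simp add: left_diff_distrib)
    finally have "k mod s \<in> D" unfolding D_def by blast
    then have "k mod s = 0" using s_le[of "k mod s"] s(1) by (metis mod_less_divisor not_less neq0_conv)
    then show ?thesis by auto
  qed
  then have "s dvd Gcd {n. pmf \<mu> n > 0}" by (intro Gcd_greatest) auto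
  then have "s = 1" using gcd by simp
  then obtain n :: int where n: "\<theta> = n * 2 * pi" using s(2) by (auto simp: D_def)
  then have "n \<noteq> 0" using \<theta> by auto
  then have "1 \<le> \<bar>real_of_int n\<bar>" by linarith
  then have "1 * (2 * pi) \<le> \<bar>real_of_int n\<bar> * (2 * pi)" by (intro mult_right_mono) auto
  then have "2 * pi \<le> \<bar>\<theta>\<bar>" by (simp add: n abs_mult mult.assoc)
  then show False using \<theta> pi_gt_zero by linarith
qed

text \<open>
  Near the origin the jumps of size between \<open>1 / \<theta>\<close> and \<open>2 / \<theta>\<close> contribute a fixed fraction of their
  probability, and this is a fixed fraction of the tail at \<open>1 / \<theta>\<close>. Away from the origin the gap is bounded below
  by compactness.
\<close>
lemma symbol_gap_ge_tail:
  assumes gcd: "Gcd {n. pmf \<mu> n > 0} = 1"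
    and c0: "0 < c0" and drop: "\<forall>\<^sub>F n in sequentially. c0 * tail \<mu> n \<le> tail \<mu> n - tail \<mu> (2 * n)"
  shows "\<exists>c>0. \<forall>\<theta>. 0 < \<bar>\<theta>\<bar> \<longrightarrow> \<bar>\<theta>\<bar> \<le> pi \<longrightarrow> c * tail \<mu> (nat \<lceil>1 / \<bar>\<theta>\<bar>\<rceil>) \<le> symbol_gap \<mu> \<theta>"
proof -
  obtain N0 where N0: "\<And>n. n \<ge> N0 \<Longrightarrow> c0 * tail \<mu> n \<le> tail \<mu> n - tail \<mu> (2 * n)"
    using drop unfolding eventually_sequentially by auto
  \<comment> \<open>\<open>\<theta>0\<close> keeps \<open>2 + 2 * \<theta>\<close> below \<open>pi\<close> and \<open>1 / \<theta>\<close> in the range where the tail drops under doubling.\<close>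
  define \<theta>0 where "\<theta>0 = min (1 / 2) (1 / real (Suc N0))"
  have "\<theta>0 \<le> 1 / 2" unfolding \<theta>0_def by (rule min.cobounded1)
  then have \<theta>0: "0 < \<theta>0" "\<theta>0 \<le> pi" using pi_gt3 by (auto simp: \<theta>0_def)
  have "\<exists>x\<in>{\<theta>0..pi}. \<forall>y\<in>{\<theta>0..pi}. symbol_gap \<mu> x \<le> symbol_gap \<mu> y"
    using \<theta>0 by (intro continuous_attains_inf symbol_gap_continuous) auto
  then obtain x0 where x0: "x0 \<in> {\<theta>0..pi}" "\<And>y. y\<in>{\<theta>0..pi} \<Longrightarrow> symbol_gap \<mu> x0 \<le> symbol_gap \<mu> y"
    by auto
  have g0: "0 < symbol_gap \<mu> x0" using x0 \<theta>0 by (intro symbol_gap_pos gcd) auto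
  have cos1: "cos 1 < (1::real)" using cos_monotone_0_pi[of 0 1] pi_gt3 by simp
  define c where "c = min (symbol_gap \<mu> x0) ((1 - cos 1) * c0)"
  have c: "0 < c" using g0 cos1 c0 by (simp add: c_def)
  have pos: "c * tail \<mu> (nat \<lceil>1 / \<theta>\<rceil>) \<le> symbol_gap \<mu> \<theta>" if "0 < \<theta>" "\<theta> \<le> pi" for \<theta>
  proof (cases "\<theta> \<ge> \<theta>0")
    case True
    have "c * tail \<mu> (nat \<lceil>1 / \<theta>\<rceil>) \<le> c * 1" using c by (intro mult_left_mono tail_le_1) auto
    also have "\<dots> \<le> symbol_gap \<mu> x0" by (simp add: c_def)
    also have "\<dots> \<le> symbol_gap \<mu> \<theta>" using True that by (intro x0) auto
    finally show ?thesis .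
  next
    case False
    define x where "x = nat \<lceil>1 / \<theta>\<rceil>"
    have t: "\<theta> < 1 / 2" "\<theta> < 1 / real (Suc N0)" using False by (auto simp: \<theta>0_def)
    have x1: "1 / \<theta> \<le> real x" and x2: "real x \<le> 1 / \<theta> + 1"
      using that by (auto simp: x_def intro: of_nat_ceiling)
    have "real (Suc N0) < 1 / \<theta>" using t(2) that by (simp add: field_simps)
    then have "N0 \<le> x" using x1 by linarith
    note N0[OF this]
    have "c * tail \<mu> x \<le> (1 - cos 1) * c0 * tail \<mu> x"
      by (intro mult_right_mono tail_nonneg) (simp add: c_def)
    also have "\<dots> = (1 - cos 1) * (c0 * tail \<mu> x)" by simp
    also have "\<dots> \<le> (1 - cos 1) * (tail \<mu> x - tail \<mu> (2 * x))"
      using cos1 \<open>c0 * _ \<le> _\<close> by (intro mult_left_mono) auto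
    also have "\<dots> = (1 - cos 1) * (\<Sum>k=x..<x + x. pmf \<mu> k)"
      by (simp add: pmf_sum_tail mult_2)
    also have "\<dots> = (\<Sum>k=x..<x + x. pmf \<mu> k * (1 - cos 1))"
      by (simp add: sum_distrib_left mult.commute)
    also have "\<dots> \<le> (\<Sum>k=x..<x + x. pmf \<mu> k * (1 - cos (real k * \<theta>)))"
    proof (intro sum_mono mult_left_mono)
      fix k assume k: "k \<in> {x..<x + x}"
      have "1 \<le> real x * \<theta>" using x1 that by (simp add: field_simps)
      also have "\<dots> \<le> real k * \<theta>" using k that by (intro mult_right_mono) auto
      finally have "1 \<le> real k * \<theta>" .
      moreover have "real k * \<theta> \<le> pi"
      proof -
        have "real k * \<theta> \<le> (2 * (1 / \<theta> + 1)) * \<theta>" using k that x2 by (intro mult_right_mono) auto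
        also have "\<dots> = 2 + 2 * \<theta>" using that by (simp add: field_simps)
        finally show ?thesis using t pi_gt3 by simp
      qed
      ultimately show "1 - cos 1 \<le> 1 - cos (real k * \<theta>)"
        using cos_monotone_0_pi_le[of 1 "real k * \<theta>"] by simp
    qed auto
    also have "\<dots> \<le> symbol_gap \<mu> \<theta>"
      unfolding symbol_gap_def by (intro sum_le_suminf symbol_gap_summable) (auto intro: symbol_gap_term_nonneg)
    finally show ?thesis by (simp add: x_def)
  qed
  have "c * tail \<mu> (nat \<lceil>1 / \<bar>\<theta>\<bar>\<rceil>) \<le> symbol_gap \<mu> \<theta>" if "0 < \<bar>\<theta>\<bar>" "\<bar>\<theta>\<bar> \<le> pi" for \<theta>
    using pos[of "\<bar>\<theta>\<bar>"] that symbol_gap_even[of \<mu> \<theta>] by (cases "\<theta> > 0") auto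
  then show ?thesis using c by blast
qed

section \<open>Square sums of renewal weights over a window\<close>

text \<open>
  The generating function \<open>F\<close> of the renewal weights is the inverse of one minus the generating function
  of the jumps. Inside the disc of radius \<open>r < 1\<close> all series converge absolutely, and the real part of one minus the
  generating function of the jumps is still at least half of the gap on the boundary, uniformly in \<open>r\<close>.
\<close>
lemma renewal_generating_function:
  fixes r \<theta> :: real
  assumes \<mu>0: "pmf \<mu> 0 = 0" and r: "0 < r" "r < 1"
  defines "F \<equiv> (\<Sum>k. of_real (r ^ k * renewal \<mu> k) * cis (real k * \<theta>))"
  shows "norm F * symbol_gap \<mu> \<theta> \<le> 2"
proof -
  define a where "a k = of_real (r ^ k * renewal \<mu> k) * cis (real k * \<theta>)" for k
  define b where "b k = of_real (r ^ k * pmf \<mu> k) * cis (real k * \<theta>)" for k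
  have na: "norm (a k) = r ^ k * renewal \<mu> k" for k
    using r by (simp add: a_def norm_mult norm_power renewal_nonneg)
  have nb: "norm (b k) = r ^ k * pmf \<mu> k" for k
    using r by (simp add: b_def norm_mult norm_power)
  have geo: "summable (\<lambda>k. r ^ k)" using r by (intro summable_geometric) auto
  have sa: "summable (\<lambda>k. norm (a k))"
    unfolding na by (rule summable_comparison_test'[OF geo])
      (use r in \<open>auto simp: abs_mult renewal_nonneg intro!: mult_left_le renewal_le_1 \<mu>0\<close>)
  have sb: "summable (\<lambda>k. norm (b k))"
    unfolding nb by (rule summable_comparison_test'[OF geo])
      (use r in \<open>auto simp: abs_mult intro!: mult_left_le pmf_le_1\<close>)
  have prod: "(\<Sum>i\<le>k. a i * b (k - i)) = a k - (if k = 0 then 1 else 0)" for k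
  proof (cases "k = 0")
    case True
    then show ?thesis by (simp add: a_def b_def \<mu>0)
  next
    case False
    have "(\<Sum>i\<le>k. a i * b (k - i)) = (\<Sum>i<k. a i * b (k - i))"
      using \<mu>0 by (simp add: b_def flip: lessThan_Suc_atMost)
    also have "\<dots> = (\<Sum>i<k. of_real (r ^ k) * cis (real k * \<theta>) * of_real (pmf \<mu> (k - i) * renewal \<mu> i))"
    proof (intro sum.cong refl)
      fix i assume i: "i \<in> {..<k}"
      have c: "cis (real i * \<theta>) * cis (real (k - i) * \<theta>) = cis (real k * \<theta>)"
        using i by (simp add: cis_mult of_nat_diff algebra_simps)
      have p: "r ^ i * r ^ (k - i) = r ^ k" using i by (simp flip: power_add)
      have "a i * b (k - i) = of_real (r ^ i * r ^ (k - i)) * (cis (real i * \<theta>) * cis (real (k - i) * \<theta>))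
          * of_real (pmf \<mu> (k - i) * renewal \<mu> i)"
        by (simp add: a_def b_def)
      then show "a i * b (k - i)
          = of_real (r ^ k) * cis (real k * \<theta>) * of_real (pmf \<mu> (k - i) * renewal \<mu> i)"
        by (simp only: c p)
    qed
    also have "\<dots> = of_real (r ^ k) * cis (real k * \<theta>) * of_real (renewal \<mu> k)"
      using False by (simp add: renewal_pos sum_distrib_left)
    finally show ?thesis using False by (simp add: a_def)
  qed
  have Fa: "F = suminf a" unfolding F_def a_def ..
  have "(\<lambda>k. a k - (if k = 0 then 1 else 0)) sums (suminf a * suminf b)"
    using Cauchy_product_sums[OF sa sb] by (simp only: prod)
  moreover have "(\<lambda>k. a k - (if k = 0 then 1 else 0)) sums (suminf a - 1)"
    using sums_single[of 0 "\<lambda>_. 1::complex"] summable_sums[OF summable_norm_cancel[OF sa]]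
    by (intro sums_diff) auto
  ultimately have "F * suminf b = F - 1" unfolding Fa by (rule sums_unique2)
  then have "F * (1 - suminf b) = 1" by (simp add: algebra_simps)
  then have n1: "norm F * norm (1 - suminf b) = 1" by (metis norm_mult norm_one)
  have "(\<lambda>k. pmf \<mu> k - Re (b k)) sums (1 - Re (suminf b))"
    by (intro sums_diff pmf_nat_sums sums_Re summable_sums summable_norm_cancel[OF sb])
  moreover have "symbol_gap \<mu> \<theta> / 2 \<le> (\<Sum>k. pmf \<mu> k - Re (b k))"
  proof -
    have "(\<Sum>k. pmf \<mu> k * (1 - cos (real k * \<theta>)) / 2) \<le> (\<Sum>k. pmf \<mu> k - Re (b k))"
    proof (rule suminf_le)
      fix k
      have rk: "0 \<le> r ^ k" "r ^ k \<le> 1" using r by (auto intro: power_le_one)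
      \<comment> \<open>Damping helps if the cosine is negative, since then the right-hand side is at least \<open>1\<close>.\<close>
      have "(1 - cos (real k * \<theta>)) / 2 \<le> 1 - r ^ k * cos (real k * \<theta>)"
      proof (cases "cos (real k * \<theta>) \<ge> 0")
        case True
        then have "r ^ k * cos (real k * \<theta>) \<le> 1 * cos (real k * \<theta>)" using rk by (intro mult_right_mono) auto
        moreover have "cos (real k * \<theta>) \<le> 1" by (rule cos_le_one)
        ultimately show ?thesis unfolding diff_divide_distrib by linarith
      next
        case False
        then have "r ^ k * cos (real k * \<theta>) \<le> 0" using rk by (intro mult_nonneg_nonpos) auto
        moreover have "- 1 \<le> cos (real k * \<theta>)" by (rule cos_ge_minus_one)
        ultimately show ?thesis unfolding diff_divide_distrib by linarith
      qed
      then have "pmf \<mu> k * ((1 - cos (real k * \<theta>)) / 2) \<le> pmf \<mu> k * (1 - r ^ k * cos (real k * \<theta>))"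
        by (intro mult_left_mono) auto
      then show "pmf \<mu> k * (1 - cos (real k * \<theta>)) / 2 \<le> pmf \<mu> k - Re (b k)"
        by (simp add: b_def algebra_simps)
    qed (use calculation in \<open>auto intro: summable_divide symbol_gap_summable simp: sums_iff\<close>)
    then show ?thesis
      by (simp add: symbol_gap_def suminf_divide[OF symbol_gap_summable])
  qed
  ultimately have "symbol_gap \<mu> \<theta> / 2 \<le> Re (1 - suminf b)" by (simp add: sums_iff)
  also have "\<dots> \<le> norm (1 - suminf b)" by (rule complex_Re_le_cmod)
  finally have "norm F * symbol_gap \<mu> \<theta> \<le> norm F * (2 * norm (1 - suminf b))"
    by (intro mult_left_mono) auto
  then show ?thesis using n1 by simp
qed

text \<open>
  The convolution of the window \<open>{..<n}\<close> with the renewal weights, damped by \<open>r\<close>, has the Dirichlet kernel times the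
  generating function of the renewal weights as its Fourier transform.
\<close>
lemma window_transform:
  fixes r \<theta> :: real
  assumes \<mu>0: "pmf \<mu> 0 = 0" and r: "0 < r" "r < 1"
  defines "c \<equiv> \<lambda>n k. (\<Sum>i\<le>k. (if i < n then 1 else 0) * (r ^ (k - i) * renewal \<mu> (k - i)))"
  shows "summable (\<lambda>k. \<bar>c n k\<bar>)"
    and "(\<Sum>k. of_real (c n k) * cis (real k * \<theta>))
       = (\<Sum>i<n. cis (real i * \<theta>)) * (\<Sum>k. of_real (r ^ k * renewal \<mu> k) * cis (real k * \<theta>))"
proof -
  define a where "a k = of_real (r ^ k * renewal \<mu> k) * cis (real k * \<theta>)" for k
  define e where "e i = (if i < n then cis (real i * \<theta>) else 0)" for i
  have geo: "summable (\<lambda>k. r ^ k)" using r by (intro summable_geometric) auto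
  have sr: "summable (\<lambda>k. \<bar>r ^ k * renewal \<mu> k\<bar>)"
    by (rule summable_comparison_test'[OF geo])
      (use r in \<open>auto simp: abs_mult renewal_nonneg intro!: mult_left_le renewal_le_1 \<mu>0\<close>)
  then have sa: "summable (\<lambda>k. norm (a k))" by (simp add: a_def norm_mult norm_power abs_mult power_abs)
  have s1: "summable (\<lambda>i. \<bar>if i < n then 1 else (0::real)\<bar>)"
    by (rule summable_finite[of "{..<n}"]) auto
  have se: "summable (\<lambda>i. norm (e i))"
    by (rule summable_finite[of "{..<n}"]) (auto simp: e_def)
  have "summable (c n)"
    unfolding c_def using s1 sr by (intro summable_Cauchy_product) auto
  moreover have "0 \<le> c n k" for k
    unfolding c_def using r by (intro sum_nonneg mult_nonneg_nonneg) (auto simp: renewal_nonneg)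
  ultimately show "summable (\<lambda>k. \<bar>c n k\<bar>)" by simp
  have "of_real (c n k) * cis (real k * \<theta>) = (\<Sum>i\<le>k. e i * a (k - i))" for k
    unfolding c_def of_real_sum sum_distrib_right
  proof (intro sum.cong refl)
    fix i assume i: "i \<in> {..k}"
    have "cis (real i * \<theta>) * cis (real (k - i) * \<theta>) = cis (real k * \<theta>)"
      using i by (simp add: cis_mult of_nat_diff algebra_simps)
    then show "of_real ((if i < n then 1 else 0) * (r ^ (k - i) * renewal \<mu> (k - i))) * cis (real k * \<theta>)
        = e i * a (k - i)"
      by (simp add: e_def a_def)
  qed
  then have "(\<Sum>k. of_real (c n k) * cis (real k * \<theta>)) = suminf e * suminf a"
    using sums_unique[OF Cauchy_product_sums[OF se sa]] by simp
  also have "suminf e = (\<Sum>i<n. cis (real i * \<theta>))"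
    by (subst suminf_finite[of "{..<n}"]) (auto simp: e_def)
  finally show "(\<Sum>k. of_real (c n k) * cis (real k * \<theta>))
       = (\<Sum>i<n. cis (real i * \<theta>)) * (\<Sum>k. of_real (r ^ k * renewal \<mu> k) * cis (real k * \<theta>))"
    by (simp add: a_def)
qed

text \<open>
  The consequences of a regularly varying tail with index strictly between \<open>0\<close> and \<open>1 / 2\<close> that drive the analysis.
  The Potter bound with an exponent \<open>a < 1 / 2\<close> keeps \<open>tail \<mu> (1 / \<theta>) powr (- 2)\<close> integrable at
  the origin. The drop of the tail under doubling provides jumps of every order of magnitude.
\<close>
locale heavy_tailed_jumps =
  fixes \<mu> :: "nat pmf" and a \<kappa> c0 :: real
  assumes pmf_0: "pmf \<mu> 0 = 0"
    and aperiodic: "Gcd {n. pmf \<mu> n > 0} = 1"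
    and tail_pos: "\<And>n. 0 < tail \<mu> n"
    and a: "0 < a" "a < 1 / 2"
    and \<kappa>: "0 < \<kappa>"
    and potter: "\<And>n x. 1 \<le> n \<Longrightarrow> n \<le> x \<Longrightarrow> \<kappa> * (real n / real x) powr a * tail \<mu> n \<le> tail \<mu> x"
    and c0: "0 < c0"
    and tail_drop: "\<forall>\<^sub>F n in sequentially. c0 * tail \<mu> n \<le> tail \<mu> n - tail \<mu> (2 * n)"
begin

text \<open>
  By \<open>bessel\<close>, the left-hand side is at most a constant times the mean of the squared Dirichlet kernel over the squared gap.
  For \<open>\<bar>\<theta>\<bar> \<ge> 1 / n\<close> the kernel is of order \<open>1 / \<theta>\<close> and the gap is at least of the order of the tail at \<open>n\<close>. For
  smaller \<open>\<theta>\<close> the kernel is at most \<open>n\<close>, and the Potter bound compares the tail at \<open>1 / \<theta>\<close> with the tail at \<open>n\<close>. Both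
  parts contribute the order \<open>n / (tail \<mu> n)\<^sup>2\<close>.
\<close>
lemma window_square_sum:
  shows "\<exists>C\<ge>0. \<forall>n\<ge>1. \<forall>K. (\<Sum>k<K. (\<Sum>i\<le>k. (if i < n then 1 else 0) * renewal \<mu> (k - i))\<^sup>2)
           \<le> C * (real n / (tail \<mu> n)\<^sup>2)"
proof -
  obtain c where c: "0 < c"
    and gap: "\<And>\<theta>. 0 < \<bar>\<theta>\<bar> \<Longrightarrow> \<bar>\<theta>\<bar> \<le> pi \<Longrightarrow> c * tail \<mu> (nat \<lceil>1 / \<bar>\<theta>\<bar>\<rceil>) \<le> symbol_gap \<mu> \<theta>"
    using symbol_gap_ge_tail[OF aperiodic c0 tail_drop] by blast
  \<comment> \<open>\<open>B\<close> is the constant in the bound of the Dirichlet kernel by \<open>1 / \<theta>\<close>; \<open>E * n\<close> is the integral of the Potter majorant over \<open>{0..1 / n}\<close>.\<close>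
  define B where "B = 4 / cos (1::real)"
  have cos1: "0 < cos (1::real)" using pi_gt3 by (intro cos_gt_zero) auto
  then have B: "0 < B" by (simp add: B_def)
  define E where "E = 2 powr (2 * a) / (\<kappa>\<^sup>2 * (1 - 2 * a))"
  have E: "0 \<le> E" using a by (simp add: E_def)
  define C where "C = (4 / c\<^sup>2) * (E + B\<^sup>2) / pi"
  have C: "0 \<le> C" using E by (simp add: C_def)
  have "(\<Sum>k<K. (\<Sum>i\<le>k. (if i < n then 1 else 0) * renewal \<mu> (k - i))\<^sup>2)
      \<le> C * (real n / (tail \<mu> n)\<^sup>2)" if n: "1 \<le> n" for n K
  proof -
    let ?H = "tail \<mu> n"
    define cr where "cr r k = (\<Sum>i\<le>k. (if i < n then 1 else 0) * (r ^ (k - i) * renewal \<mu> (k - i)))" for r k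
    define h where "h t = (4 / c\<^sup>2 / ?H\<^sup>2) *
        (if t < 1 / real n then (real n)\<^sup>2 / \<kappa>\<^sup>2 * (real n / 2) powr (-2 * a) * t powr (-2 * a)
         else B\<^sup>2 * (1 / t\<^sup>2))" for t
    have "1 / real n \<le> 1" using n by simp
    then have np: "1 / real n \<le> pi" using pi_gt3 by linarith
    have n0: "0 < real n" using n by simp
    have h0: "(h has_integral ((4 / c\<^sup>2 / ?H\<^sup>2) * (real n * E))) {0..1 / real n}"
    proof -
      have "((\<lambda>t. (4 / c\<^sup>2 / ?H\<^sup>2) * ((real n)\<^sup>2 / \<kappa>\<^sup>2 * (real n / 2) powr (-2 * a) * t powr (-2 * a)))
          has_integral ((4 / c\<^sup>2 / ?H\<^sup>2) * ((real n)\<^sup>2 / \<kappa>\<^sup>2 * (real n / 2) powr (-2 * a)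
             * ((1 / real n) powr (-2 * a + 1) / (-2 * a + 1))))) {0..1 / real n}"
        using a by (intro has_integral_mult_right has_integral_powr_from_0) auto
      moreover have "(real n)\<^sup>2 / \<kappa>\<^sup>2 * (real n / 2) powr (-2 * a)
             * ((1 / real n) powr (-2 * a + 1) / (-2 * a + 1)) = real n * E"
      proof -
        have "(real n / 2) powr (-2 * a) = real n powr (-2 * a) * 2 powr (2 * a)"
          by (simp add: powr_divide powr_minus field_simps)
        moreover have "(1 / real n) powr (-2 * a + 1) = real n powr (2 * a) * (1 / real n)"
        proof -
          have "(1 / real n) powr (-2 * a + 1) = (1 / real n) powr (-2 * a) * (1 / real n) powr 1"
            by (rule powr_add)
          then show ?thesis using n0 by (simp add: powr_divide powr_minus)
        qed
        moreover have "real n powr (-2 * a) * real n powr (2 * a) = 1"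
          using n0 by (simp flip: powr_add)
        moreover have "(real n)\<^sup>2 / \<kappa>\<^sup>2 * (p * t) * (p' * (1 / real n) / (-2 * a + 1))
            = real n * (t / (\<kappa>\<^sup>2 * (1 - 2 * a)))" if "p * p' = 1" for p p' t
        proof -
          have "(real n)\<^sup>2 / \<kappa>\<^sup>2 * (p * t) * (p' * (1 / real n) / (-2 * a + 1))
              = (p * p') * ((real n)\<^sup>2 * (1 / real n)) * (t / (\<kappa>\<^sup>2 * (1 - 2 * a)))"
            by (simp add: divide_inverse inverse_mult_distrib mult_ac)
          also have "(real n)\<^sup>2 * (1 / real n) = real n" using n0 by (simp add: power2_eq_square)
          finally show ?thesis using that by simp
        qed
        ultimately show ?thesis unfolding E_def by (simp only:)
      qed
      ultimately have *: "((\<lambda>t. (4 / c\<^sup>2 / ?H\<^sup>2) * ((real n)\<^sup>2 / \<kappa>\<^sup>2 * (real n / 2) powr (-2 * a) * t powr (-2 * a)))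
          has_integral ((4 / c\<^sup>2 / ?H\<^sup>2) * (real n * E))) {0..1 / real n}"
        by (simp only:)
      show ?thesis
        by (rule has_integral_spike_finite[OF _ _ *, of "{1 / real n}"]) (auto simp: h_def)
    qed
    have h1: "(h has_integral ((4 / c\<^sup>2 / ?H\<^sup>2) * (B\<^sup>2 * (real n - 1 / pi)))) {1 / real n..pi}"
    proof -
      have "((\<lambda>t. 1 / t\<^sup>2) has_integral ((- (1 / pi)) - (- (1 / (1 / real n))))) {1 / real n..pi}"
      proof (rule fundamental_theorem_of_calculus[OF np])
        fix x assume x: "x \<in> {1 / real n..pi}"
        then have "0 < x" using n0 by (intro less_le_trans[of 0 "1 / real n" x]) auto
        then show "((\<lambda>t. - (1 / t)) has_vector_derivative 1 / x\<^sup>2) (at x within {1 / real n..pi})"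
          by (auto intro!: derivative_eq_intros simp: power2_eq_square simp flip: has_real_derivative_iff_has_vector_derivative)
      qed
      then have "((\<lambda>t. (4 / c\<^sup>2 / ?H\<^sup>2) * (B\<^sup>2 * (1 / t\<^sup>2))) has_integral
          ((4 / c\<^sup>2 / ?H\<^sup>2) * (B\<^sup>2 * (- (1 / pi) - (- (1 / (1 / real n))))))) {1 / real n..pi}"
        by (intro has_integral_mult_right)
      then show ?thesis
        by (subst has_integral_cong[where g = "\<lambda>t. (4 / c\<^sup>2 / ?H\<^sup>2) * (B\<^sup>2 * (1 / t\<^sup>2))"]) (auto simp: h_def)
    qed
    define J where "J = (4 / c\<^sup>2 / ?H\<^sup>2) * (real n * E) + (4 / c\<^sup>2 / ?H\<^sup>2) * (B\<^sup>2 * (real n - 1 / pi))"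
    have hJ: "(h has_integral J) {0..pi}"
      unfolding J_def using n0 np by (intro has_integral_combine[OF _ _ h0 h1]) auto
    have hp: "((\<lambda>\<theta>. h \<bar>\<theta>\<bar>) has_integral J) {0..pi}"
      using hJ by (subst has_integral_cong[where g = h]) auto
    have hm: "((\<lambda>\<theta>. h \<bar>\<theta>\<bar>) has_integral J) {-pi..0}"
    proof -
      have "((\<lambda>\<theta>. h \<bar>- \<theta>\<bar>) has_integral J) {-pi..- 0}"
        using hp by (subst has_integral_reflect_real) simp
      then show ?thesis by simp
    qed
    have hh: "((\<lambda>\<theta>. h \<bar>\<theta>\<bar>) has_integral (J + J)) {-pi..pi}"
      by (rule has_integral_combine[OF _ _ hm hp]) auto
    have bound: "(\<Sum>k<K. (cr r k)\<^sup>2) \<le> (J + J) / (2 * pi)" if r: "0 < r" "r < 1" for r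
    proof (rule bessel[OF _ hh])
      show "summable (\<lambda>k. \<bar>cr r k\<bar>)"
        unfolding cr_def by (rule window_transform[OF pmf_0 r])
      fix \<theta> assume \<theta>: "\<theta> \<in> {-pi..pi}" "\<theta> \<noteq> 0"
      define F where "F = (\<Sum>k. of_real (r ^ k * renewal \<mu> k) * cis (real k * \<theta>))"
      define D where "D = (\<Sum>i<n. cis (real i * \<theta>))"
      define x where "x = nat \<lceil>1 / \<bar>\<theta>\<bar>\<rceil>"
      have \<theta>a: "0 < \<bar>\<theta>\<bar>" "\<bar>\<theta>\<bar> \<le> pi" using \<theta> by auto
      have tx: "0 < tail \<mu> x" by (rule tail_pos)
      have "norm F * (c * tail \<mu> x) \<le> norm F * symbol_gap \<mu> \<theta>"
        using gap[OF \<theta>a] by (intro mult_left_mono) (auto simp: x_def)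
      also have "\<dots> \<le> 2" unfolding F_def by (rule renewal_generating_function[OF pmf_0 r])
      finally have F: "norm F \<le> 2 / (c * tail \<mu> x)" using c tx by (simp add: field_simps)
      have D1: "norm D \<le> real n" and D2: "norm D \<le> B / \<bar>\<theta>\<bar>"
        using dirichlet_kernel_bounds[of \<theta> n] \<theta>a \<theta> by (auto simp: D_def B_def)
      have x1: "1 / \<bar>\<theta>\<bar> \<le> real x" and x2: "real x \<le> 1 / \<bar>\<theta>\<bar> + 1"
        using \<theta>a by (auto simp: x_def intro: of_nat_ceiling)
      have "norm (D * F) \<le> sqrt (h \<bar>\<theta>\<bar>)"
      proof (cases "\<bar>\<theta>\<bar> < 1 / real n")
        case True
        have "real n \<le> 1 / \<bar>\<theta>\<bar>" using True \<theta>a n0 by (simp add: field_simps)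
        then have nx: "n \<le> x" using x1 by linarith
        have "1 \<le> 1 / \<bar>\<theta>\<bar>" using \<open>real n \<le> 1 / \<bar>\<theta>\<bar>\<close> n by linarith
        then have "real x \<le> 2 / \<bar>\<theta>\<bar>" using x2 by simp
        then have "real n * \<bar>\<theta>\<bar> / 2 \<le> real n / real x"
          using nx n \<theta>a by (simp add: field_simps)
        then have "(real n / 2 * \<bar>\<theta>\<bar>) powr a \<le> (real n / real x) powr a"
          using a \<theta>a n0 by (intro powr_mono2) auto
        then have "\<kappa> * (real n / 2 * \<bar>\<theta>\<bar>) powr a * ?H \<le> \<kappa> * (real n / real x) powr a * ?H"
          using \<kappa> tail_nonneg by (intro mult_right_mono mult_left_mono) auto
        also have "\<dots> \<le> tail \<mu> x" using nx n by (intro potter)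
        finally have t: "\<kappa> * (real n / 2 * \<bar>\<theta>\<bar>) powr a * ?H \<le> tail \<mu> x" .
        have tp: "0 < \<kappa> * (real n / 2 * \<bar>\<theta>\<bar>) powr a * ?H"
          using \<kappa> n0 \<theta>a tail_pos by simp
        have "norm (D * F) \<le> real n * (2 / (c * tail \<mu> x))"
          unfolding norm_mult using D1 F by (intro mult_mono) auto
        also have "\<dots> \<le> real n * (2 / (c * (\<kappa> * (real n / 2 * \<bar>\<theta>\<bar>) powr a * ?H)))"
        proof (intro mult_left_mono divide_left_mono mult_left_mono t)
          show "0 < c * tail \<mu> x * (c * (\<kappa> * (real n / 2 * \<bar>\<theta>\<bar>) powr a * ?H))"
            by (intro mult_pos_pos c tx tp)
        qed (use c in auto)
        also have "\<dots> = sqrt ((real n * (2 / (c * (\<kappa> * (real n / 2 * \<bar>\<theta>\<bar>) powr a * ?H))))\<^sup>2)"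
          using \<kappa> c tail_nonneg by (subst real_sqrt_abs) (auto intro!: abs_of_nonneg[symmetric] divide_nonneg_nonneg mult_nonneg_nonneg)
        also have "(real n * (2 / (c * (\<kappa> * (real n / 2 * \<bar>\<theta>\<bar>) powr a * ?H))))\<^sup>2 = h \<bar>\<theta>\<bar>"
        proof -
          have "((real n / 2 * \<bar>\<theta>\<bar>) powr a)\<^sup>2 = (real n / 2) powr (2 * a) * \<bar>\<theta>\<bar> powr (2 * a)"
          proof -
            have "(y powr a)\<^sup>2 = y powr (2 * a)" for y :: real
              unfolding power2_eq_square mult_2 by (rule powr_add[symmetric])
            moreover have "(real n / 2 * \<bar>\<theta>\<bar>) powr a = (real n / 2) powr a * \<bar>\<theta>\<bar> powr a"
              by (rule powr_mult)
            ultimately show ?thesis by (simp only: power_mult_distrib)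
          qed
          then show ?thesis using True c tail_pos[of n]
            by (simp add: h_def power_mult_distrib power_divide powr_minus field_simps)
        qed
        finally show ?thesis .
      next
        case False
        have "1 / \<bar>\<theta>\<bar> \<le> real n" using False \<theta>a n0 by (simp add: field_simps)
        then have "x \<le> n" by (simp add: x_def nat_le_iff ceiling_le_iff)
        then have t: "?H \<le> tail \<mu> x" by (rule tail_antimono)
        have "norm (D * F) \<le> (B / \<bar>\<theta>\<bar>) * (2 / (c * tail \<mu> x))"
          unfolding norm_mult using D2 F B by (intro mult_mono) auto
        also have "\<dots> \<le> (B / \<bar>\<theta>\<bar>) * (2 / (c * ?H))"
          using t tail_pos c B by (intro mult_left_mono divide_left_mono mult_pos_pos tx) auto
        also have "\<dots> = sqrt (((B / \<bar>\<theta>\<bar>) * (2 / (c * ?H)))\<^sup>2)"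
          using B c tail_nonneg[of \<mu> n] by (subst real_sqrt_abs) (auto intro!: abs_of_nonneg[symmetric])
        also have "((B / \<bar>\<theta>\<bar>) * (2 / (c * ?H)))\<^sup>2 = h \<bar>\<theta>\<bar>"
          using False by (simp add: h_def power_mult_distrib power_divide field_simps)
        finally show ?thesis .
      qed
      moreover have "0 \<le> h \<bar>\<theta>\<bar>" by (auto simp: h_def)
      ultimately have "(norm (D * F))\<^sup>2 \<le> h \<bar>\<theta>\<bar>"
        by (metis norm_ge_zero power_mono real_sqrt_pow2)
      moreover have "(\<Sum>k. of_real (cr r k) * cis (real k * \<theta>)) = D * F"
        unfolding cr_def D_def F_def by (rule window_transform[OF pmf_0 r])
      ultimately show "(norm (\<Sum>k. of_real (cr r k) * cis (real k * \<theta>)))\<^sup>2 \<le> h \<bar>\<theta>\<bar>" by simp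
    qed
    \<comment> \<open>The bound does not depend on the damping, which can now be removed.\<close>
    have "((\<lambda>r. \<Sum>k<K. (cr r k)\<^sup>2) \<longlongrightarrow> (\<Sum>k<K. (cr 1 k)\<^sup>2)) (at_left 1)"
      unfolding cr_def by (intro tendsto_intros)
    then have "(\<Sum>k<K. (cr 1 k)\<^sup>2) \<le> (J + J) / (2 * pi)"
    proof (rule tendsto_upperbound)
      show "\<forall>\<^sub>F r in at_left 1. (\<Sum>k<K. (cr r k)\<^sup>2) \<le> (J + J) / (2 * pi)"
        by (rule eventually_mono[OF eventually_at_left_real[OF zero_less_one]]) (rule bound, auto)
    qed auto
    also have "(J + J) / (2 * pi) = J / pi" by simp
    also have "J / pi \<le> C * (real n / ?H\<^sup>2)"
    proof -
      have "J \<le> (4 / c\<^sup>2 / ?H\<^sup>2) * (real n * E) + (4 / c\<^sup>2 / ?H\<^sup>2) * (B\<^sup>2 * real n)"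
        unfolding J_def by (intro add_left_mono mult_left_mono) auto
      also have "\<dots> = ((4 / c\<^sup>2) * (E + B\<^sup>2)) * (real n / ?H\<^sup>2)"
        by (simp add: divide_inverse algebra_simps)
      also have "(4 / c\<^sup>2) * (E + B\<^sup>2) = C * pi" by (simp add: C_def)
      finally show ?thesis by (simp add: field_simps)
    qed
    finally show ?thesis by (simp add: cr_def)
  qed
  then show ?thesis using C by blast
qed

end

section \<open>Hitting weights on the integers and the energy of a window\<close>

abbreviation cZ :: "int measure" where "cZ \<equiv> count_space UNIV"

text \<open>
  The probability that the ancestral line of a vertex contains the vertex \<open>k\<close> below it. Values in \<open>ennreal\<close> make all sums
  over the integers commute.
\<close>
definition hit :: "nat pmf \<Rightarrow> int \<Rightarrow> ennreal" where
  "hit \<mu> k = (if k < 0 then 0 else ennreal (renewal \<mu> (nat k)))"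

lemma hit_neg [simp]: "k < 0 \<Longrightarrow> hit \<mu> k = 0"
  by (simp add: hit_def)

lemma hit_of_nat [simp]: "hit \<mu> (int n) = ennreal (renewal \<mu> n)"
  by (simp add: hit_def)

lemma hit_0 [simp]: "hit \<mu> 0 = 1"
  by (simp add: hit_def)

lemma nn_integral_int_reflect: "(\<integral>\<^sup>+w. f (y - w) \<partial>cZ) = (\<integral>\<^sup>+w. f w \<partial>cZ)"
  by (rule nn_integral_bij_count_space) (auto intro!: bij_betwI[of _ _ _ "\<lambda>w. y - w"])

lemma nn_integral_int_nonneg_support:
  assumes "\<And>k. k < 0 \<Longrightarrow> f k = 0"
  shows "(\<integral>\<^sup>+k. f k \<partial>cZ) = (\<Sum>n. f (int n))"
proof -
  have "(\<integral>\<^sup>+k. f k \<partial>cZ) = (\<integral>\<^sup>+k. f k \<partial>count_space (range int))"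
  proof (rule nn_integral_count_space_eq)
    fix x assume "x \<in> UNIV - range int"
    then have "x < 0" using zero_le_imp_eq_int[of x] by (cases "x < 0") auto
    then show "f x = 0" by (rule assms)
  qed auto
  also have "\<dots> = (\<integral>\<^sup>+n. f (int n) \<partial>count_space UNIV)"
    by (rule nn_integral_bij_count_space[symmetric]) (simp add: bij_betw_def)
  finally show ?thesis by (simp add: nn_integral_count_space_nat)
qed

lemma nn_integral_int_swap:
  "(\<integral>\<^sup>+y. (\<integral>\<^sup>+x. f x y \<partial>cZ) \<partial>cZ) = (\<integral>\<^sup>+x. (\<integral>\<^sup>+y. f x y \<partial>cZ) \<partial>cZ)"
  using nn_integral_snd_count_space[of "case_prod f"] nn_integral_fst_count_space[of "case_prod f"]
  by simp

lemma ennreal_suminf_le: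
  fixes f :: "nat \<Rightarrow> ennreal"
  shows "(\<And>n. (\<Sum>i<n. f i) \<le> x) \<Longrightarrow> suminf f \<le> x"
  by (intro suminf_le_const summableI)

lemma nn_integral_pmf_swap:
  "(\<integral>\<^sup>+m. (\<integral>\<^sup>+z. f m z \<partial>cZ) \<partial>measure_pmf \<mu>) = (\<integral>\<^sup>+z. (\<integral>\<^sup>+m. f m z \<partial>measure_pmf \<mu>) \<partial>cZ)"
  for f :: "nat \<Rightarrow> int \<Rightarrow> ennreal"
proof -
  have "(\<integral>\<^sup>+m. (\<integral>\<^sup>+z. f m z \<partial>cZ) \<partial>measure_pmf \<mu>)
      = (\<integral>\<^sup>+m. (\<integral>\<^sup>+z. ennreal (pmf \<mu> m) * f m z \<partial>cZ) \<partial>count_space UNIV)"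
    by (simp add: nn_integral_measure_pmf nn_integral_cmult)
  also have "\<dots> = (\<integral>\<^sup>+z. (\<integral>\<^sup>+m. ennreal (pmf \<mu> m) * f m z \<partial>count_space UNIV) \<partial>cZ)"
    using nn_integral_snd_count_space[of "\<lambda>(m, z). ennreal (pmf \<mu> m) * f m z"]
      nn_integral_fst_count_space[of "\<lambda>(m, z). ennreal (pmf \<mu> m) * f m z"]
    by simp
  also have "\<dots> = (\<integral>\<^sup>+z. (\<integral>\<^sup>+m. f m z \<partial>measure_pmf \<mu>) \<partial>cZ)"
    by (simp add: nn_integral_measure_pmf)
  finally show ?thesis .
qed

text \<open>
  Condition on the first jump. At \<open>k = 0\<close> the vertex is hit by the start of the line and by no later point.
\<close>
lemma hit_harmonic:
  assumes \<mu>0: "pmf \<mu> 0 = 0"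
  shows "(\<integral>\<^sup>+m. hit \<mu> (k - int m) \<partial>measure_pmf \<mu>) = (if k = 0 then 0 else hit \<mu> k)"
proof (cases "k \<le> 0")
  case True
  have "(\<integral>\<^sup>+m. hit \<mu> (k - int m) \<partial>measure_pmf \<mu>) = (\<integral>\<^sup>+m. 0 \<partial>measure_pmf \<mu>)"
  proof (rule nn_integral_cong_AE)
    show "AE m in measure_pmf \<mu>. hit \<mu> (k - int m) = 0"
      using True \<mu>0 by (auto simp: AE_measure_pmf_iff set_pmf_iff intro!: hit_neg) (metis gr0I le_less_trans less_add_same_cancel1 of_nat_0_less_iff)
  qed
  then show ?thesis using True by auto
next
  case False
  define n where "n = nat k"
  have k: "k = int n" "0 < n" using False by (auto simp: n_def)
  have "(\<integral>\<^sup>+m. hit \<mu> (k - int m) \<partial>measure_pmf \<mu>)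
      = (\<integral>\<^sup>+m. ennreal (pmf \<mu> m) * hit \<mu> (k - int m) \<partial>count_space UNIV)"
    by (rule nn_integral_measure_pmf)
  also have "\<dots> = (\<Sum>m\<in>{1..n}. ennreal (pmf \<mu> m) * hit \<mu> (k - int m))"
    using \<mu>0 k by (intro nn_integral_count_space') (auto simp: not_le)
  also have "\<dots> = (\<Sum>m\<in>{1..n}. ennreal (pmf \<mu> m * renewal \<mu> (n - m)))"
    by (intro sum.cong refl) (auto simp: k(1) ennreal_mult renewal_nonneg hit_def nat_diff_distrib)
  also have "\<dots> = ennreal (\<Sum>m\<in>{1..n}. pmf \<mu> m * renewal \<mu> (n - m))"
    by (intro sum_ennreal mult_nonneg_nonneg) (auto simp: renewal_nonneg)
  also have "(\<Sum>m\<in>{1..n}. pmf \<mu> m * renewal \<mu> (n - m)) = (\<Sum>j<n. pmf \<mu> (n - j) * renewal \<mu> j)"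
    by (rule sum.reindex_bij_witness[of _ "\<lambda>j. n - j" "\<lambda>m. n - m"]) auto
  finally show ?thesis using k by (simp add: renewal_pos)
qed

lemma ennreal_power2_le_imp_le: "a\<^sup>2 \<le> b\<^sup>2 \<Longrightarrow> a \<le> b" for a b :: ennreal
proof (cases a; cases b)
  fix x y :: real
  assume le: "a\<^sup>2 \<le> b\<^sup>2" and x: "0 \<le> x" "a = ennreal x" and y: "0 \<le> y" "b = ennreal y"
  then have "ennreal (x\<^sup>2) \<le> ennreal (y\<^sup>2)" by (simp add: ennreal_power)
  then have "x\<^sup>2 \<le> y\<^sup>2" by (subst (asm) ennreal_le_iff) simp_all
  then have "x \<le> y" using y(1) by (rule power2_le_imp_le)
  then show "a \<le> b" using x y by (simp add: ennreal_leI)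
qed (auto simp: power_eq_top_ennreal top_unique ennreal_power)

context heavy_tailed_jumps
begin

abbreviation "q \<equiv> hit \<mu>"

definition window :: "nat \<Rightarrow> int \<Rightarrow> ennreal" where
  "window n z = (\<Sum>i=1..n. q (int i - z))"

definition energy :: "nat \<Rightarrow> ennreal" where
  "energy n = (\<integral>\<^sup>+z. (window n z)\<^sup>2 \<partial>cZ)"

text \<open>
  The common order of magnitude of the energy and of the variance of the sums.
\<close>
definition scale :: "nat \<Rightarrow> real" where
  "scale n = real n / (tail \<mu> n)\<^sup>2"

lemma scale_pos: "1 \<le> n \<Longrightarrow> 0 < scale n"
  using tail_pos[of n] by (simp add: scale_def)

lemma window_reflected:
  "window n (int n - int m) = ennreal (\<Sum>j\<le>m. (if j < n then 1 else 0) * renewal \<mu> (m - j))"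
proof -
  have "window n (int n - int m) = (\<Sum>j<n. q (int m - int j))"
    unfolding window_def
    by (rule sum.reindex_bij_witness[of _ "\<lambda>j. n - j" "\<lambda>i. n - i"]) (auto simp: of_nat_diff algebra_simps)
  also have "\<dots> = (\<Sum>j\<in>{..<n} \<inter> {..m}. q (int m - int j))"
    by (intro sum.mono_neutral_right) (auto simp: not_le)
  also have "\<dots> = (\<Sum>j\<le>m. ennreal ((if j < n then 1 else 0) * renewal \<mu> (m - j)))"
    by (rule sum.mono_neutral_cong_left) (auto simp: hit_def nat_diff_distrib)
  also have "\<dots> = ennreal (\<Sum>j\<le>m. (if j < n then 1 else 0) * renewal \<mu> (m - j))"
    by (intro sum_ennreal mult_nonneg_nonneg) (auto simp: renewal_nonneg)
  finally show ?thesis .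
qed

lemma energy_bound: "\<exists>C\<ge>0. \<forall>n\<ge>1. energy n \<le> ennreal (C * scale n)"
proof -
  obtain C where C: "0 \<le> C" and bound: "\<And>n K. 1 \<le> n \<Longrightarrow>
      (\<Sum>k<K. (\<Sum>i\<le>k. (if i < n then 1 else 0) * renewal \<mu> (k - i))\<^sup>2) \<le> C * (real n / (tail \<mu> n)\<^sup>2)"
    using window_square_sum by blast
  have "energy n \<le> ennreal (C * scale n)" if n: "1 \<le> n" for n
  proof -
    have "energy n = (\<integral>\<^sup>+k. (window n (int n - k))\<^sup>2 \<partial>cZ)"
      unfolding energy_def by (rule nn_integral_int_reflect[symmetric])
    also have "\<dots> = (\<Sum>m. (window n (int n - int m))\<^sup>2)"
      by (rule nn_integral_int_nonneg_support) (simp add: window_def)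
    also have "\<dots> \<le> ennreal (C * scale n)"
    proof (rule ennreal_suminf_le)
      fix K
      have "(\<Sum>m<K. (window n (int n - int m))\<^sup>2)
          = (\<Sum>m<K. ennreal ((\<Sum>j\<le>m. (if j < n then 1 else 0) * renewal \<mu> (m - j))\<^sup>2))"
        unfolding window_reflected
        by (intro sum.cong refl ennreal_power sum_nonneg mult_nonneg_nonneg) (auto simp: renewal_nonneg)
      also have "\<dots> = ennreal (\<Sum>m<K. (\<Sum>j\<le>m. (if j < n then 1 else 0) * renewal \<mu> (m - j))\<^sup>2)"
        by (intro sum_ennreal) auto
      also have "\<dots> \<le> ennreal (C * scale n)"
        unfolding scale_def by (intro ennreal_leI bound n)
      finally show "(\<Sum>m<K. (window n (int n - int m))\<^sup>2) \<le> ennreal (C * scale n)" .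
    qed
    finally show ?thesis .
  qed
  then show ?thesis using C by blast
qed

text \<open>
  The expected number of common points of two independent ancestral lines that start at one vertex.
\<close>
definition Q :: ennreal where "Q = (\<integral>\<^sup>+k. (q k)\<^sup>2 \<partial>cZ)"

lemma Q_suminf: "Q = (\<Sum>n. ennreal ((renewal \<mu> n)\<^sup>2))"
  unfolding Q_def by (subst nn_integral_int_nonneg_support) (auto simp: ennreal_power renewal_nonneg)

lemma Q_finite: "Q < \<infinity>"
proof -
  obtain C where "energy 1 \<le> ennreal (C * scale 1)" using energy_bound by blast
  moreover have "energy 1 = Q"
    using nn_integral_int_reflect[of "\<lambda>w. (q w)\<^sup>2" 1] by (simp add: energy_def window_def Q_def)
  ultimately show ?thesis by (metis ennreal_less_top le_less_trans infinity_ennreal_def)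
qed

lemma Q_ge_1: "1 \<le> Q"
proof -
  have "(\<Sum>n<1. ennreal ((renewal \<mu> n)\<^sup>2)) \<le> (\<Sum>n. ennreal ((renewal \<mu> n)\<^sup>2))"
    by (rule sum_le_suminf) auto
  then show ?thesis by (simp add: Q_suminf)
qed

lemma renewal_square_summable: "summable (\<lambda>n. (renewal \<mu> n)\<^sup>2)"
  using Q_finite by (intro summable_suminf_not_top) (auto simp: Q_suminf)

lemma Q_tail_small:
  assumes "0 < e"
  shows "\<exists>m::nat. (\<integral>\<^sup>+k. (q k)\<^sup>2 * indicator {int m..} k \<partial>cZ) \<le> ennreal e"
proof -
  have "(\<lambda>m. \<Sum>n. (renewal \<mu> (n + m))\<^sup>2) \<longlonglongrightarrow> 0"
    by (rule suminf_exist_split2) (rule renewal_square_summable)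
  then have "\<forall>\<^sub>F m in sequentially. (\<Sum>n. (renewal \<mu> (n + m))\<^sup>2) < e"
    using assms by (rule order_tendstoD)
  then obtain m where m: "(\<Sum>n. (renewal \<mu> (n + m))\<^sup>2) < e"
    by (auto simp: eventually_sequentially)
  have "(\<integral>\<^sup>+k. (q k)\<^sup>2 * indicator {int m..} k \<partial>cZ)
      = (\<integral>\<^sup>+k. (q (int m - k))\<^sup>2 * indicator {int m..} (int m - k) \<partial>cZ)"
    by (rule nn_integral_int_reflect[symmetric])
  also have "\<dots> = (\<integral>\<^sup>+k. (q (int m - (0 - k)))\<^sup>2 * indicator {int m..} (int m - (0 - k)) \<partial>cZ)"
    by (rule nn_integral_int_reflect[symmetric])
  also have "\<dots> = (\<Sum>n. (q (int m - (0 - int n)))\<^sup>2 * indicator {int m..} (int m - (0 - int n)))"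
    by (rule nn_integral_int_nonneg_support) auto
  also have "\<dots> = (\<Sum>n. ennreal ((renewal \<mu> (n + m))\<^sup>2))"
    by (intro suminf_cong) (simp add: ennreal_power renewal_nonneg add.commute flip: of_nat_add)
  also have "\<dots> = ennreal (\<Sum>n. (renewal \<mu> (n + m))\<^sup>2)"
    by (rule suminf_ennreal2) (auto intro: summable_ignore_initial_segment renewal_square_summable)
  also have "\<dots> \<le> ennreal e" using m by (intro ennreal_leI) auto
  finally show ?thesis ..
qed

text \<open>
  The expected number of common points of two independent ancestral lines that start at \<open>y\<close> and \<open>y'\<close>.
\<close>
definition meet :: "int \<Rightarrow> int \<Rightarrow> ennreal" where
  "meet y y' = (\<integral>\<^sup>+w. q (y - w) * q (y' - w) \<partial>cZ)"

lemma meet_commute: "meet y y' = meet y' y"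
  by (simp add: meet_def mult.commute)

lemma meet_le_Q: "meet y y' \<le> Q"
proof -
  have "(meet y y')\<^sup>2 \<le> (\<integral>\<^sup>+w. (q (y - w))\<^sup>2 \<partial>cZ) * (\<integral>\<^sup>+w. (q (y' - w))\<^sup>2 \<partial>cZ)"
    unfolding meet_def by (rule Cauchy_Schwarz_nn_integral) auto
  also have "\<dots> = Q\<^sup>2"
    using nn_integral_int_reflect[of "\<lambda>w. (q w)\<^sup>2"] by (simp add: Q_def power2_eq_square)
  finally show ?thesis by (rule ennreal_power2_le_imp_le)
qed

text \<open>
  If \<open>y\<close> is higher than \<open>y'\<close> by at least \<open>K\<close>, then only the weights \<open>q k\<close> with \<open>k \<ge> K\<close> of the line from
  \<open>y\<close> enter. Their square sum is small, and the Cauchy-Schwarz inequality applies.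
\<close>
lemma meet_small:
  assumes e: "0 < e"
  shows "\<exists>K::nat. \<forall>y y'. \<bar>y - y'\<bar> \<ge> int K \<longrightarrow> meet y y' \<le> ennreal e"
proof -
  obtain Qr where Qr: "Q = ennreal Qr" "1 \<le> Qr"
    using Q_finite Q_ge_1 by (cases Q) auto
  obtain K where K: "(\<integral>\<^sup>+k. (q k)\<^sup>2 * indicator {int K..} k \<partial>cZ) \<le> ennreal (e\<^sup>2 / Qr)"
    using Q_tail_small[of "e\<^sup>2 / Qr"] e Qr by auto
  have main: "meet y y' \<le> ennreal e" if "y \<ge> y' + int K" for y y'
  proof -
    have "meet y y' = (\<integral>\<^sup>+w. (q (y - w) * indicator {int K..} (y - w)) * q (y' - w) \<partial>cZ)"
      unfolding meet_def using that by (intro nn_integral_cong) (auto simp: indicator_def)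
    then have "(meet y y')\<^sup>2 \<le> (\<integral>\<^sup>+w. (q (y - w) * indicator {int K..} (y - w))\<^sup>2 \<partial>cZ)
        * (\<integral>\<^sup>+w. (q (y' - w))\<^sup>2 \<partial>cZ)"
      by (simp only:) (rule Cauchy_Schwarz_nn_integral, auto)
    also have "(\<integral>\<^sup>+w. (q (y' - w))\<^sup>2 \<partial>cZ) = Q"
      unfolding Q_def by (rule nn_integral_int_reflect)
    also have "(\<integral>\<^sup>+w. (q (y - w) * indicator {int K..} (y - w))\<^sup>2 \<partial>cZ)
        = (\<integral>\<^sup>+k. (q k)\<^sup>2 * indicator {int K..} k \<partial>cZ)"
      by (subst nn_integral_int_reflect) (auto intro!: nn_integral_cong simp: indicator_def)
    also have "\<dots> * Q \<le> ennreal (e\<^sup>2 / Qr) * Q" by (intro mult_right_mono K) auto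
    also have "\<dots> = (ennreal e)\<^sup>2"
      using Qr e by (simp add: ennreal_power flip: ennreal_mult)
    finally show ?thesis by (rule ennreal_power2_le_imp_le)
  qed
  have "meet y y' \<le> ennreal e" if "\<bar>y - y'\<bar> \<ge> int K" for y y'
    using main[of y y'] main[of y' y] that by (cases "y \<ge> y'") (auto simp: meet_commute)
  then show ?thesis by blast
qed

text \<open>
  Cauchy-Schwarz; the window is small in the supremum norm compared with its energy.
\<close>
lemma window_square_le: "(window n z)\<^sup>2 \<le> of_nat n * Q"
proof -
  have "(\<integral>\<^sup>+i. q (int i - z) * 1 \<partial>count_space {1..n})\<^sup>2
      \<le> (\<integral>\<^sup>+i. (q (int i - z))\<^sup>2 \<partial>count_space {1..n}) * (\<integral>\<^sup>+i. 1\<^sup>2 \<partial>count_space {1..n})"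
    by (rule Cauchy_Schwarz_nn_integral) auto
  then have "(window n z)\<^sup>2 \<le> (\<Sum>i=1..n. (q (int i - z))\<^sup>2) * of_nat n"
    by (simp add: window_def nn_integral_count_space_finite)
  moreover have "(\<Sum>i=1..n. (q (int i - z))\<^sup>2) \<le> Q"
  proof -
    have "(\<Sum>i=1..n. (q (int i - z))\<^sup>2) = (\<Sum>k\<in>(\<lambda>i. int i - z) ` {1..n}. (q k)\<^sup>2)"
      by (subst sum.reindex) (auto simp: inj_on_def)
    also have "\<dots> = (\<integral>\<^sup>+k. (q k)\<^sup>2 * indicator ((\<lambda>i. int i - z) ` {1..n}) k \<partial>cZ)"
      by (subst nn_integral_indicator_finite) auto
    also have "\<dots> \<le> Q"
      unfolding Q_def by (intro nn_integral_mono) (auto simp: indicator_def)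
    finally show ?thesis .
  qed
  ultimately have "(window n z)\<^sup>2 \<le> Q * of_nat n"
    by (rule order_trans[OF _ mult_right_mono]) simp
  then show ?thesis by (simp add: mult.commute)
qed

end

section \<open>Tree sums\<close>

context heavy_tailed_jumps
begin

text \<open>
  The weight of \<open>w\<close> as an ancestor of a point \<open>y\<close> at which the lines of two vertices of the window
  have met. A binary tree with four leaves is either balanced, two such flows meeting at \<open>w\<close>, or a caterpillar, one
  flow meeting the lines of the two other vertices one after the other.
\<close>
definition pair_flow :: "nat \<Rightarrow> int \<Rightarrow> ennreal" where
  "pair_flow n w = (\<integral>\<^sup>+y. (window n y)\<^sup>2 * q (y - w) \<partial>cZ)"

definition balanced_sum :: "nat \<Rightarrow> ennreal" where
  "balanced_sum n = (\<integral>\<^sup>+w. (pair_flow n w)\<^sup>2 \<partial>cZ)"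

definition caterpillar_sum :: "nat \<Rightarrow> ennreal" where
  "caterpillar_sum n = (\<integral>\<^sup>+x. pair_flow n x * window n x * (\<integral>\<^sup>+w. q (x - w) * window n w \<partial>cZ) \<partial>cZ)"

lemma balanced_sum_meet:
  "balanced_sum n = (\<integral>\<^sup>+y. (\<integral>\<^sup>+y'. (window n y)\<^sup>2 * (window n y')\<^sup>2 * meet y y' \<partial>cZ) \<partial>cZ)"
proof -
  have "(pair_flow n w)\<^sup>2
      = (\<integral>\<^sup>+y. (\<integral>\<^sup>+y'. (window n y)\<^sup>2 * (window n y')\<^sup>2 * (q (y - w) * q (y' - w)) \<partial>cZ) \<partial>cZ)" for w
  proof -
    define f where "f y = (window n y)\<^sup>2 * q (y - w)" for y
    have "(pair_flow n w)\<^sup>2 = (\<integral>\<^sup>+y. f y \<partial>cZ) * (\<integral>\<^sup>+y. f y \<partial>cZ)"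
      by (simp add: power2_eq_square pair_flow_def f_def)
    also have "\<dots> = (\<integral>\<^sup>+y. f y * (\<integral>\<^sup>+y'. f y' \<partial>cZ) \<partial>cZ)"
      by (rule nn_integral_multc[symmetric]) simp
    also have "\<dots> = (\<integral>\<^sup>+y. (\<integral>\<^sup>+y'. f y * f y' \<partial>cZ) \<partial>cZ)"
      by (intro nn_integral_cong nn_integral_cmult[symmetric]) simp
    finally show ?thesis by (simp add: f_def mult_ac)
  qed
  then have "balanced_sum n = (\<integral>\<^sup>+w. (\<integral>\<^sup>+y. (\<integral>\<^sup>+y'. (window n y)\<^sup>2 * (window n y')\<^sup>2 * (q (y - w) * q (y' - w)) \<partial>cZ) \<partial>cZ) \<partial>cZ)"
    by (simp add: balanced_sum_def)
  also have "\<dots> = (\<integral>\<^sup>+y. (\<integral>\<^sup>+w. (\<integral>\<^sup>+y'. (window n y)\<^sup>2 * (window n y')\<^sup>2 * (q (y - w) * q (y' - w)) \<partial>cZ) \<partial>cZ) \<partial>cZ)"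
    by (rule nn_integral_int_swap)
  also have "\<dots> = (\<integral>\<^sup>+y. (\<integral>\<^sup>+y'. (\<integral>\<^sup>+w. (window n y)\<^sup>2 * (window n y')\<^sup>2 * (q (y - w) * q (y' - w)) \<partial>cZ) \<partial>cZ) \<partial>cZ)"
    by (intro nn_integral_cong nn_integral_int_swap)
  finally show ?thesis by (simp add: meet_def nn_integral_cmult)
qed

text \<open>
  Young's inequality only gives \<open>Q * (energy n)\<^sup>2\<close>. The gain comes from splitting the pairs \<open>y, y'\<close> according to
  their distance: distant pairs rarely meet, and close pairs carry little mass because the squared window is bounded
  by \<open>n * Q\<close>.
\<close>
lemma balanced_sum_bound:
  assumes K: "\<And>y y'. \<bar>y - y'\<bar> \<ge> int K \<Longrightarrow> meet y y' \<le> e"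
  shows "balanced_sum n \<le> e * (energy n)\<^sup>2 + of_nat (2 * K + 1) * of_nat n * Q\<^sup>2 * energy n"
proof -
  have inner: "(\<integral>\<^sup>+y'. (window n y)\<^sup>2 * (window n y')\<^sup>2 * meet y y' \<partial>cZ)
      \<le> (window n y)\<^sup>2 * (e * energy n + of_nat (2 * K + 1) * of_nat n * Q\<^sup>2)" for y
  proof -
    let ?I = "{y - int K..y + int K}"
    have "(\<integral>\<^sup>+y'. (window n y)\<^sup>2 * (window n y')\<^sup>2 * meet y y' \<partial>cZ)
        \<le> (\<integral>\<^sup>+y'. (window n y)\<^sup>2 * (e * (window n y')\<^sup>2 + of_nat n * Q\<^sup>2 * indicator ?I y') \<partial>cZ)"
    proof (rule nn_integral_mono)
      fix y'
      have "(window n y')\<^sup>2 * meet y y' \<le> e * (window n y')\<^sup>2 + of_nat n * Q\<^sup>2 * indicator ?I y'"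
      proof (cases "y' \<in> ?I")
        case True
        have "(window n y')\<^sup>2 * meet y y' \<le> (of_nat n * Q) * Q"
          by (intro mult_mono window_square_le meet_le_Q) auto
        also have "\<dots> = of_nat n * Q\<^sup>2 * indicator ?I y'"
          using True by (simp add: power2_eq_square mult.assoc)
        also have "\<dots> \<le> e * (window n y')\<^sup>2 + \<dots>" by (simp add: add_increasing)
        finally show ?thesis .
      next
        case False
        then have "meet y y' \<le> e" by (intro K) auto
        then have "(window n y')\<^sup>2 * meet y y' \<le> (window n y')\<^sup>2 * e" by (intro mult_left_mono) auto
        then show ?thesis using False by (simp add: mult.commute)
      qed
      then show "(window n y)\<^sup>2 * (window n y')\<^sup>2 * meet y y'
          \<le> (window n y)\<^sup>2 * (e * (window n y')\<^sup>2 + of_nat n * Q\<^sup>2 * indicator ?I y')"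
        unfolding mult.assoc by (intro mult_left_mono) (auto simp: mult.assoc)
    qed
    also have "\<dots> = (window n y)\<^sup>2 * (e * energy n + of_nat n * Q\<^sup>2 * (\<integral>\<^sup>+y'. indicator ?I y' \<partial>cZ))"
      by (simp add: nn_integral_cmult nn_integral_add energy_def)
    also have "(\<integral>\<^sup>+y'. indicator ?I y' \<partial>cZ) = of_nat (2 * K + 1)"
      by (simp add: nn_integral_indicator emeasure_count_space_finite nat_add_distrib nat_mult_distrib)
    finally show ?thesis by (simp add: mult_ac)
  qed
  have "balanced_sum n \<le> (\<integral>\<^sup>+y. (window n y)\<^sup>2 * (e * energy n + of_nat (2 * K + 1) * of_nat n * Q\<^sup>2) \<partial>cZ)"
    unfolding balanced_sum_meet by (intro nn_integral_mono inner)
  also have "\<dots> = energy n * (e * energy n + of_nat (2 * K + 1) * of_nat n * Q\<^sup>2)"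
    by (simp add: nn_integral_multc energy_def)
  finally show ?thesis by (simp add: distrib_left power2_eq_square mult_ac)
qed

text \<open>
  Cauchy-Schwarz twice: first for the sum over the root, which is bounded uniformly, then for the
  pairing of the flow with the window.
\<close>
lemma caterpillar_sum_bound: "(caterpillar_sum n)\<^sup>2 \<le> Q * balanced_sum n * (energy n)\<^sup>2"
proof -
  define T where "T x = (\<integral>\<^sup>+w. q (x - w) * window n w \<partial>cZ)" for x
  have T: "(T x)\<^sup>2 \<le> Q * energy n" for x
  proof -
    have "(T x)\<^sup>2 \<le> (\<integral>\<^sup>+w. (q (x - w))\<^sup>2 \<partial>cZ) * (\<integral>\<^sup>+w. (window n w)\<^sup>2 \<partial>cZ)"
      unfolding T_def by (rule Cauchy_Schwarz_nn_integral) auto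
    then show ?thesis
      using nn_integral_int_reflect[of "\<lambda>w. (q w)\<^sup>2" x] by (simp add: Q_def energy_def)
  qed
  have "(\<integral>\<^sup>+x. pair_flow n x * (window n x * T x) \<partial>cZ)\<^sup>2
      \<le> (\<integral>\<^sup>+x. (pair_flow n x)\<^sup>2 \<partial>cZ) * (\<integral>\<^sup>+x. (window n x * T x)\<^sup>2 \<partial>cZ)"
    by (rule Cauchy_Schwarz_nn_integral) auto
  also have "(\<integral>\<^sup>+x. (window n x * T x)\<^sup>2 \<partial>cZ) \<le> (\<integral>\<^sup>+x. (window n x)\<^sup>2 * (Q * energy n) \<partial>cZ)"
    unfolding power_mult_distrib by (intro nn_integral_mono mult_left_mono T) auto
  also have "\<dots> = energy n * (Q * energy n)"
    by (simp add: nn_integral_multc energy_def)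
  finally have "(\<integral>\<^sup>+x. pair_flow n x * (window n x * T x) \<partial>cZ)\<^sup>2
      \<le> balanced_sum n * (energy n * (Q * energy n))"
    by (simp add: balanced_sum_def mult_left_mono)
  then show ?thesis
    by (simp add: caterpillar_sum_def T_def power2_eq_square mult_ac)
qed

text \<open>
  The second term of \<open>balanced_sum_bound\<close> is negligible because \<open>n\<close> is small compared with \<open>scale n\<close>.
\<close>
lemma tree_sums_negligible:
  assumes e: "0 < e"
  shows "\<forall>\<^sub>F n in sequentially.
    balanced_sum n \<le> ennreal (e * (scale n)\<^sup>2) \<and> caterpillar_sum n \<le> ennreal (e * (scale n)\<^sup>2)"
proof -
  obtain Qr where Qr: "Q = ennreal Qr" "1 \<le> Qr"
    using Q_finite Q_ge_1 by (cases Q) auto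
  obtain C where C0: "0 \<le> C" and C: "\<And>n. 1 \<le> n \<Longrightarrow> energy n \<le> ennreal (C * scale n)"
    using energy_bound by blast
  \<comment> \<open>The first entry serves the balanced sum, the second the caterpillar sum, which is bounded by the square root of the balanced one.\<close>
  define e1 where "e1 = min e (e\<^sup>2 / (Qr * C\<^sup>2 + 1))"
  have den: "0 < Qr * C\<^sup>2 + 1" using Qr by (intro add_nonneg_pos mult_nonneg_nonneg) auto
  have e1: "0 < e1" "e1 \<le> e" "Qr * e1 * C\<^sup>2 \<le> e\<^sup>2"
  proof -
    show "0 < e1" "e1 \<le> e" using e den by (auto simp: e1_def)
    then have "(Qr * C\<^sup>2) * e1 \<le> (Qr * C\<^sup>2 + 1) * (e\<^sup>2 / (Qr * C\<^sup>2 + 1))"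
      using Qr den by (intro mult_mono) (auto simp: e1_def)
    then show "Qr * e1 * C\<^sup>2 \<le> e\<^sup>2" using den by (simp add: mult_ac)
  qed
  define e2 where "e2 = e1 / (2 * (C\<^sup>2 + 1))"
  have C1: "0 < C\<^sup>2 + 1" by (intro add_nonneg_pos) auto
  have e2: "0 < e2" using e1 C1 by (simp add: e2_def)
  have e2C: "e2 * C\<^sup>2 \<le> e1 / 2"
  proof -
    have "e2 * C\<^sup>2 \<le> e2 * (C\<^sup>2 + 1)" using e2 by (intro mult_left_mono) auto
    also have "e2 * (C\<^sup>2 + 1) = e1 / 2" using C1 by (simp add: e2_def divide_simps del: sum_power2_gt_zero_iff)
    finally show ?thesis .
  qed
  obtain K where K: "\<And>y y'. \<bar>y - y'\<bar> \<ge> int K \<Longrightarrow> meet y y' \<le> ennreal e2"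
    using meet_small[OF e2] by blast
  define D where "D = real (2 * K + 1) * Qr\<^sup>2 * C"
  have "(\<lambda>n. D * (tail \<mu> n)\<^sup>2) \<longlonglongrightarrow> D * 0\<^sup>2"
    by (intro tendsto_intros tail_tendsto_0)
  then have "\<forall>\<^sub>F n in sequentially. D * (tail \<mu> n)\<^sup>2 < e1 / 2"
    using e1 by (intro order_tendstoD) auto
  then show ?thesis
    using eventually_ge_at_top[of 1]
  proof eventually_elim
    case (elim n)
    have sp: "0 < scale n" using elim by (intro scale_pos)
    have nD: "D * real n \<le> e1 / 2 * scale n"
    proof -
      have "D * real n = (D * (tail \<mu> n)\<^sup>2) * scale n"
        using tail_pos[of n] by (simp add: scale_def)
      also have "\<dots> \<le> e1 / 2 * scale n" using elim sp by (intro mult_right_mono) auto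
      finally show ?thesis .
    qed
    have "balanced_sum n \<le> ennreal e2 * (energy n)\<^sup>2 + of_nat (2 * K + 1) * of_nat n * Q\<^sup>2 * energy n"
      by (rule balanced_sum_bound) (rule K)
    also have "\<dots> \<le> ennreal e2 * (ennreal (C * scale n))\<^sup>2 + of_nat (2 * K + 1) * of_nat n * Q\<^sup>2 * ennreal (C * scale n)"
      using elim by (intro add_mono mult_left_mono power_mono C) auto
    also have "\<dots> = ennreal (e2 * (C * scale n)\<^sup>2 + real (2 * K + 1) * real n * Qr\<^sup>2 * (C * scale n))"
    proof -
      have "ennreal e2 * (ennreal s)\<^sup>2 + of_nat (2 * K + 1) * of_nat n * Q\<^sup>2 * ennreal s
          = ennreal (e2 * s\<^sup>2 + real (2 * K + 1) * real n * Qr\<^sup>2 * s)" if "0 \<le> s" for s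
        using e2 Qr that
        by (simp add: ennreal_power ennreal_mult ennreal_plus ennreal_of_nat_eq_real_of_nat
            del: of_nat_add of_nat_mult of_nat_Suc)
      then show ?thesis using C0 sp by simp
    qed
    also have "\<dots> \<le> ennreal (e1 * (scale n)\<^sup>2)"
    proof (rule ennreal_leI)
      have "e2 * (C * scale n)\<^sup>2 = (e2 * C\<^sup>2) * (scale n)\<^sup>2" by (simp add: power_mult_distrib)
      also have "\<dots> \<le> e1 / 2 * (scale n)\<^sup>2" using e2C by (intro mult_right_mono) auto
      finally have "e2 * (C * scale n)\<^sup>2 \<le> e1 / 2 * (scale n)\<^sup>2" .
      moreover have "real (2 * K + 1) * real n * Qr\<^sup>2 * (C * scale n) = (D * real n) * scale n"
        by (simp add: D_def)
      moreover have "(D * real n) * scale n \<le> (e1 / 2 * scale n) * scale n"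
        using nD sp by (intro mult_right_mono) auto
      moreover have "(e1 / 2 * scale n) * scale n = e1 / 2 * (scale n)\<^sup>2"
        by (simp add: power2_eq_square)
      moreover have "e1 / 2 * (scale n)\<^sup>2 + e1 / 2 * (scale n)\<^sup>2 = e1 * (scale n)\<^sup>2" by simp
      ultimately show "e2 * (C * scale n)\<^sup>2 + real (2 * K + 1) * real n * Qr\<^sup>2 * (C * scale n) \<le> e1 * (scale n)\<^sup>2"
        by linarith
    qed
    finally have b: "balanced_sum n \<le> ennreal (e1 * (scale n)\<^sup>2)" .
    also have "\<dots> \<le> ennreal (e * (scale n)\<^sup>2)" using e1 by (intro ennreal_leI mult_right_mono) auto
    finally have b': "balanced_sum n \<le> ennreal (e * (scale n)\<^sup>2)" .
    have "(caterpillar_sum n)\<^sup>2 \<le> Q * balanced_sum n * (energy n)\<^sup>2" by (rule caterpillar_sum_bound)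
    also have "\<dots> \<le> ennreal Qr * ennreal (e1 * (scale n)\<^sup>2) * (ennreal (C * scale n))\<^sup>2"
      unfolding Qr(1) using elim by (intro mult_mono mult_left_mono b power_mono C) auto
    also have "\<dots> = ennreal (Qr * (e1 * (scale n)\<^sup>2) * (C * scale n)\<^sup>2)"
    proof -
      have "ennreal Qr * ennreal (e1 * (scale n)\<^sup>2) * (ennreal s)\<^sup>2
          = ennreal (Qr * (e1 * (scale n)\<^sup>2) * s\<^sup>2)" if "0 \<le> s" for s
        using Qr e1 that by (simp add: ennreal_power ennreal_mult)
      then show ?thesis using C0 sp by simp
    qed
    also have "\<dots> \<le> ennreal ((e * (scale n)\<^sup>2)\<^sup>2)"
    proof (rule ennreal_leI)
      have "Qr * (e1 * (scale n)\<^sup>2) * (C * scale n)\<^sup>2 = (Qr * e1 * C\<^sup>2) * ((scale n)\<^sup>2)\<^sup>2"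
        by (simp add: power_mult_distrib power2_eq_square mult_ac)
      also have "\<dots> \<le> e\<^sup>2 * ((scale n)\<^sup>2)\<^sup>2" using e1 by (intro mult_right_mono) auto
      finally show "Qr * (e1 * (scale n)\<^sup>2) * (C * scale n)\<^sup>2 \<le> (e * (scale n)\<^sup>2)\<^sup>2"
        by (simp add: power_mult_distrib)
    qed
    also have "\<dots> = (ennreal (e * (scale n)\<^sup>2))\<^sup>2" using e by (simp add: ennreal_power)
    finally have "caterpillar_sum n \<le> ennreal (e * (scale n)\<^sup>2)" by (rule ennreal_power2_le_imp_le)
    with b' show ?case by simp
  qed
qed

end

section \<open>A lower bound for quadratic forms with signs\<close>

lemma sum_squares_lower: "real l ^ 3 / 3 \<le> (\<Sum>k<l. (real (Suc k))\<^sup>2)"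
proof (induction l)
  case (Suc l)
  have "real (Suc l) ^ 3 / 3 \<le> real l ^ 3 / 3 + (real (Suc l))\<^sup>2"
    by (simp add: power3_eq_cube power2_eq_square algebra_simps)
  then show ?case using Suc by simp
qed simp

context heavy_tailed_jumps
begin

text \<open>
  Karamata's estimate, from the Potter bound with the exponent \<open>1 / 2\<close>.
\<close>
lemma tail_sum_upper:
  assumes "1 \<le> m"
  shows "(\<Sum>i=1..m. tail \<mu> i) \<le> 2 / \<kappa> * (real m * tail \<mu> m)"
proof -
  have "(\<Sum>i=1..m. tail \<mu> i) \<le> (\<Sum>i=1..m. tail \<mu> m * sqrt (real m) / \<kappa> * (1 / sqrt (real i)))"
  proof (rule sum_mono)
    fix i assume i: "i \<in> {1..m}"
    have "(real i / real m) powr (1 / 2) \<le> (real i / real m) powr a"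
      using i a by (intro powr_mono') auto
    then have "\<kappa> * sqrt (real i / real m) * tail \<mu> i \<le> \<kappa> * (real i / real m) powr a * tail \<mu> i"
      using \<kappa> by (intro mult_right_mono mult_left_mono tail_nonneg) (auto simp: powr_half_sqrt)
    also have "\<dots> \<le> tail \<mu> m" using i by (intro potter) auto
    finally show "tail \<mu> i \<le> tail \<mu> m * sqrt (real m) / \<kappa> * (1 / sqrt (real i))"
      using i \<kappa> by (simp add: real_sqrt_divide field_simps)
  qed
  also have "\<dots> = tail \<mu> m * sqrt (real m) / \<kappa> * (\<Sum>i=1..m. 1 / sqrt (real i))"
    by (simp add: sum_distrib_left)
  also have "\<dots> \<le> tail \<mu> m * sqrt (real m) / \<kappa> * (2 * sqrt (real m))"
    using \<kappa> by (intro mult_left_mono sum_inverse_sqrt_le) (auto simp: tail_nonneg)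
  also have "\<dots> = 2 / \<kappa> * (real m * tail \<mu> m)" by simp
  finally show ?thesis .
qed

text \<open>
  Combine \<open>renewal_sum_lower\<close> with \<open>tail_sum_upper\<close> at \<open>Suc k\<close>, and pass to the tail at \<open>n\<close> by the Potter bound with the
  exponent \<open>1\<close>. The resulting bound is linear in \<open>k\<close>, which makes its squares easy to sum.
\<close>
lemma renewal_sum_ge:
  assumes "Suc k \<le> n"
  shows "\<kappa>\<^sup>2 / (2 * real n * tail \<mu> n) * real (Suc k) \<le> (\<Sum>j\<le>k. renewal \<mu> j)"
proof -
  define U where "U = (\<Sum>j\<le>k. renewal \<mu> j)"
  have U: "0 \<le> U" unfolding U_def by (intro sum_nonneg renewal_nonneg)
  let ?m = "Suc k"
  have alg: "x * (y * (s * t)) = s * (x * (y * t))" for x y s t :: real by simp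
  have "real ?m \<le> U * (\<Sum>i=1..?m. tail \<mu> i)"
    unfolding U_def by (rule renewal_sum_lower[OF pmf_0])
  also have "\<dots> \<le> U * (2 / \<kappa> * (real ?m * tail \<mu> ?m))"
    using U by (intro mult_left_mono tail_sum_upper) auto
  also have "\<dots> = real ?m * (U * (2 / \<kappa> * tail \<mu> ?m))" by (rule alg)
  finally have "real ?m * 1 \<le> real ?m * (U * (2 / \<kappa> * tail \<mu> ?m))" unfolding mult_1_right .
  then have U1: "1 \<le> U * (2 / \<kappa> * tail \<mu> ?m)"
    by (rule mult_left_le_imp_le) simp
  have "(real ?m / real n) powr 1 \<le> (real ?m / real n) powr a"
    using assms a by (intro powr_mono') auto
  then have "\<kappa> * (real ?m / real n) * tail \<mu> ?m \<le> \<kappa> * (real ?m / real n) powr a * tail \<mu> ?m"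
    using \<kappa> by (intro mult_right_mono mult_left_mono tail_nonneg) auto
  also have "\<dots> \<le> tail \<mu> n" using assms by (intro potter) auto
  finally have P: "\<kappa> * (real ?m / real n) * tail \<mu> ?m \<le> tail \<mu> n" .
  have n0: "0 < real n" using assms by simp
  have "\<kappa>\<^sup>2 * real ?m * 1 \<le> \<kappa>\<^sup>2 * real ?m * (U * (2 / \<kappa> * tail \<mu> ?m))"
    by (intro mult_left_mono U1) auto
  also have "\<dots> = U * 2 * real n * (\<kappa> * (real ?m / real n) * tail \<mu> ?m)"
    using \<kappa> n0 by (simp add: power2_eq_square)
  also have "\<dots> \<le> U * 2 * real n * tail \<mu> n"
    using U by (intro mult_left_mono P) auto
  finally show ?thesis
    unfolding U_def[symmetric] using n0 tail_pos[of n] by (simp add: field_simps)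
qed

text \<open>
  The matrix \<open>meet i j\<close> is the Gram matrix of the shifted renewal weights.
\<close>
lemma quadratic_form_ge:
  assumes S: "finite S" and F: "finite F"
  shows "(\<Sum>z\<in>F. (\<Sum>i\<in>S. b i * enn2real (q (i - z)))\<^sup>2)
    \<le> (\<Sum>i\<in>S. \<Sum>j\<in>S. b i * b j * enn2real (meet i j))"
proof -
  define r where "r k = enn2real (q k)" for k
  have rq: "ennreal (r k) = q k" for k by (simp add: r_def hit_def)
  have r0: "0 \<le> r k" for k by (simp add: r_def)
  have nn: "(\<integral>\<^sup>+z. ennreal (r (i - z) * r (j - z)) \<partial>cZ) = meet i j" for i j
    by (simp add: meet_def ennreal_mult r0 rq)
  have fin: "meet i j < \<infinity>" for i j using meet_le_Q Q_finite by (rule le_less_trans)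
  have int: "integrable cZ (\<lambda>z. r (i - z) * r (j - z))" for i j
    using fin[of i j] by (intro integrableI_nonneg) (auto simp: nn r0)
  have val: "(\<integral>z. r (i - z) * r (j - z) \<partial>cZ) = enn2real (meet i j)" for i j
    by (subst integral_eq_nn_integral) (auto simp: nn r0)
  define g where "g z = (\<Sum>i\<in>S. b i * r (i - z))\<^sup>2" for z
  have g: "g z = (\<Sum>i\<in>S. \<Sum>j\<in>S. b i * b j * (r (i - z) * r (j - z)))" for z
    by (simp add: g_def power2_eq_square sum_product mult_ac)
  have ig: "integrable cZ g" unfolding g[abs_def]
    by (intro Bochner_Integration.integrable_sum integrable_mult_right int)
  have "(\<Sum>z\<in>F. g z) = (\<integral>z. indicator F z * g z \<partial>cZ)"
    using F by (subst lebesgue_integral_count_space_finite_support)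
      (auto intro!: sum.mono_neutral_cong_right simp: indicator_def elim: finite_subset[rotated])
  also have "\<dots> \<le> (\<integral>z. g z \<partial>cZ)"
  proof (rule integral_mono)
    show "integrable cZ (\<lambda>z. indicator F z * g z)"
      using integrable_mult_indicator[OF _ ig, of F] by simp
    show "indicator F z * g z \<le> g z" for z by (auto simp: indicator_def g_def)
  qed (rule ig)
  also have "\<dots> = (\<Sum>i\<in>S. \<Sum>j\<in>S. b i * b j * enn2real (meet i j))"
    unfolding g by (simp add: integral_sum integrable_sum int val)
  finally show ?thesis by (simp add: g_def r_def)
qed

text \<open>
  Keep only the levels \<open>z\<close> with \<open>n1 < z \<le> n2\<close>: there the ancestral weights see \<open>b\<close> only where it equals \<open>\<beta>\<close> or \<open>0\<close>,
  and the inner sum is \<open>\<beta>\<close> times a partial sum of renewal weights.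
\<close>
lemma quadratic_form_lower:
  fixes b :: "int \<Rightarrow> real"
  assumes n: "n1 < n2" "n2 \<le> N"
    and b1: "\<And>i. int n1 < i \<Longrightarrow> i \<le> int n2 \<Longrightarrow> b i = \<beta>"
    and b0: "\<And>i. int n2 < i \<Longrightarrow> b i = 0"
  shows "\<beta>\<^sup>2 * \<kappa> ^ 4 / 12 * (real (n2 - n1) / real N) ^ 3 * scale N
    \<le> (\<Sum>i\<in>{1..int N}. \<Sum>j\<in>{1..int N}. b i * b j * enn2real (meet i j))"
proof -
  define l where "l = n2 - n1"
  define c where "c = \<kappa>\<^sup>2 / (2 * real N * tail \<mu> N)"
  have N0: "0 < real N" using n by simp
  have c: "0 \<le> c" using tail_nonneg by (simp add: c_def)
  have row: "(\<Sum>i\<in>{1..int N}. b i * enn2real (q (i - (int n2 - int k)))) = \<beta> * (\<Sum>j\<le>k. renewal \<mu> j)"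
    if k: "k < l" for k
  proof -
    have kl: "k < n2 - n1" using k by (simp add: l_def)
    have "(\<Sum>i\<in>{1..int N}. b i * enn2real (q (i - (int n2 - int k))))
        = (\<Sum>i\<in>{int n2 - int k..int n2}. b i * enn2real (q (i - (int n2 - int k))))"
      using n kl by (intro sum.mono_neutral_right) (auto simp: b0 not_le)
    also have "\<dots> = (\<Sum>j\<le>k. \<beta> * renewal \<mu> j)"
      using n kl
      by (intro sum.reindex_bij_witness[of _ "\<lambda>j. int n2 - int k + int j" "\<lambda>i. nat (i - (int n2 - int k))"])
         (auto simp: hit_def b1 renewal_nonneg)
    finally show ?thesis by (simp add: sum_distrib_left)
  qed
  have "\<beta>\<^sup>2 * \<kappa> ^ 4 / 12 * (real (n2 - n1) / real N) ^ 3 * scale N = \<beta>\<^sup>2 * c\<^sup>2 * (real l ^ 3 / 3)"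
    using N0 by (simp add: c_def scale_def l_def power2_eq_square power3_eq_cube power4_eq_xxxx field_simps)
  also have "\<dots> \<le> \<beta>\<^sup>2 * c\<^sup>2 * (\<Sum>k<l. (real (Suc k))\<^sup>2)"
    by (intro mult_left_mono sum_squares_lower) auto
  also have "\<dots> = (\<Sum>k<l. \<beta>\<^sup>2 * (c * real (Suc k))\<^sup>2)"
    by (simp add: sum_distrib_left power_mult_distrib mult.assoc)
  also have "\<dots> \<le> (\<Sum>k<l. \<beta>\<^sup>2 * (\<Sum>j\<le>k. renewal \<mu> j)\<^sup>2)"
  proof (intro sum_mono mult_left_mono power_mono)
    fix k assume "k \<in> {..<l}"
    then have "Suc k \<le> N" using n by (simp add: l_def)
    then show "c * real (Suc k) \<le> (\<Sum>j\<le>k. renewal \<mu> j)"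
      unfolding c_def by (rule renewal_sum_ge)
  qed (use c in auto)
  also have "\<dots> = (\<Sum>k<l. (\<Sum>i\<in>{1..int N}. b i * enn2real (q (i - (int n2 - int k))))\<^sup>2)"
    by (intro sum.cong refl) (simp add: row power_mult_distrib)
  also have "\<dots> = (\<Sum>z\<in>(\<lambda>k. int n2 - int k) ` {..<l}. (\<Sum>i\<in>{1..int N}. b i * enn2real (q (i - z)))\<^sup>2)"
    by (subst sum.reindex) (auto simp: inj_on_def)
  also have "\<dots> \<le> (\<Sum>i\<in>{1..int N}. \<Sum>j\<in>{1..int N}. b i * b j * enn2real (meet i j))"
    by (rule quadratic_form_ge) auto
  finally show ?thesis .
qed

end

section \<open>Ancestral lines\<close>

primrec path :: "(int \<Rightarrow> nat) \<Rightarrow> int \<Rightarrow> nat \<Rightarrow> int" where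
  "path r i 0 = i"
| "path r i (Suc k) = path r i k - int (r (path r i k))"

definition ancestors :: "(int \<Rightarrow> nat) \<Rightarrow> int \<Rightarrow> int set" where
  "ancestors r i = range (path r i)"

lemma path_shift: "path r i (Suc k) = path r (i - int (r i)) k"
  by (induction k) auto

lemma path_add: "path r i (k + l) = path r (path r i k) l"
  by (induction l) auto

lemma path_le: "path r i k \<le> i"
  by (induction k) auto

lemma ancestors_le: "v \<in> ancestors r i \<Longrightarrow> v \<le> i"
  using path_le by (auto simp: ancestors_def)

lemma self_ancestor [simp]: "i \<in> ancestors r i"
  unfolding ancestors_def by (rule range_eqI[of _ _ 0]) simp

lemma ancestors_trans: "v \<in> ancestors r i \<Longrightarrow> w \<in> ancestors r v \<Longrightarrow> w \<in> ancestors r i"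
  unfolding ancestors_def by (auto simp flip: path_add)

lemma ancestors_chain:
  assumes "v \<in> ancestors r i" "w \<in> ancestors r i"
  shows "v \<in> ancestors r w \<or> w \<in> ancestors r v"
proof -
  obtain k l where v: "v = path r i k" and w: "w = path r i l"
    using assms by (auto simp: ancestors_def)
  consider m where "l = k + m" | m where "k = l + m" by (metis le_Suc_ex linear)
  then show ?thesis by cases (auto simp: v w path_add ancestors_def)
qed

lemma ancestors_unfold: "ancestors r i = insert i (ancestors r (i - int (r i)))"
proof -
  have "range (path r i) = insert (path r i 0) ((\<lambda>k. path r i (Suc k)) ` UNIV)"
    by (subst UNIV_nat_eq) (simp add: image_image)
  then show ?thesis by (simp add: ancestors_def path_shift del: path.simps(2))
qed

lemma ancestors_update: "j < i \<Longrightarrow> ancestors (r(i := m)) j = ancestors r j"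
proof -
  assume "j < i"
  have "path (r(i := m)) j k = path r j k" for k
  proof (induction k)
    case (Suc k)
    have "path r j k \<noteq> i" using path_le[of r j k] \<open>j < i\<close> by auto
    then show ?case using Suc by simp
  qed simp
  then show ?thesis by (simp add: ancestors_def)
qed

lemma ancestors_update_self:
  "0 < m \<Longrightarrow> ancestors (r(i := m)) i = insert i (ancestors r (i - int m))"
  by (subst ancestors_unfold) (simp add: ancestors_update)

text \<open>
  With \<open>A = {z0..}\<close> the event depends on finitely many jumps, and the lines that have fallen below
  \<open>z0\<close> no longer matter; this makes induction possible.
\<close>
definition common_anc :: "int set \<Rightarrow> (int \<Rightarrow> nat) \<Rightarrow> (nat \<Rightarrow> int) \<Rightarrow> nat set \<Rightarrow> bool" where
  "common_anc A r x I \<longleftrightarrow> (\<exists>v\<in>A. \<forall>b\<in>I. v \<in> ancestors r (x b))"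

text \<open>
  The line of the unique highest vertex leaves it before it can meet the others, and no other line uses the
  jump at this vertex.
\<close>
lemma common_anc_step:
  assumes b: "b \<in> I" "b \<noteq> c" and lt: "\<And>b. b \<in> I \<Longrightarrow> b \<noteq> c \<Longrightarrow> x b < x c" and m: "0 < m"
  shows "common_anc A (r(x c := m)) x I \<longleftrightarrow> common_anc A r (x(c := x c - int m)) I"
proof -
  have "(\<forall>b\<in>I. v \<in> ancestors (r(x c := m)) (x b))
      \<longleftrightarrow> (\<forall>b\<in>I. v \<in> ancestors r ((x(c := x c - int m)) b))" for v
  proof -
    have "v \<in> ancestors (r(x c := m)) (x b') \<longleftrightarrow> v \<in> ancestors r ((x(c := x c - int m)) b')"
      if "b' \<in> I" "v \<noteq> x c" for b'
      using that lt[of b'] m by (cases "b' = c") (auto simp: ancestors_update ancestors_update_self)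
    moreover have "v \<notin> ancestors (r(x c := m)) (x b)" "v \<notin> ancestors r ((x(c := x c - int m)) b)" if "v = x c"
      using b lt[OF b] that by (auto dest: ancestors_le)
    ultimately show ?thesis using b(1) by (cases "v = x c") (auto simp del: fun_upd_apply)
  qed
  then show ?thesis by (simp add: common_anc_def)
qed

definition jumps :: "nat pmf \<Rightarrow> (int \<Rightarrow> nat) measure" where
  "jumps \<mu> = PiM UNIV (\<lambda>_. measure_pmf \<mu>)"

lemma space_jumps [simp]: "space (jumps \<mu>) = UNIV"
  by (simp add: jumps_def space_PiM)

lemma prob_space_jumps: "prob_space (jumps \<mu>)"
  unfolding jumps_def by (intro prob_space_PiM measure_pmf.prob_space_axioms)

lemma sets_jumps: "sets (jumps \<mu>) = sets (PiM UNIV (\<lambda>_. count_space UNIV))"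
  unfolding jumps_def by (intro sets_PiM_cong) auto

lemma measurable_coordinate [measurable]: "(\<lambda>r. r i) \<in> measurable (jumps \<mu>) (count_space UNIV)"
proof -
  have "(\<lambda>r. r i) \<in> measurable (jumps \<mu>) (measure_pmf \<mu>)"
    unfolding jumps_def by (rule measurable_component_singleton) simp
  then show ?thesis by (simp add: measurable_def)
qed

lemma measurable_path [measurable]: "(\<lambda>r. path r i k) \<in> measurable (jumps \<mu>) (count_space UNIV)"
proof (induction k)
  case (Suc k)
  note Suc [measurable]
  have "(\<lambda>r. (\<lambda>v r. v - int (r v)) (path r i k) r) \<in> measurable (jumps \<mu>) (count_space UNIV)"
    by (rule measurable_compose_countable[OF _ Suc]) measurable
  then show ?case by simp
qed simp

lemma measurable_ancestor [measurable]: "Measurable.pred (jumps \<mu>) (\<lambda>r. v \<in> ancestors r i)"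
proof -
  have "(\<lambda>r. v \<in> ancestors r i) = (\<lambda>r. \<exists>k. path r i k = v)" by (auto simp: ancestors_def)
  then show ?thesis by simp
qed

lemma measurable_common_anc [measurable]:
  assumes "finite I"
  shows "Measurable.pred (jumps \<mu>) (\<lambda>r. common_anc A r x I)"
proof -
  have "(\<lambda>r. common_anc A r x I) = (\<lambda>r. \<exists>v. v \<in> A \<and> (\<forall>b\<in>I. v \<in> ancestors r (x b)))"
    by (auto simp: common_anc_def)
  moreover have "Measurable.pred (jumps \<mu>) (\<lambda>r. \<exists>v. v \<in> A \<and> (\<forall>b\<in>I. v \<in> ancestors r (x b)))"
    using assms by measurable
  ultimately show ?thesis by simp
qed

text \<open>
  The coordinate \<open>r i\<close> is independent of all others, so it may be replaced by an independent jump.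
\<close>
lemma resample:
  assumes E: "Measurable.pred (jumps \<mu>) E"
  shows "emeasure (jumps \<mu>) {r. E r}
    = (\<integral>\<^sup>+m. emeasure (jumps \<mu>) {r. E (r(i := m))} \<partial>measure_pmf \<mu>)"
proof -
  interpret J: prob_space "jumps \<mu>" by (rule prob_space_jumps)
  have eq: "distr (measure_pmf \<mu> \<Otimes>\<^sub>M jumps \<mu>) (jumps \<mu>) (\<lambda>(m, r). r(i := m)) = jumps \<mu>"
    using distr_pair_PiM_eq_PiM[of UNIV "\<lambda>_. measure_pmf \<mu>" i, OF measure_pmf.prob_space_axioms measure_pmf.prob_space_axioms]
    by (simp add: jumps_def insert_UNIV)
  have meas: "(\<lambda>(m, r). r(i := m)) \<in> measurable (measure_pmf \<mu> \<Otimes>\<^sub>M jumps \<mu>) (jumps \<mu>)"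
    using measurable_fun_upd[of UNIV UNIV i snd "measure_pmf \<mu> \<Otimes>\<^sub>M jumps \<mu>" "\<lambda>_. measure_pmf \<mu>" fst]
    by (simp add: jumps_def case_prod_unfold)
  have S: "{r. E r} \<in> sets (jumps \<mu>)" using E by (simp add: pred_def)
  have "emeasure (jumps \<mu>) {r. E r}
      = emeasure (measure_pmf \<mu> \<Otimes>\<^sub>M jumps \<mu>) ((\<lambda>(m, r). r(i := m)) -` {r. E r} \<inter> space (measure_pmf \<mu> \<Otimes>\<^sub>M jumps \<mu>))"
    by (subst (1) eq[symmetric]) (rule emeasure_distr[OF meas S])
  also have "\<dots> = (\<integral>\<^sup>+m. emeasure (jumps \<mu>) (Pair m -` ((\<lambda>(m, r). r(i := m)) -` {r. E r} \<inter> space (measure_pmf \<mu> \<Otimes>\<^sub>M jumps \<mu>))) \<partial>measure_pmf \<mu>)"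
    by (rule J.emeasure_pair_measure_alt) (rule measurable_sets[OF meas S])
  also have "\<dots> = (\<integral>\<^sup>+m. emeasure (jumps \<mu>) {r. E (r(i := m))} \<partial>measure_pmf \<mu>)"
    by (intro nn_integral_cong arg_cong2[where f = emeasure] refl) (auto simp: space_pair_measure)
  finally show ?thesis .
qed

lemma AE_jump_pos:
  fixes \<mu> :: "nat pmf"
  assumes "pmf \<mu> 0 = 0" shows "AE m in measure_pmf \<mu>. 0 < m"
proof -
  have "0 \<notin> set_pmf \<mu>" using assms by (simp add: set_pmf_iff)
  then show ?thesis unfolding AE_measure_pmf_iff by (auto intro!: gr0I)
qed

text \<open>
  Reveal the jump of the highest vertex, as long as all vertices are distinct and none is below \<open>z0\<close>. Every step
  lowers a vertex, so the process ends with a tie or with a vertex below \<open>z0\<close>, where \<open>F\<close> and \<open>G\<close> are compared directly.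
\<close>
lemma coalescence_comparison:
  fixes F G :: "(nat \<Rightarrow> int) \<Rightarrow> ennreal"
  assumes \<mu>0: "pmf \<mu> 0 = 0" and I: "finite I" "I \<noteq> {}"
    and F: "\<And>x c. inj_on x I \<Longrightarrow> c \<in> I \<Longrightarrow> (\<And>b. b \<in> I \<Longrightarrow> b \<noteq> c \<Longrightarrow> x b < x c) \<Longrightarrow>
        F x \<le> (\<integral>\<^sup>+m. F (x(c := x c - int m)) \<partial>measure_pmf \<mu>)"
    and G: "\<And>x c. inj_on x I \<Longrightarrow> c \<in> I \<Longrightarrow> (\<And>b. b \<in> I \<Longrightarrow> b \<noteq> c \<Longrightarrow> x b < x c) \<Longrightarrow>
        (\<integral>\<^sup>+m. G (x(c := x c - int m)) \<partial>measure_pmf \<mu>) \<le> G x"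
    and tie: "\<And>x b c. b \<in> I \<Longrightarrow> c \<in> I \<Longrightarrow> b \<noteq> c \<Longrightarrow> x b = x c \<Longrightarrow> F x \<le> G x"
    and low: "\<And>x b. b \<in> I \<Longrightarrow> x b < z0 \<Longrightarrow> F x \<le> G x"
  shows "F x \<le> G x"
proof (induction "\<Sum>b\<in>I. nat (x b - z0 + 1)" arbitrary: x rule: less_induct)
  case (less x)
  consider b where "b \<in> I" "x b < z0" | "\<not> inj_on x I" | "inj_on x I" "\<And>b. b \<in> I \<Longrightarrow> z0 \<le> x b"
    by (meson not_le)
  then show ?case
  proof cases
    case 1
    then show ?thesis by (rule low)
  next
    case 2
    then show ?thesis using tie by (auto simp: inj_on_def)
  next
    case 3
    have "Max (x ` I) \<in> x ` I" using I by (intro Max_in) auto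
    then obtain c where c: "c \<in> I" "x c = Max (x ` I)" by auto
    have lt: "x b < x c" if "b \<in> I" "b \<noteq> c" for b
    proof -
      have "x b \<le> x c" using that I c by simp
      moreover have "x b \<noteq> x c" using 3(1) that c by (auto simp: inj_on_def)
      ultimately show ?thesis by simp
    qed
    have "F x \<le> (\<integral>\<^sup>+m. F (x(c := x c - int m)) \<partial>measure_pmf \<mu>)" by (rule F[OF 3(1) c(1) lt])
    also have "\<dots> \<le> (\<integral>\<^sup>+m. G (x(c := x c - int m)) \<partial>measure_pmf \<mu>)"
    proof (rule nn_integral_mono_AE)
      have *: "F (x(c := x c - int m)) \<le> G (x(c := x c - int m))" if "0 < m" for m
      proof (rule less)
        show "(\<Sum>b\<in>I. nat ((x(c := x c - int m)) b - z0 + 1)) < (\<Sum>b\<in>I. nat (x b - z0 + 1))"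
        proof (rule sum_strict_mono_ex1[OF I(1)])
          show "\<forall>b\<in>I. nat ((x(c := x c - int m)) b - z0 + 1) \<le> nat (x b - z0 + 1)" by auto
          show "\<exists>b\<in>I. nat ((x(c := x c - int m)) b - z0 + 1) < nat (x b - z0 + 1)"
            using that 3(2)[OF c(1)] by (intro bexI[OF _ c(1)]) auto
        qed
      qed
      show "AE m in measure_pmf \<mu>. F (x(c := x c - int m)) \<le> G (x(c := x c - int m))"
        using AE_jump_pos[OF \<mu>0] by eventually_elim (rule *)
    qed
    also have "\<dots> \<le> G x" by (rule G[OF 3(1) c(1) lt])
    finally show ?thesis .
  qed
qed

section \<open>Coalescence of two ancestral lines\<close>

definition coal :: "nat pmf \<Rightarrow> int set \<Rightarrow> (nat \<Rightarrow> int) \<Rightarrow> nat set \<Rightarrow> ennreal" where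
  "coal \<mu> A x I = emeasure (jumps \<mu>) {r. common_anc A r x I}"

lemma emeasure_jumps_mono:
  assumes "\<And>r. E r \<Longrightarrow> E' r" "Measurable.pred (jumps \<mu>) E'"
  shows "emeasure (jumps \<mu>) {r. E r} \<le> emeasure (jumps \<mu>) {r. E' r}"
  using assms by (intro emeasure_mono) (auto simp: pred_def)

lemma coal_step:
  assumes \<mu>0: "pmf \<mu> 0 = 0" and I: "finite I" and b: "b \<in> I" "b \<noteq> c"
    and lt: "\<And>b. b \<in> I \<Longrightarrow> b \<noteq> c \<Longrightarrow> x b < x c"
  shows "coal \<mu> A x I = (\<integral>\<^sup>+m. coal \<mu> A (x(c := x c - int m)) I \<partial>measure_pmf \<mu>)"
proof -
  have "coal \<mu> A x I
      = (\<integral>\<^sup>+m. emeasure (jumps \<mu>) {r. common_anc A (r(x c := m)) x I} \<partial>measure_pmf \<mu>)"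
    unfolding coal_def by (rule resample[OF measurable_common_anc[OF I]])
  also have "\<dots> = (\<integral>\<^sup>+m. coal \<mu> A (x(c := x c - int m)) I \<partial>measure_pmf \<mu>)"
  proof (rule nn_integral_cong_AE)
    show "AE m in measure_pmf \<mu>. emeasure (jumps \<mu>) {r. common_anc A (r(x c := m)) x I}
        = coal \<mu> A (x(c := x c - int m)) I"
      using AE_jump_pos[OF \<mu>0]
    proof eventually_elim
      case (elim m)
      have "common_anc A (r(x c := m)) x I \<longleftrightarrow> common_anc A r (x(c := x c - int m)) I" for r
        by (rule common_anc_step[where b = b]) (use b lt elim in auto)
      then show ?case by (simp only: coal_def)
    qed
  qed
  finally show ?thesis .
qed

lemma coal_low:
  assumes "b \<in> I" "x b < z0"
  shows "coal \<mu> {z0..} x I = 0"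
proof -
  have "\<not> common_anc {z0..} r x I" for r
    using assms by (force simp: common_anc_def dest: ancestors_le)
  then show ?thesis by (simp add: coal_def)
qed

lemma coal_le_1: "coal \<mu> A x I \<le> 1"
  unfolding coal_def by (rule prob_space.emeasure_le_1[OF prob_space_jumps])

lemma coal_mono:
  assumes "finite I" "A \<subseteq> B" shows "coal \<mu> A x I \<le> coal \<mu> B x I"
  unfolding coal_def
  by (rule emeasure_jumps_mono[OF _ measurable_common_anc[OF assms(1)]]) (use assms(2) in \<open>auto simp: common_anc_def\<close>)

lemma coal_reindex:
  assumes "x ` I = y ` J"
  shows "coal \<mu> A x I = coal \<mu> A y J"
proof -
  have "common_anc A r x I \<longleftrightarrow> common_anc A r y J" for r
  proof -
    have "(\<forall>b\<in>I. v \<in> ancestors r (x b)) \<longleftrightarrow> (\<forall>b\<in>J. v \<in> ancestors r (y b))" for v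
    proof -
      have "(\<forall>b\<in>I. v \<in> ancestors r (x b)) \<longleftrightarrow> (\<forall>i\<in>x ` I. v \<in> ancestors r i)" by simp
      also have "\<dots> \<longleftrightarrow> (\<forall>b\<in>J. v \<in> ancestors r (y b))" by (simp only: assms) simp
      finally show ?thesis .
    qed
    then show ?thesis by (simp add: common_anc_def)
  qed
  then show ?thesis by (simp add: coal_def)
qed

lemma coal_unique:
  assumes "\<And>b. b \<in> I \<Longrightarrow> x b = i" "i \<in> A"
  shows "coal \<mu> A x I = 1"
proof -
  have "common_anc A r x I" for r using assms by (auto simp: common_anc_def intro!: bexI[of _ i])
  then show ?thesis using prob_space.emeasure_space_1[OF prob_space_jumps] by (simp add: coal_def)
qed

lemma coal_limit:
  assumes I: "finite I"
  shows "coal \<mu> UNIV x I = (SUP n::nat. coal \<mu> {- int n..} x I)"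
proof -
  have "(SUP n. emeasure (jumps \<mu>) {r. common_anc {- int n..} r x I})
      = emeasure (jumps \<mu>) (\<Union>n. {r. common_anc {- int n..} r x I})"
  proof (rule SUP_emeasure_incseq)
    show "range (\<lambda>n. {r. common_anc {- int n..} r x I}) \<subseteq> sets (jumps \<mu>)"
      using measurable_common_anc[OF I, where \<mu> = \<mu> and x = x] by (auto simp: pred_def)
    show "incseq (\<lambda>n. {r. common_anc {- int n..} r x I})"
      by (force simp: incseq_def common_anc_def)
  qed
  also have "(\<Union>n. {r. common_anc {- int n..} r x I}) = {r. common_anc UNIV r x I}"
  proof (intro equalityI subsetI)
    fix r assume "r \<in> {r. common_anc UNIV r x I}"
    then obtain v where v: "\<forall>b\<in>I. v \<in> ancestors r (x b)" by (auto simp: common_anc_def)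
    have "v \<in> {- int (nat (- v))..}" by simp
    then have "common_anc {- int (nat (- v))..} r x I" using v unfolding common_anc_def by blast
    then show "r \<in> (\<Union>n. {r. common_anc {- int n..} r x I})" by blast
  qed (auto simp: common_anc_def)
  finally show ?thesis by (simp add: coal_def)
qed

definition superharmonic :: "nat pmf \<Rightarrow> (int \<Rightarrow> ennreal) \<Rightarrow> bool" where
  "superharmonic \<mu> f \<longleftrightarrow> (\<forall>i. (\<integral>\<^sup>+m. f (i - int m) \<partial>measure_pmf \<mu>) \<le> f i)"

lemma superharmonic_add:
  "superharmonic \<mu> f \<Longrightarrow> superharmonic \<mu> g \<Longrightarrow> superharmonic \<mu> (\<lambda>i. f i + g i)"
  by (auto simp: superharmonic_def nn_integral_add intro!: add_mono)

lemma superharmonic_cmult: "superharmonic \<mu> f \<Longrightarrow> superharmonic \<mu> (\<lambda>i. c * f i)"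
  by (auto simp: superharmonic_def nn_integral_cmult intro!: mult_left_mono)

lemma superharmonic_multc: "superharmonic \<mu> f \<Longrightarrow> superharmonic \<mu> (\<lambda>i. f i * c)"
  by (auto simp: superharmonic_def nn_integral_multc intro!: mult_right_mono)

lemma superharmonic_nn_integral:
  "(\<And>w. superharmonic \<mu> (f w)) \<Longrightarrow> superharmonic \<mu> (\<lambda>i. \<integral>\<^sup>+w. f w i \<partial>cZ)"
  unfolding superharmonic_def
  by (subst nn_integral_pmf_swap) (auto intro!: nn_integral_mono)

lemmas superharmonic_intros = superharmonic_add superharmonic_cmult superharmonic_multc superharmonic_nn_integral

context heavy_tailed_jumps
begin

lemma superharmonic_hit: "superharmonic \<mu> (\<lambda>i. q (i - w))"
proof -
  have "(\<integral>\<^sup>+m. q (i - int m - w) \<partial>measure_pmf \<mu>) \<le> q (i - w)" for i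
    using hit_harmonic[OF pmf_0, of "i - w"] by (simp add: algebra_simps)
  then show ?thesis by (simp add: superharmonic_def)
qed

text \<open>
  The truncation of \<open>meet\<close> that corresponds to meetings at or above the level \<open>z0\<close>.
\<close>
definition meet_above :: "int \<Rightarrow> int \<Rightarrow> int \<Rightarrow> ennreal" where
  "meet_above z0 i j = (\<integral>\<^sup>+w. q (i - w) * q (j - w) * indicator {z0..} w \<partial>cZ)"

lemma meet_above_commute: "meet_above z0 i j = meet_above z0 j i"
  by (simp add: meet_above_def mult_ac)

text \<open>
  The renewal equation applies at every level \<open>w\<close> except \<open>w = i\<close>, which the lower line cannot reach.
\<close>
lemma meet_above_harmonic:
  assumes "j < i"
  shows "(\<integral>\<^sup>+m. meet_above z0 (i - int m) j \<partial>measure_pmf \<mu>) = meet_above z0 i j"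
proof -
  have "(\<integral>\<^sup>+m. meet_above z0 (i - int m) j \<partial>measure_pmf \<mu>)
      = (\<integral>\<^sup>+w. (\<integral>\<^sup>+m. q (i - w - int m) * (q (j - w) * indicator {z0..} w) \<partial>measure_pmf \<mu>) \<partial>cZ)"
    unfolding meet_above_def by (subst nn_integral_pmf_swap) (simp add: algebra_simps)
  also have "\<dots> = meet_above z0 i j"
    unfolding meet_above_def
    using assms by (intro nn_integral_cong) (auto simp: nn_integral_multc hit_harmonic[OF pmf_0] mult.assoc)
  finally show ?thesis .
qed

lemma meet_above_low: "i < z0 \<or> j < z0 \<Longrightarrow> meet_above z0 i j = 0"
proof -
  assume "i < z0 \<or> j < z0"
  then have "meet_above z0 i j = (\<integral>\<^sup>+w. 0 \<partial>cZ)"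
    unfolding meet_above_def by (intro nn_integral_cong) (auto simp: indicator_def)
  then show ?thesis by simp
qed

lemma meet_above_le_meet: "meet_above z0 i j \<le> meet i j"
  unfolding meet_above_def meet_def by (intro nn_integral_mono) (auto simp: indicator_def)

lemma meet_above_step:
  assumes c: "c \<in> {0, 1::nat}" and lt: "\<And>b. b \<in> {0, 1} \<Longrightarrow> b \<noteq> c \<Longrightarrow> x b < x c"
  shows "(\<integral>\<^sup>+m. meet_above z0 ((x(c := x c - int m)) 0) ((x(c := x c - int m)) 1) \<partial>measure_pmf \<mu>)
    = meet_above z0 (x 0) (x 1)"
proof (cases "c = 0")
  case True
  then show ?thesis using lt[of 1] meet_above_harmonic by simp
next
  case False
  then have "c = 1" using c by simp
  then have "x 0 < x 1" using lt[of 0] by simp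
  from meet_above_harmonic[OF this, of z0] show ?thesis
    by (simp add: \<open>c = 1\<close> meet_above_commute[of z0 "x 0" "x 1"] meet_above_commute[of z0 "x 0" "x 1 - int _"] del: One_nat_def)
qed

lemma coal_step2:
  assumes c: "c \<in> {0, 1::nat}" and lt: "\<And>b. b \<in> {0, 1} \<Longrightarrow> b \<noteq> c \<Longrightarrow> x b < x c"
  shows "coal \<mu> A x {0, 1} = (\<integral>\<^sup>+m. coal \<mu> A (x(c := x c - int m)) {0, 1} \<partial>measure_pmf \<mu>)"
proof (rule coal_step[OF pmf_0])
  show "1 - c \<in> {0, 1}" "1 - c \<noteq> c" using c by auto
qed (use lt in simp_all)

text \<open>
  After the first meeting, the expected number of further common points is at most \<open>Q\<close>.
\<close>
lemma meet_above_le_coal: "meet_above z0 (x 0) (x 1) \<le> Q * coal \<mu> {z0..} x {0, 1}"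
proof (rule coalescence_comparison[OF pmf_0, of "{0, 1}" "\<lambda>x. meet_above z0 (x 0) (x 1)"
      "\<lambda>x. Q * coal \<mu> {z0..} x {0, 1}" z0])
  fix x :: "nat \<Rightarrow> int" and c :: nat
  assume c: "c \<in> {0, 1}" and lt: "\<And>b. b \<in> {0, 1} \<Longrightarrow> b \<noteq> c \<Longrightarrow> x b < x c"
  show "meet_above z0 (x 0) (x 1)
      \<le> (\<integral>\<^sup>+m. meet_above z0 ((x(c := x c - int m)) 0) ((x(c := x c - int m)) 1) \<partial>measure_pmf \<mu>)"
    using meet_above_step[of c x z0] c lt by auto
  show "(\<integral>\<^sup>+m. Q * coal \<mu> {z0..} (x(c := x c - int m)) {0, 1} \<partial>measure_pmf \<mu>)
      \<le> Q * coal \<mu> {z0..} x {0, 1}"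
    using coal_step2[of c x "{z0..}"] c lt by (auto simp: nn_integral_cmult simp del: fun_upd_apply)
next
  fix x :: "nat \<Rightarrow> int" and b c :: nat
  assume "b \<in> {0, 1}" "c \<in> {0, 1}" "b \<noteq> c" "x b = x c"
  then have eq: "x 1 = x 0" by auto
  show "meet_above z0 (x 0) (x 1) \<le> Q * coal \<mu> {z0..} x {0, 1}"
  proof (cases "z0 \<le> x 0")
    case True
    then have "coal \<mu> {z0..} x {0, 1} = 1" using eq by (intro coal_unique) auto
    then show ?thesis using meet_above_le_meet[of z0 "x 0" "x 1"] meet_le_Q[of "x 0" "x 1"] by simp
  qed (simp add: meet_above_low)
qed (auto simp: meet_above_low)

text \<open>
  If the first meeting is at least \<open>K\<close> above \<open>z0\<close>, then all common points within distance \<open>K\<close> of it are counted.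
\<close>
lemma meet_above_ge_coal:
  "(\<integral>\<^sup>+k. (q k)\<^sup>2 * indicator {..int K} k \<partial>cZ) * coal \<mu> {z0 + int K..} x {0, 1} \<le> meet_above z0 (x 0) (x 1)"
proof (rule coalescence_comparison[OF pmf_0, of "{0, 1}"
      "\<lambda>x. (\<integral>\<^sup>+k. (q k)\<^sup>2 * indicator {..int K} k \<partial>cZ) * coal \<mu> {z0 + int K..} x {0, 1}"
      "\<lambda>x. meet_above z0 (x 0) (x 1)" "z0 + int K"])
  let ?QK = "\<integral>\<^sup>+k. (q k)\<^sup>2 * indicator {..int K} k \<partial>cZ"
  fix x :: "nat \<Rightarrow> int" and c :: nat
  assume c: "c \<in> {0, 1}" and lt: "\<And>b. b \<in> {0, 1} \<Longrightarrow> b \<noteq> c \<Longrightarrow> x b < x c"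
  show "(\<integral>\<^sup>+m. meet_above z0 ((x(c := x c - int m)) 0) ((x(c := x c - int m)) 1) \<partial>measure_pmf \<mu>)
      \<le> meet_above z0 (x 0) (x 1)"
    using meet_above_step[of c x z0] c lt by auto
  show "?QK * coal \<mu> {z0 + int K..} x {0, 1}
      \<le> (\<integral>\<^sup>+m. ?QK * coal \<mu> {z0 + int K..} (x(c := x c - int m)) {0, 1} \<partial>measure_pmf \<mu>)"
    using coal_step2[of c x "{z0 + int K..}"] c lt by (auto simp: nn_integral_cmult simp del: fun_upd_apply)
next
  let ?QK = "\<integral>\<^sup>+k. (q k)\<^sup>2 * indicator {..int K} k \<partial>cZ"
  fix x :: "nat \<Rightarrow> int" and b c :: nat
  assume "b \<in> {0, 1}" "c \<in> {0, 1}" "b \<noteq> c" "x b = x c"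
  then have eq: "x 1 = x 0" by auto
  show "?QK * coal \<mu> {z0 + int K..} x {0, 1} \<le> meet_above z0 (x 0) (x 1)"
  proof (cases "z0 + int K \<le> x 0")
    case True
    have "?QK * coal \<mu> {z0 + int K..} x {0, 1} \<le> ?QK * 1" by (intro mult_left_mono coal_le_1) auto
    also have "?QK * 1 = (\<integral>\<^sup>+w. (q (x 0 - w))\<^sup>2 * indicator {..int K} (x 0 - w) \<partial>cZ)"
      by (simp add: nn_integral_int_reflect[of "\<lambda>k. (q k)\<^sup>2 * indicator {..int K} k" "x 0"])
    also have "\<dots> \<le> meet_above z0 (x 0) (x 1)"
      unfolding meet_above_def eq using True
      by (intro nn_integral_mono) (auto simp: indicator_def power2_eq_square)
    finally show ?thesis .
  next
    case False
    then show ?thesis by (subst coal_low[of 0]) auto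
  qed
next
  let ?QK = "\<integral>\<^sup>+k. (q k)\<^sup>2 * indicator {..int K} k \<partial>cZ"
  fix x :: "nat \<Rightarrow> int" and b :: nat
  assume "b \<in> {0, 1}" "x b < z0 + int K"
  then show "?QK * coal \<mu> {z0 + int K..} x {0, 1} \<le> meet_above z0 (x 0) (x 1)"
    by (subst coal_low[of b]) auto
qed auto

text \<open>
  Two independent lines that meet have on average \<open>Q\<close> common points, counted from the first one; and up to their
  first meeting two lines of the graph behave like independent ones.
\<close>
lemma meet_eq_coal: "meet (x 0) (x 1) = Q * coal \<mu> UNIV x {0, 1}"
proof (rule antisym)
  have "meet (x 0) (x 1) = (\<integral>\<^sup>+w. (SUP n::nat. q (x 0 - w) * q (x 1 - w) * indicator {- int n..} w) \<partial>cZ)"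
    unfolding meet_def
  proof (intro nn_integral_cong antisym)
    fix w
    have "q (x 0 - w) * q (x 1 - w) = q (x 0 - w) * q (x 1 - w) * indicator {- int (nat (- w))..} w"
      by simp
    also have "\<dots> \<le> (SUP n::nat. q (x 0 - w) * q (x 1 - w) * indicator {- int n..} w)"
      by (rule SUP_upper) simp
    finally show "q (x 0 - w) * q (x 1 - w) \<le> \<dots>" .
    show "(SUP n::nat. q (x 0 - w) * q (x 1 - w) * indicator {- int n..} w) \<le> q (x 0 - w) * q (x 1 - w)"
      by (rule SUP_least) (auto simp: indicator_def)
  qed
  also have "\<dots> = (SUP n::nat. meet_above (- int n) (x 0) (x 1))"
    unfolding meet_above_def
    by (rule nn_integral_monotone_convergence_SUP) (auto simp: incseq_def le_fun_def indicator_def)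
  also have "\<dots> \<le> Q * coal \<mu> UNIV x {0, 1}"
  proof (rule SUP_least)
    fix n :: nat
    have "meet_above (- int n) (x 0) (x 1) \<le> Q * coal \<mu> {- int n..} x {0, 1}" by (rule meet_above_le_coal)
    also have "\<dots> \<le> Q * coal \<mu> UNIV x {0, 1}" by (intro mult_left_mono coal_mono) auto
    finally show "meet_above (- int n) (x 0) (x 1) \<le> Q * coal \<mu> UNIV x {0, 1}" .
  qed
  finally show "meet (x 0) (x 1) \<le> Q * coal \<mu> UNIV x {0, 1}" .
next
  have K: "(\<integral>\<^sup>+k. (q k)\<^sup>2 * indicator {..int K} k \<partial>cZ) * coal \<mu> UNIV x {0, 1} \<le> meet (x 0) (x 1)" for K
  proof -
    have "(\<integral>\<^sup>+k. (q k)\<^sup>2 * indicator {..int K} k \<partial>cZ) * coal \<mu> {- int n..} x {0, 1} \<le> meet (x 0) (x 1)" for n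
    proof -
      have "(\<integral>\<^sup>+k. (q k)\<^sup>2 * indicator {..int K} k \<partial>cZ) * coal \<mu> {(- int n - int K) + int K..} x {0, 1}
          \<le> meet_above (- int n - int K) (x 0) (x 1)" by (rule meet_above_ge_coal)
      also have "\<dots> \<le> meet (x 0) (x 1)" by (rule meet_above_le_meet)
      finally show ?thesis by simp
    qed
    then show ?thesis
      by (subst coal_limit) (auto simp: SUP_mult_left_ennreal intro!: SUP_least)
  qed
  have "Q = (\<integral>\<^sup>+k. (SUP K::nat. (q k)\<^sup>2 * indicator {..int K} k) \<partial>cZ)"
    unfolding Q_def
  proof (intro nn_integral_cong antisym)
    fix k
    have "(q k)\<^sup>2 = (q k)\<^sup>2 * indicator {..int (nat k)} k" by simp
    also have "\<dots> \<le> (SUP K::nat. (q k)\<^sup>2 * indicator {..int K} k)" by (rule SUP_upper) simp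
    finally show "(q k)\<^sup>2 \<le> \<dots>" .
    show "(SUP K::nat. (q k)\<^sup>2 * indicator {..int K} k) \<le> (q k)\<^sup>2"
      by (rule SUP_least) (auto simp: indicator_def)
  qed
  also have "\<dots> = (SUP K::nat. \<integral>\<^sup>+k. (q k)\<^sup>2 * indicator {..int K} k \<partial>cZ)"
    by (rule nn_integral_monotone_convergence_SUP) (auto simp: incseq_def le_fun_def indicator_def)
  finally have Q: "Q = (SUP K::nat. \<integral>\<^sup>+k. (q k)\<^sup>2 * indicator {..int K} k \<partial>cZ)" .
  show "Q * coal \<mu> UNIV x {0, 1} \<le> meet (x 0) (x 1)"
    by (subst Q) (auto simp: SUP_mult_right_ennreal intro!: SUP_least K simp del: One_nat_def)
qed

end

section \<open>Coalescence of three and four ancestral lines\<close>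

lemma sum_int_interval: "(\<Sum>i=1..n. f (int i)) = (\<Sum>i\<in>{1..int n}. f i)"
  by (rule sum.reindex_bij_witness[of _ nat int]) auto

context heavy_tailed_jumps
begin

lemma superharmonic_meet2: "superharmonic \<mu> (\<lambda>j. meet i j)"
  unfolding meet_def by (intro superharmonic_intros superharmonic_hit)

text \<open>
  The lines of \<open>i\<close> and \<open>j\<close> meet first, at \<open>y\<close>, and the joint line then meets the line of \<open>k\<close>.
\<close>
definition join3 :: "int \<Rightarrow> int \<Rightarrow> int \<Rightarrow> ennreal" where
  "join3 i j k = (\<integral>\<^sup>+y. q (i - y) * q (j - y) * meet y k \<partial>cZ)"

definition tree3 :: "int \<Rightarrow> int \<Rightarrow> int \<Rightarrow> ennreal" where
  "tree3 i j k = join3 i j k + join3 i k j + join3 j k i"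

definition join4 :: "int \<Rightarrow> int \<Rightarrow> int \<Rightarrow> int \<Rightarrow> ennreal" where
  "join4 i j k l = (\<integral>\<^sup>+y. q (i - y) * q (j - y) * tree3 y k l \<partial>cZ)"

definition tree4 :: "int \<Rightarrow> int \<Rightarrow> int \<Rightarrow> int \<Rightarrow> ennreal" where
  "tree4 i j k l = join4 i j k l + join4 i k j l + join4 i l j k + join4 j k i l + join4 j l i k + join4 k l i j"

lemma superharmonic_join3:
  "superharmonic \<mu> (\<lambda>i. join3 i j k)" "superharmonic \<mu> (\<lambda>j. join3 i j k)" "superharmonic \<mu> (\<lambda>k. join3 i j k)"
  unfolding join3_def by (intro superharmonic_intros superharmonic_hit superharmonic_meet2)+

lemma superharmonic_tree3:
  "superharmonic \<mu> (\<lambda>i. tree3 i j k)" "superharmonic \<mu> (\<lambda>j. tree3 i j k)" "superharmonic \<mu> (\<lambda>k. tree3 i j k)"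
  unfolding tree3_def by (intro superharmonic_add superharmonic_join3)+

lemma superharmonic_join4:
  "superharmonic \<mu> (\<lambda>i. join4 i j k l)" "superharmonic \<mu> (\<lambda>j. join4 i j k l)"
  "superharmonic \<mu> (\<lambda>k. join4 i j k l)" "superharmonic \<mu> (\<lambda>l. join4 i j k l)"
  unfolding join4_def by (intro superharmonic_intros superharmonic_hit superharmonic_tree3)+

lemma superharmonic_tree4:
  "superharmonic \<mu> (\<lambda>i. tree4 i j k l)" "superharmonic \<mu> (\<lambda>j. tree4 i j k l)"
  "superharmonic \<mu> (\<lambda>k. tree4 i j k l)" "superharmonic \<mu> (\<lambda>l. tree4 i j k l)"
  unfolding tree4_def by (intro superharmonic_add superharmonic_join4)+

text \<open>
  The term with meeting point \<open>i\<close>.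
\<close>
lemma join3_tie: "meet i k \<le> join3 i i k"
  using nn_integral_ge_point[of i UNIV "\<lambda>y. q (i - y) * q (i - y) * meet y k"] by (simp add: join3_def)

lemma join4_tie: "tree3 i k l \<le> join4 i i k l"
  using nn_integral_ge_point[of i UNIV "\<lambda>y. q (i - y) * q (i - y) * tree3 y k l"] by (simp add: join4_def)

lemma coal_le_meet:
  assumes "finite I" "x ` I = {i, j}"
  shows "coal \<mu> A x I \<le> meet i j"
proof -
  define y where "y = (\<lambda>n::nat. if n = 0 then i else j)"
  have "coal \<mu> A x I \<le> coal \<mu> UNIV x I" by (rule coal_mono) (use assms in auto)
  also have "\<dots> = coal \<mu> UNIV y {0, 1}" by (rule coal_reindex) (use assms in \<open>auto simp: y_def\<close>)
  also have "1 * \<dots> \<le> Q * coal \<mu> UNIV y {0, 1}" by (intro mult_right_mono Q_ge_1) auto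
  also have "\<dots> = meet i j" using meet_eq_coal[of y] by (simp add: y_def)
  finally show ?thesis by simp
qed

text \<open>
  Tree sums are superharmonic in every leaf, because the edge weights \<open>q\<close> are. At a tie, the summand in which
  the tied leaves are joined first already dominates the probability for the remaining leaves.
\<close>
lemma coal_le_tree3:
  assumes "finite I" "x ` I = {i, j, k}"
  shows "coal \<mu> A x I \<le> tree3 i j k"
proof -
  have main: "coal \<mu> {z0..} x {0, 1, 2} \<le> tree3 (x 0) (x 1) (x 2)" for z0 x
  proof (rule coalescence_comparison[OF pmf_0, of "{0, 1, 2}" "\<lambda>x. coal \<mu> {z0..} x {0, 1, 2}"
        "\<lambda>x. tree3 (x 0) (x 1) (x 2)" z0])
    fix x :: "nat \<Rightarrow> int" and c :: nat
    assume c: "c \<in> {0, 1, 2}" and lt: "\<And>b. b \<in> {0, 1, 2} \<Longrightarrow> b \<noteq> c \<Longrightarrow> x b < x c"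
    have "coal \<mu> {z0..} x {0, 1, 2} = (\<integral>\<^sup>+m. coal \<mu> {z0..} (x(c := x c - int m)) {0, 1, 2} \<partial>measure_pmf \<mu>)"
    proof (rule coal_step[OF pmf_0])
      show "(if c = 0 then 1 else 0) \<in> {0, 1, 2::nat}" "(if c = 0 then 1 else 0) \<noteq> c" by auto
    qed (use lt in simp_all)
    then show "coal \<mu> {z0..} x {0, 1, 2} \<le> (\<integral>\<^sup>+m. coal \<mu> {z0..} (x(c := x c - int m)) {0, 1, 2} \<partial>measure_pmf \<mu>)"
      by simp
    show "(\<integral>\<^sup>+m. tree3 ((x(c := x c - int m)) 0) ((x(c := x c - int m)) 1) ((x(c := x c - int m)) 2) \<partial>measure_pmf \<mu>)
        \<le> tree3 (x 0) (x 1) (x 2)"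
      using c superharmonic_tree3[unfolded superharmonic_def] by auto
  next
    fix x :: "nat \<Rightarrow> int" and b c :: nat
    assume *: "b \<in> {0, 1, 2}" "c \<in> {0, 1, 2}" "b \<noteq> c" "x b = x c"
    consider "x 0 = x 1" | "x 0 = x 2" | "x 1 = x 2" using * by auto
    then show "coal \<mu> {z0..} x {0, 1, 2} \<le> tree3 (x 0) (x 1) (x 2)"
    proof cases
      case 1
      have "coal \<mu> {z0..} x {0, 1, 2} \<le> meet (x 0) (x 2)" using 1 by (intro coal_le_meet) auto
      also have "\<dots> \<le> join3 (x 0) (x 1) (x 2)" using join3_tie 1 by simp
      finally show ?thesis by (simp add: tree3_def add_increasing2)
    next
      case 2
      have "coal \<mu> {z0..} x {0, 1, 2} \<le> meet (x 0) (x 1)" using 2 by (intro coal_le_meet) auto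
      also have "\<dots> \<le> join3 (x 0) (x 2) (x 1)" using join3_tie 2 by simp
      finally show ?thesis by (simp add: tree3_def add_increasing2 add_increasing)
    next
      case 3
      have "coal \<mu> {z0..} x {0, 1, 2} \<le> meet (x 1) (x 0)" using 3 by (intro coal_le_meet) auto
      also have "\<dots> \<le> join3 (x 1) (x 2) (x 0)" using join3_tie 3 by simp
      finally show ?thesis by (simp add: tree3_def add_increasing)
    qed
  next
    fix x :: "nat \<Rightarrow> int" and b :: nat
    assume "b \<in> {0, 1, 2}" "x b < z0"
    then show "coal \<mu> {z0..} x {0, 1, 2} \<le> tree3 (x 0) (x 1) (x 2)" by (subst coal_low[of b]) auto
  qed auto
  define y where "y = (\<lambda>n::nat. if n = 0 then i else if n = 1 then j else k)"
  have "coal \<mu> A x I \<le> coal \<mu> UNIV x I" by (rule coal_mono) (use assms in auto)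
  also have "\<dots> = coal \<mu> UNIV y {0, 1, 2}" by (rule coal_reindex) (use assms in \<open>auto simp: y_def\<close>)
  also have "\<dots> \<le> tree3 (y 0) (y 1) (y 2)"
    by (subst coal_limit) (auto intro!: SUP_least main simp del: One_nat_def)
  finally show ?thesis by (simp add: y_def)
qed

lemma coal_le_tree4:
  assumes "finite I" "x ` I = {i, j, k, l}"
  shows "coal \<mu> A x I \<le> tree4 i j k l"
proof -
  let ?I = "{0, 1, 2, 3::nat}"
  have main: "coal \<mu> {z0..} x ?I \<le> tree4 (x 0) (x 1) (x 2) (x 3)" for z0 x
  proof (rule coalescence_comparison[OF pmf_0, of ?I "\<lambda>x. coal \<mu> {z0..} x ?I"
        "\<lambda>x. tree4 (x 0) (x 1) (x 2) (x 3)" z0])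
    fix x :: "nat \<Rightarrow> int" and c :: nat
    assume c: "c \<in> ?I" and lt: "\<And>b. b \<in> ?I \<Longrightarrow> b \<noteq> c \<Longrightarrow> x b < x c"
    have "coal \<mu> {z0..} x ?I = (\<integral>\<^sup>+m. coal \<mu> {z0..} (x(c := x c - int m)) ?I \<partial>measure_pmf \<mu>)"
    proof (rule coal_step[OF pmf_0])
      show "(if c = 0 then 1 else 0) \<in> ?I" "(if c = 0 then 1 else 0) \<noteq> c" by auto
    qed (use lt in simp_all)
    then show "coal \<mu> {z0..} x ?I \<le> (\<integral>\<^sup>+m. coal \<mu> {z0..} (x(c := x c - int m)) ?I \<partial>measure_pmf \<mu>)"
      by simp
    show "(\<integral>\<^sup>+m. tree4 ((x(c := x c - int m)) 0) ((x(c := x c - int m)) 1) ((x(c := x c - int m)) 2)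
          ((x(c := x c - int m)) 3) \<partial>measure_pmf \<mu>)
        \<le> tree4 (x 0) (x 1) (x 2) (x 3)"
      using c superharmonic_tree4[unfolded superharmonic_def] by auto
  next
    fix x :: "nat \<Rightarrow> int" and b c :: nat
    assume *: "b \<in> ?I" "c \<in> ?I" "b \<noteq> c" "x b = x c"
    have tie: "coal \<mu> {z0..} x ?I \<le> join4 s s' t u" if "x ` ?I = {s, t, u}" "s' = s" for s s' t u
    proof -
      have "coal \<mu> {z0..} x ?I \<le> tree3 s t u" using that(1) by (intro coal_le_tree3) auto
      also have "\<dots> \<le> join4 s s' t u" using join4_tie that by simp
      finally show ?thesis .
    qed
    consider "x 0 = x 1" | "x 0 = x 2" | "x 0 = x 3" | "x 1 = x 2" | "x 1 = x 3" | "x 2 = x 3" using * by auto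
    then show "coal \<mu> {z0..} x ?I \<le> tree4 (x 0) (x 1) (x 2) (x 3)"
    proof cases
      case 1
      have "coal \<mu> {z0..} x ?I \<le> join4 (x 0) (x 1) (x 2) (x 3)" using 1 by (intro tie) auto
      then show ?thesis by (simp add: tree4_def add_increasing2)
    next
      case 2
      have "coal \<mu> {z0..} x ?I \<le> join4 (x 0) (x 2) (x 1) (x 3)" using 2 by (intro tie) auto
      then show ?thesis by (simp add: tree4_def add_increasing2 add_increasing)
    next
      case 3
      have "coal \<mu> {z0..} x ?I \<le> join4 (x 0) (x 3) (x 1) (x 2)" using 3 by (intro tie) auto
      then show ?thesis by (simp add: tree4_def add_increasing2 add_increasing)
    next
      case 4
      have "coal \<mu> {z0..} x ?I \<le> join4 (x 1) (x 2) (x 0) (x 3)" using 4 by (intro tie) auto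
      then show ?thesis by (simp add: tree4_def add_increasing2 add_increasing)
    next
      case 5
      have "coal \<mu> {z0..} x ?I \<le> join4 (x 1) (x 3) (x 0) (x 2)" using 5 by (intro tie) auto
      then show ?thesis by (simp add: tree4_def add_increasing2 add_increasing)
    next
      case 6
      have "coal \<mu> {z0..} x ?I \<le> join4 (x 2) (x 3) (x 0) (x 1)" using 6 by (intro tie) auto
      then show ?thesis by (simp add: tree4_def add_increasing2 add_increasing)
    qed
  next
    fix x :: "nat \<Rightarrow> int" and b :: nat
    assume "b \<in> ?I" "x b < z0"
    then show "coal \<mu> {z0..} x ?I \<le> tree4 (x 0) (x 1) (x 2) (x 3)" by (subst coal_low[of b]) auto
  qed auto
  define y where "y = (\<lambda>n::nat. if n = 0 then i else if n = 1 then j else if n = 2 then k else l)"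
  have "coal \<mu> A x I \<le> coal \<mu> UNIV x I" by (rule coal_mono) (use assms in auto)
  also have "\<dots> = coal \<mu> UNIV y ?I" by (rule coal_reindex) (use assms in \<open>auto simp: y_def\<close>)
  also have "\<dots> \<le> tree4 (y 0) (y 1) (y 2) (y 3)"
    by (subst coal_limit) (auto intro!: SUP_least main simp del: One_nat_def)
  finally show ?thesis by (simp add: y_def)
qed

definition fourfold :: "nat \<Rightarrow> ennreal" where
  "fourfold n = (\<Sum>i\<in>{1..int n}. \<Sum>j\<in>{1..int n}. \<Sum>k\<in>{1..int n}. \<Sum>l\<in>{1..int n}. tree4 i j k l)"

lemma window_int: "window n z = (\<Sum>i\<in>{1..int n}. q (i - z))"
  unfolding window_def by (rule sum_int_interval)

text \<open>
  Summed over the window, the leaves of each tree turn into factors \<open>window\<close>. Of the three trees on the joint point and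
  the two remaining leaves, two are caterpillars and one is balanced.
\<close>
lemma sum_join4:
  "(\<Sum>i\<in>{1..int n}. \<Sum>j\<in>{1..int n}. \<Sum>k\<in>{1..int n}. \<Sum>l\<in>{1..int n}. join4 i j k l)
    = 2 * caterpillar_sum n + balanced_sum n"
proof -
  let ?S = "{1..int n}"
  have j3a: "(\<Sum>k\<in>?S. \<Sum>l\<in>?S. join3 y k l) = (\<integral>\<^sup>+x. q (y - x) * window n x * (\<integral>\<^sup>+w. q (x - w) * window n w \<partial>cZ) \<partial>cZ)" for y
    unfolding join3_def meet_def window_int
    by (simp add: sum_distrib_left sum_distrib_right mult.assoc flip: nn_integral_sum nn_integral_cmult)
  have j3c: "(\<Sum>k\<in>?S. \<Sum>l\<in>?S. join3 k l y) = (\<integral>\<^sup>+w. pair_flow n w * q (y - w) \<partial>cZ)" for y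
  proof -
    have "(\<Sum>k\<in>?S. \<Sum>l\<in>?S. join3 k l y) = (\<integral>\<^sup>+x. (window n x)\<^sup>2 * meet x y \<partial>cZ)"
      unfolding join3_def window_int power2_eq_square sum_product
      by (simp add: sum_distrib_right flip: nn_integral_sum)
    also have "\<dots> = (\<integral>\<^sup>+x. (\<integral>\<^sup>+w. (window n x)\<^sup>2 * q (x - w) * q (y - w) \<partial>cZ) \<partial>cZ)"
      unfolding meet_def by (simp add: mult.assoc nn_integral_cmult)
    also have "\<dots> = (\<integral>\<^sup>+w. (\<integral>\<^sup>+x. (window n x)\<^sup>2 * q (x - w) * q (y - w) \<partial>cZ) \<partial>cZ)"
      by (rule nn_integral_int_swap)
    also have "\<dots> = (\<integral>\<^sup>+w. pair_flow n w * q (y - w) \<partial>cZ)"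
      by (simp add: nn_integral_multc pair_flow_def)
    finally show ?thesis .
  qed
  define T where "T x = (\<integral>\<^sup>+w. q (x - w) * window n w \<partial>cZ)" for x
  have t3: "(\<Sum>k\<in>?S. \<Sum>l\<in>?S. tree3 y k l)
      = 2 * (\<integral>\<^sup>+x. q (y - x) * window n x * T x \<partial>cZ) + (\<integral>\<^sup>+w. pair_flow n w * q (y - w) \<partial>cZ)" for y
  proof -
    have "(\<Sum>k\<in>?S. \<Sum>l\<in>?S. join3 y l k) = (\<Sum>k\<in>?S. \<Sum>l\<in>?S. join3 y k l)" by (rule sum.swap)
    then show ?thesis unfolding tree3_def sum.distrib j3a j3c by (simp add: T_def mult_2)
  qed
  have "(\<Sum>i\<in>?S. \<Sum>j\<in>?S. \<Sum>k\<in>?S. \<Sum>l\<in>?S. join4 i j k l)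
      = (\<integral>\<^sup>+y. (\<Sum>i\<in>?S. \<Sum>j\<in>?S. \<Sum>k\<in>?S. \<Sum>l\<in>?S. q (i - y) * q (j - y) * tree3 y k l) \<partial>cZ)"
    unfolding join4_def by (simp flip: nn_integral_sum)
  also have "\<dots> = (\<integral>\<^sup>+y. (window n y)\<^sup>2 * (\<Sum>k\<in>?S. \<Sum>l\<in>?S. tree3 y k l) \<partial>cZ)"
    unfolding window_int power2_eq_square
    by (simp add: mult.assoc flip: sum_distrib_left sum_distrib_right)
  also have "\<dots> = 2 * (\<integral>\<^sup>+y. (\<integral>\<^sup>+x. (window n y)\<^sup>2 * q (y - x) * (window n x * T x) \<partial>cZ) \<partial>cZ)
      + (\<integral>\<^sup>+y. (\<integral>\<^sup>+w. pair_flow n w * ((window n y)\<^sup>2 * q (y - w)) \<partial>cZ) \<partial>cZ)"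
    unfolding t3
    by (simp add: distrib_left nn_integral_add nn_integral_cmult mult_ac flip: nn_integral_cmult)
  also have "(\<integral>\<^sup>+y. (\<integral>\<^sup>+x. (window n y)\<^sup>2 * q (y - x) * (window n x * T x) \<partial>cZ) \<partial>cZ)
      = (\<integral>\<^sup>+x. (\<integral>\<^sup>+y. (window n y)\<^sup>2 * q (y - x) * (window n x * T x) \<partial>cZ) \<partial>cZ)"
    by (rule nn_integral_int_swap)
  also have "\<dots> = caterpillar_sum n"
  proof -
    have "(\<integral>\<^sup>+y. (window n y)\<^sup>2 * q (y - x) * c \<partial>cZ) = pair_flow n x * c" for x c
      by (simp add: pair_flow_def nn_integral_multc)
    then show ?thesis by (simp add: caterpillar_sum_def T_def mult.assoc)
  qed
  also have "(\<integral>\<^sup>+y. (\<integral>\<^sup>+w. pair_flow n w * ((window n y)\<^sup>2 * q (y - w)) \<partial>cZ) \<partial>cZ)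
      = (\<integral>\<^sup>+w. (\<integral>\<^sup>+y. pair_flow n w * ((window n y)\<^sup>2 * q (y - w)) \<partial>cZ) \<partial>cZ)"
    by (rule nn_integral_int_swap)
  also have "\<dots> = balanced_sum n"
    by (simp add: nn_integral_cmult balanced_sum_def pair_flow_def power2_eq_square)
  finally show ?thesis .
qed

lemma fourfold_eq: "fourfold n = 6 * (2 * caterpillar_sum n + balanced_sum n)"
proof -
  let ?S = "{1..int n}"
  let ?J = "2 * caterpillar_sum n + balanced_sum n"
  have prod: "(\<Sum>i\<in>?S. \<Sum>j\<in>?S. \<Sum>k\<in>?S. \<Sum>l\<in>?S. g i j k l)
      = (\<Sum>(i, j, k, l)\<in>?S \<times> ?S \<times> ?S \<times> ?S. g i j k l)" for g :: "int \<Rightarrow> int \<Rightarrow> int \<Rightarrow> int \<Rightarrow> ennreal"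
    by (simp add: sum.cartesian_product)
  have J: "(\<Sum>(i, j, k, l)\<in>?S \<times> ?S \<times> ?S \<times> ?S. join4 i j k l) = ?J"
    using sum_join4[of n] by (simp only: prod)
  have "(\<Sum>i\<in>?S. \<Sum>j\<in>?S. \<Sum>k\<in>?S. \<Sum>l\<in>?S. join4 i k j l) = ?J"
    unfolding prod J[symmetric]
    by (rule sum.reindex_bij_witness[of _ "\<lambda>(i, k, j, l). (i, j, k, l)" "\<lambda>(i, j, k, l). (i, k, j, l)"]) auto
  moreover have "(\<Sum>i\<in>?S. \<Sum>j\<in>?S. \<Sum>k\<in>?S. \<Sum>l\<in>?S. join4 i l j k) = ?J"
    unfolding prod J[symmetric]
    by (rule sum.reindex_bij_witness[of _ "\<lambda>(i, l, j, k). (i, j, k, l)" "\<lambda>(i, j, k, l). (i, l, j, k)"]) auto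
  moreover have "(\<Sum>i\<in>?S. \<Sum>j\<in>?S. \<Sum>k\<in>?S. \<Sum>l\<in>?S. join4 j k i l) = ?J"
    unfolding prod J[symmetric]
    by (rule sum.reindex_bij_witness[of _ "\<lambda>(j, k, i, l). (i, j, k, l)" "\<lambda>(i, j, k, l). (j, k, i, l)"]) auto
  moreover have "(\<Sum>i\<in>?S. \<Sum>j\<in>?S. \<Sum>k\<in>?S. \<Sum>l\<in>?S. join4 j l i k) = ?J"
    unfolding prod J[symmetric]
    by (rule sum.reindex_bij_witness[of _ "\<lambda>(j, l, i, k). (i, j, k, l)" "\<lambda>(i, j, k, l). (j, l, i, k)"]) auto
  moreover have "(\<Sum>i\<in>?S. \<Sum>j\<in>?S. \<Sum>k\<in>?S. \<Sum>l\<in>?S. join4 k l i j) = ?J"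
    unfolding prod J[symmetric]
    by (rule sum.reindex_bij_witness[of _ "\<lambda>(k, l, i, j). (i, j, k, l)" "\<lambda>(i, j, k, l). (k, l, i, j)"]) auto
  ultimately have "fourfold n = ?J + ?J + ?J + ?J + ?J + ?J"
    unfolding fourfold_def tree4_def sum.distrib sum_join4 by simp
  also have "\<dots> = 6 * ?J"
  proof -
    have "z + z + z + z + z + z = 6 * z" for z :: ennreal
      using distrib_right[of 1 1 z] distrib_right[of 2 1 z] distrib_right[of 3 1 z] distrib_right[of 4 1 z] distrib_right[of 5 1 z]
      by simp
    then show ?thesis .
  qed
  finally show ?thesis .
qed

lemma fourfold_negligible:
  assumes e: "0 < e"
  shows "\<forall>\<^sub>F n in sequentially. fourfold n \<le> ennreal (e * (scale n)\<^sup>2)"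
proof (rule eventually_mono[OF tree_sums_negligible[of "e / 18"]])
  fix n assume n: "balanced_sum n \<le> ennreal (e / 18 * (scale n)\<^sup>2) \<and> caterpillar_sum n \<le> ennreal (e / 18 * (scale n)\<^sup>2)"
  have "fourfold n \<le> 6 * (2 * ennreal (e / 18 * (scale n)\<^sup>2) + ennreal (e / 18 * (scale n)\<^sup>2))"
    unfolding fourfold_eq using n by (intro mult_left_mono add_mono) auto
  also have "\<dots> = ennreal (6 * (2 * (e / 18 * (scale n)\<^sup>2) + e / 18 * (scale n)\<^sup>2))"
  proof -
    have "6 * (2 * ennreal z + ennreal z) = ennreal (6 * (2 * z + z))" if "0 \<le> z" for z
    proof -
      have "ennreal (6 * (2 * z + z)) = ennreal 6 * ennreal (2 * z + z)"
        using that by (intro ennreal_mult) auto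
      also have "ennreal (2 * z + z) = ennreal (2 * z) + ennreal z" using that by (intro ennreal_plus) auto
      also have "ennreal (2 * z) = ennreal 2 * ennreal z" using that by (intro ennreal_mult) auto
      finally show ?thesis by simp
    qed
    then show ?thesis using e by simp
  qed
  also have "6 * (2 * (e / 18 * (scale n)\<^sup>2) + e / 18 * (scale n)\<^sup>2) = e * (scale n)\<^sup>2" by simp
  finally show "fourfold n \<le> ennreal (e * (scale n)\<^sup>2)" .
qed (use e in simp)

end

section \<open>Components of the graph and the covariance bound\<close>

lemma graph_edges_iff: "(i, j) \<in> graph_edges r \<longleftrightarrow> j = i - int (r i)"
  by (auto simp: graph_edges_def)

definition linked :: "(int \<Rightarrow> nat) \<Rightarrow> int \<Rightarrow> int \<Rightarrow> bool" where
  "linked r i j \<longleftrightarrow> ancestors r i \<inter> ancestors r j \<noteq> {}"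

lemma ancestor_reachable: "(i, path r i k) \<in> (graph_edges r)\<^sup>*"
proof (induction k)
  case (Suc k)
  then show ?case by (rule rtrancl_into_rtrancl) (simp add: graph_edges_iff)
qed simp

lemma linked_parent: "linked r (i - int (r i)) j \<longleftrightarrow> linked r i j"
proof
  assume "linked r (i - int (r i)) j"
  then show "linked r i j" using ancestors_unfold[of r i] by (auto simp: linked_def)
next
  assume "linked r i j"
  then obtain v where v: "v \<in> ancestors r i" "v \<in> ancestors r j" by (auto simp: linked_def)
  show "linked r (i - int (r i)) j"
  proof (cases "v = i")
    case True
    then have "i - int (r i) \<in> ancestors r j"
      using v(2) ancestors_unfold[of r i] ancestors_trans[of i r j] by auto
    then show ?thesis using self_ancestor[of "i - int (r i)" r] unfolding linked_def by blast
  next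
    case False
    then show ?thesis using v ancestors_unfold[of r i] by (auto simp: linked_def)
  qed
qed

lemma linked_sym: "linked r i j \<Longrightarrow> linked r j i"
  by (auto simp: linked_def)

lemma linked_refl [simp]: "linked r i i"
  unfolding linked_def using self_ancestor[of i r] by blast

text \<open>
  Every vertex has out-degree one, so a connected component has at most one line going down: ancestral lines of
  connected vertices merge.
\<close>
lemma same_component_iff_linked: "same_component r i j \<longleftrightarrow> linked r i j"
proof
  assume "same_component r i j"
  then have "(i, j) \<in> (graph_edges r \<union> (graph_edges r)\<inverse>)\<^sup>*" by (simp add: same_component_def)
  then show "linked r i j"
  proof (induction rule: converse_rtrancl_induct)
    case (step i k)
    then have "k = i - int (r i) \<or> i = k - int (r k)" by (auto simp: graph_edges_iff)
    then show ?case using step.IH linked_parent[of r i j] linked_parent[of r k j] by auto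
  qed simp
next
  assume "linked r i j"
  then obtain k l where kl: "path r i k = path r j l" by (auto simp: linked_def ancestors_def)
  let ?E = "graph_edges r \<union> (graph_edges r)\<inverse>"
  have up: "(graph_edges r)\<^sup>* \<subseteq> ?E\<^sup>*" by (rule rtrancl_mono) auto
  have "(i, path r i k) \<in> ?E\<^sup>*" "(j, path r i k) \<in> ?E\<^sup>*"
    using ancestor_reachable[of i r k] ancestor_reachable[of j r l] up by (auto simp: kl)
  moreover have "sym (?E\<^sup>*)" by (intro sym_rtrancl) (auto simp: sym_def)
  ultimately show "same_component r i j"
    unfolding same_component_def by (meson rtrancl_trans symD)
qed

lemma linked_trans: "linked r i j \<Longrightarrow> linked r j k \<Longrightarrow> linked r i k"
  unfolding same_component_iff_linked[symmetric] same_component_def by (rule rtrancl_trans)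

lemma linked_common_anc: "linked r (x b) (x c) \<longleftrightarrow> common_anc UNIV r x {b, c}"
  by (auto simp: linked_def common_anc_def)

lemma linked_four:
  assumes "linked r (x 0) (x 1)" "linked r (x 0) (x 2)" "linked r (x 0) (x 3)"
  shows "common_anc UNIV r x {0, 1, 2, 3}"
proof -
  obtain u v w where
    u: "u \<in> ancestors r (x 0)" "u \<in> ancestors r (x 1)" and
    v: "v \<in> ancestors r (x 0)" "v \<in> ancestors r (x 2)" and
    w: "w \<in> ancestors r (x 0)" "w \<in> ancestors r (x 3)"
    using assms by (auto simp: linked_def)
  obtain s where s: "s \<in> ancestors r u" "s \<in> ancestors r v"
    using ancestors_chain[OF u(1) v(1)] self_ancestor by blast
  have s0: "s \<in> ancestors r (x 0)" using ancestors_trans[OF u(1) s(1)] .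
  obtain t where t: "t \<in> ancestors r s" "t \<in> ancestors r w"
    using ancestors_chain[OF s0 w(1)] self_ancestor by blast
  have "t \<in> ancestors r (x 0)" "t \<in> ancestors r (x 1)" "t \<in> ancestors r (x 2)" "t \<in> ancestors r (x 3)"
    using s0 t s u v w by (meson ancestors_trans)+
  then show ?thesis unfolding common_anc_def by auto
qed

lemma measurable_linked [measurable]: "Measurable.pred (jumps \<mu>) (\<lambda>r. linked r i j)"
proof -
  define x where "x n = (if n = 0 then i else j)" for n :: nat
  have "Measurable.pred (jumps \<mu>) (\<lambda>r. common_anc UNIV r x {0, 1})"
    by (rule measurable_common_anc) simp
  moreover have "linked r i j \<longleftrightarrow> common_anc UNIV r x {0, 1}" for r
    using linked_common_anc[of r x 0 1] by (simp add: x_def)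
  ultimately show ?thesis by simp
qed

context heavy_tailed_jumps
begin

text \<open>
  The lines of the first pair meet, those of the second pair meet, and the two pairs lie in different
  components. The meetings are located in \<open>A\<close>, the separation is everywhere.
\<close>
definition separate :: "int set \<Rightarrow> (int \<Rightarrow> nat) \<Rightarrow> (nat \<Rightarrow> int) \<Rightarrow> bool" where
  "separate A r x \<longleftrightarrow> common_anc A r x {0, 1} \<and> common_anc A r x {2, 3} \<and> \<not> common_anc UNIV r x {0, 2}"

lemma measurable_separate: "Measurable.pred (jumps \<mu>) (\<lambda>r. separate A r x)"
  unfolding separate_def by measurable

text \<open>
  A disjointness inequality of the type of van den Berg and Kesten: the jumps that realise the two meetings are
  distinct. The product of the two probabilities is harmonic in the highest vertex, and a tie between the pairs makes
  the event impossible.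
\<close>
lemma separate_product:
  "emeasure (jumps \<mu>) {r. separate UNIV r x} \<le> coal \<mu> UNIV x {0, 1} * coal \<mu> UNIV x {2, 3}"
proof -
  let ?I = "{0, 1, 2, 3::nat}"
  let ?F = "\<lambda>A x. emeasure (jumps \<mu>) {r. separate A r x}"
  let ?G = "\<lambda>x. coal \<mu> UNIV x {0, 1} * coal \<mu> UNIV x {2, 3}"
  have main: "?F {z0..} x \<le> ?G x" for z0 x
  proof (rule coalescence_comparison[OF pmf_0, of ?I "?F {z0..}" ?G z0])
    fix x :: "nat \<Rightarrow> int" and c :: nat
    assume c: "c \<in> ?I" and lt: "\<And>b. b \<in> ?I \<Longrightarrow> b \<noteq> c \<Longrightarrow> x b < x c"
    have ca: "common_anc A (r(x c := m)) x {s, t} \<longleftrightarrow> common_anc A r (x(c := x c - int m)) {s, t}"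
      if "0 < m" "s \<in> ?I" "t \<in> ?I" "s \<noteq> t" for A r m s t
    proof (rule common_anc_step)
      show "(if s = c then t else s) \<in> {s, t}" "(if s = c then t else s) \<noteq> c" using that by auto
      show "x b < x c" if "b \<in> {s, t}" "b \<noteq> c" for b
        using that \<open>s \<in> ?I\<close> \<open>t \<in> ?I\<close> by (intro lt) auto
    qed (use that in auto)
    have "?F {z0..} x = (\<integral>\<^sup>+m. emeasure (jumps \<mu>) {r. separate {z0..} (r(x c := m)) x} \<partial>measure_pmf \<mu>)"
      by (rule resample[OF measurable_separate])
    also have "\<dots> = (\<integral>\<^sup>+m. ?F {z0..} (x(c := x c - int m)) \<partial>measure_pmf \<mu>)"
    proof (rule nn_integral_cong_AE)
      show "AE m in measure_pmf \<mu>. emeasure (jumps \<mu>) {r. separate {z0..} (r(x c := m)) x}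
          = ?F {z0..} (x(c := x c - int m))"
        using AE_jump_pos[OF pmf_0]
      proof eventually_elim
        case (elim m)
        have "separate {z0..} (r(x c := m)) x \<longleftrightarrow> separate {z0..} r (x(c := x c - int m))" for r
          unfolding separate_def using elim by (subst (1 2 3) ca) auto
        then show ?case by (simp only:)
      qed
    qed
    finally show "?F {z0..} x \<le> (\<integral>\<^sup>+m. ?F {z0..} (x(c := x c - int m)) \<partial>measure_pmf \<mu>)" by simp
    show "(\<integral>\<^sup>+m. ?G (x(c := x c - int m)) \<partial>measure_pmf \<mu>) \<le> ?G x"
    proof (cases "c \<in> {0, 1}")
      case True
      have "coal \<mu> UNIV (x(c := x c - int m)) {2, 3} = coal \<mu> UNIV x {2, 3}" for m
        using True by (intro coal_reindex) auto
      moreover have "coal \<mu> UNIV x {0, 1} = (\<integral>\<^sup>+m. coal \<mu> UNIV (x(c := x c - int m)) {0, 1} \<partial>measure_pmf \<mu>)"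
      proof (rule coal_step[OF pmf_0])
        show "1 - c \<in> {0, 1}" "1 - c \<noteq> c" using True by auto
      qed (use lt in auto)
      ultimately show ?thesis by (simp add: nn_integral_multc del: fun_upd_apply)
    next
      case False
      then have c23: "c \<in> {2, 3}" using c by auto
      have "coal \<mu> UNIV (x(c := x c - int m)) {0, 1} = coal \<mu> UNIV x {0, 1}" for m
        using False by (intro coal_reindex) auto
      moreover have "coal \<mu> UNIV x {2, 3} = (\<integral>\<^sup>+m. coal \<mu> UNIV (x(c := x c - int m)) {2, 3} \<partial>measure_pmf \<mu>)"
      proof (rule coal_step[OF pmf_0])
        show "5 - c \<in> {2, 3}" "5 - c \<noteq> c" using c23 by auto
      qed (use lt in auto)
      ultimately show ?thesis by (simp add: nn_integral_cmult del: fun_upd_apply)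
    qed
  next
    fix x :: "nat \<Rightarrow> int" and b c :: nat
    assume *: "b \<in> ?I" "c \<in> ?I" "b \<noteq> c" "x b = x c"
    have cross: "?F {z0..} x \<le> ?G x" if "s \<in> {0, 1}" "t \<in> {2, 3}" "x s = x t" for s t
    proof -
      have "\<not> separate {z0..} r x" for r
      proof
        assume sep: "separate {z0..} r x"
        then have "linked r (x 0) (x 1)" "linked r (x 2) (x 3)" "\<not> linked r (x 0) (x 2)"
          unfolding separate_def linked_common_anc by (auto simp: common_anc_def)
        from \<open>linked r (x 0) (x 1)\<close> \<open>linked r (x 2) (x 3)\<close> have "linked r (x 0) (x s)" "linked r (x t) (x 2)"
          using that by (auto intro: linked_sym)
        then show False using \<open>x s = x t\<close> \<open>\<not> linked r (x 0) (x 2)\<close> by (auto dest: linked_trans)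
      qed
      then show ?thesis by simp
    qed
    consider "x 0 = x 1" | "x 2 = x 3" | s t where "s \<in> {0, 1}" "t \<in> {2, 3}" "x s = x t"
      using * by (auto; metis)
    then show "?F {z0..} x \<le> ?G x"
    proof cases
      case 1
      have "coal \<mu> UNIV x {0, 1} = 1" using 1 by (intro coal_unique) auto
      moreover have "?F {z0..} x \<le> coal \<mu> UNIV x {2, 3}"
        unfolding coal_def
        by (rule emeasure_jumps_mono[OF _ measurable_common_anc]) (auto simp: separate_def common_anc_def)
      ultimately show ?thesis by simp
    next
      case 2
      have "coal \<mu> UNIV x {2, 3} = 1" using 2 by (intro coal_unique) auto
      moreover have "?F {z0..} x \<le> coal \<mu> UNIV x {0, 1}"
        unfolding coal_def
        by (rule emeasure_jumps_mono[OF _ measurable_common_anc]) (auto simp: separate_def common_anc_def)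
      ultimately show ?thesis by simp
    qed (rule cross)
  next
    fix x :: "nat \<Rightarrow> int" and b :: nat
    assume b: "b \<in> ?I" "x b < z0"
    have "\<not> separate {z0..} r x" for r
      using b by (force simp: separate_def common_anc_def dest: ancestors_le)
    then show "?F {z0..} x \<le> ?G x" by simp
  qed auto
  have "?F UNIV x = emeasure (jumps \<mu>) (\<Union>n::nat. {r. separate {- int n..} r x})"
  proof (intro arg_cong2[where f = emeasure] refl equalityI subsetI)
    fix r assume "r \<in> {r. separate UNIV r x}"
    then have ns: "\<not> common_anc UNIV r x {0, 2}" and "common_anc UNIV r x {0, 1}" "common_anc UNIV r x {2, 3}"
      by (auto simp: separate_def)
    then obtain v w where v: "\<forall>b\<in>{0, 1}. v \<in> ancestors r (x b)" and w: "\<forall>b\<in>{2, 3}. w \<in> ancestors r (x b)"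
      unfolding common_anc_def by blast
    define n where "n = nat (max (- v) (- w))"
    have "v \<in> {- int n..}" "w \<in> {- int n..}" by (auto simp: n_def)
    then have "separate {- int n..} r x"
      using v w ns unfolding separate_def common_anc_def by blast
    then show "r \<in> (\<Union>n::nat. {r. separate {- int n..} r x})" by blast
  next
    fix r assume "r \<in> (\<Union>n::nat. {r. separate {- int n..} r x})"
    then show "r \<in> {r. separate UNIV r x}" by (auto simp: separate_def common_anc_def)
  qed
  also have "\<dots> = (SUP n::nat. ?F {- int n..} x)"
  proof (rule SUP_emeasure_incseq[symmetric])
    show "range (\<lambda>n. {r. separate {- int n..} r x}) \<subseteq> sets (jumps \<mu>)"
      using measurable_separate by (auto simp: pred_def)
    show "incseq (\<lambda>n. {r. separate {- int n..} r x})"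
      unfolding incseq_def
    proof (intro allI impI subsetI)
      fix m n :: nat and r assume "m \<le> n" "r \<in> {r. separate {- int m..} r x}"
      then show "r \<in> {r. separate {- int n..} r x}"
        unfolding separate_def common_anc_def by fastforce
    qed
  qed
  also have "\<dots> \<le> ?G x" by (intro SUP_least main)
  finally show ?thesis .
qed

definition pair_prob :: "int \<Rightarrow> int \<Rightarrow> real" where
  "pair_prob i j = measure (jumps \<mu>) {r. linked r i j}"

definition quad_prob :: "int \<Rightarrow> int \<Rightarrow> int \<Rightarrow> int \<Rightarrow> real" where
  "quad_prob i j k l = measure (jumps \<mu>) {r. linked r i j \<and> linked r i k \<and> linked r i l}"

lemma pair_prob_meet: "enn2real Q * pair_prob i j = enn2real (meet i j)"
proof -
  define x where "x n = (if n = 0 then i else j)" for n :: nat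
  have "meet i j = Q * emeasure (jumps \<mu>) {r. linked r i j}"
    using meet_eq_coal[of x] linked_common_anc[of _ x 0 1] by (simp add: x_def coal_def)
  then show ?thesis by (simp add: pair_prob_def measure_def enn2real_mult)
qed

text \<open>
  If both pairs are connected, they lie either in different components or in the same.
\<close>
lemma two_pairs_prob:
  "measure (jumps \<mu>) {r. linked r i j \<and> linked r k l} \<le> pair_prob i j * pair_prob k l + quad_prob i j k l"
proof -
  interpret J: prob_space "jumps \<mu>" by (rule prob_space_jumps)
  define x where "x n = (if n = 0 then i else if n = 1 then j else if n = 2 then k else l)" for n :: nat
  have x: "x 0 = i" "x 1 = j" "x 2 = k" "x 3 = l" by (auto simp: x_def)
  have S: "{r. separate UNIV r x} \<in> sets (jumps \<mu>)" using measurable_separate by (simp add: pred_def)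
  have F: "{r. linked r i j \<and> linked r i k \<and> linked r i l} \<in> sets (jumps \<mu>)"
  proof -
    have "Measurable.pred (jumps \<mu>) (\<lambda>r. linked r i j \<and> linked r i k \<and> linked r i l)" by measurable
    then show ?thesis by (simp add: pred_def)
  qed
  have "measure (jumps \<mu>) {r. linked r i j \<and> linked r k l}
      \<le> measure (jumps \<mu>) ({r. separate UNIV r x} \<union> {r. linked r i j \<and> linked r i k \<and> linked r i l})"
  proof (rule J.finite_measure_mono)
    show "{r. linked r i j \<and> linked r k l}
        \<subseteq> {r. separate UNIV r x} \<union> {r. linked r i j \<and> linked r i k \<and> linked r i l}"
      unfolding separate_def linked_common_anc[symmetric] x by (auto intro: linked_trans)
  qed (use S F in auto)
  also have "\<dots> \<le> measure (jumps \<mu>) {r. separate UNIV r x} + quad_prob i j k l"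
    unfolding quad_prob_def by (rule measure_Un_le[OF S F])
  also have "measure (jumps \<mu>) {r. separate UNIV r x} \<le> pair_prob i j * pair_prob k l"
  proof -
    have "coal \<mu> UNIV x {0, 1} = emeasure (jumps \<mu>) {r. linked r i j}"
      "coal \<mu> UNIV x {2, 3} = emeasure (jumps \<mu>) {r. linked r k l}"
      unfolding coal_def linked_common_anc[symmetric] x by auto
    then have "emeasure (jumps \<mu>) {r. separate UNIV r x} \<le> ennreal (pair_prob i j * pair_prob k l)"
      using separate_product[of x] by (simp add: J.emeasure_eq_measure pair_prob_def ennreal_mult)
    then show ?thesis by (simp add: J.emeasure_eq_measure pair_prob_def)
  qed
  finally show ?thesis by simp
qed

lemma quad_prob_sum:
  "ennreal (\<Sum>i\<in>{1..int n}. \<Sum>j\<in>{1..int n}. \<Sum>k\<in>{1..int n}. \<Sum>l\<in>{1..int n}. quad_prob i j k l) \<le> fourfold n"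
proof -
  interpret J: prob_space "jumps \<mu>" by (rule prob_space_jumps)
  have one: "ennreal (quad_prob i j k l) \<le> tree4 i j k l" for i j k l
  proof -
    define x where "x n = (if n = 0 then i else if n = 1 then j else if n = 2 then k else l)" for n :: nat
    have x: "x 0 = i" "x 1 = j" "x 2 = k" "x 3 = l" by (auto simp: x_def)
    have "ennreal (quad_prob i j k l) = emeasure (jumps \<mu>) {r. linked r i j \<and> linked r i k \<and> linked r i l}"
      by (simp add: quad_prob_def J.emeasure_eq_measure)
    also have "\<dots> \<le> coal \<mu> UNIV x {0, 1, 2, 3}"
      unfolding coal_def
      by (rule emeasure_jumps_mono[OF _ measurable_common_anc]) (use linked_four[of _ x] x in auto)
    also have "\<dots> \<le> tree4 i j k l"
      by (rule coal_le_tree4) (auto simp: x_def)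
    finally show ?thesis .
  qed
  have nn: "0 \<le> quad_prob i j k l" for i j k l by (simp add: quad_prob_def)
  show ?thesis
    unfolding fourfold_def by (simp add: nn sum_nonneg flip: sum_ennreal) (intro sum_mono one)
qed

end

section \<open>Independent colours\<close>

text \<open>
  Conditionally on \<open>E\<close>, the colours at \<open>J\<close> have the product law; this extends the factorisation from
  rectangles to integrable functions. The proof conditions by a density, which requires \<open>E\<close> to have positive
  probability.
\<close>
lemma colour_product_expectation:
  fixes f :: "int \<Rightarrow> real \<Rightarrow> 'b::{real_normed_field, banach, second_countable_topology}"
  assumes M: "prob_space M" and \<nu>: "prob_space \<nu>" "sets \<nu> = sets borel"
    and C: "component_colouring M R \<nu> C"
    and J: "finite J" and B: "B \<in> sets (\<Pi>\<^sub>M k\<in>(UNIV :: int set). count_space (UNIV :: nat set))"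
    and E: "E = {\<omega>\<in>space M. (\<lambda>k. R k \<omega>) \<in> B \<and> distinct_components (\<lambda>k. R k \<omega>) J}" "E \<in> sets M"
    and f: "\<And>j. j \<in> J \<Longrightarrow> integrable \<nu> (f j)"
  shows "integrable M (\<lambda>\<omega>. indicator E \<omega> *\<^sub>R (\<Prod>j\<in>J. f j (C j \<omega>)))" (is ?int)
    and "(\<integral>\<omega>. indicator E \<omega> *\<^sub>R (\<Prod>j\<in>J. f j (C j \<omega>)) \<partial>M) = measure M E *\<^sub>R (\<Prod>j\<in>J. \<integral>x. f j x \<partial>\<nu>)" (is ?eq)
proof -
  interpret M: prob_space M by fact
  interpret \<nu>: prob_space \<nu> by fact
  have mC [measurable]: "C j \<in> borel_measurable M" for j using C by (simp add: component_colouring_def)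
  have law: "measure M {\<omega>\<in>space M. (\<lambda>k. R k \<omega>) \<in> B \<and> distinct_components (\<lambda>k. R k \<omega>) J \<and> (\<forall>j\<in>J. C j \<omega> \<in> D j)}
      = measure M E * (\<Prod>j\<in>J. measure \<nu> (D j))" if "\<And>j. j \<in> J \<Longrightarrow> D j \<in> sets borel" for D
    using C J B that unfolding component_colouring_def E(1) by blast
  have mf [measurable]: "f j \<in> borel_measurable borel" if "j \<in> J" for j
    using borel_measurable_integrable[OF f[OF that]] \<nu>(2) by (simp cong: measurable_cong_sets)
  have mF [measurable]: "(\<lambda>\<omega>. \<Prod>j\<in>J. f j (C j \<omega>)) \<in> borel_measurable M"
    by (intro borel_measurable_prod measurable_compose[OF mC mf]) auto
  have mI: "(\<lambda>\<omega>. indicator E \<omega> :: real) \<in> borel_measurable M" using E(2) by simp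
  have "?int \<and> ?eq"
  proof (cases "measure M E = 0")
    case True
    then have "E \<in> null_sets M" using E(2) by (auto simp: null_sets_def M.emeasure_eq_measure)
    then have ae: "AE \<omega> in M. indicator E \<omega> *\<^sub>R (\<Prod>j\<in>J. f j (C j \<omega>)) = 0"
      by (rule AE_I') (auto simp: indicator_def)
    have "integrable M (\<lambda>\<omega>. indicator E \<omega> *\<^sub>R (\<Prod>j\<in>J. f j (C j \<omega>))) \<longleftrightarrow> integrable M (\<lambda>\<omega>. 0 :: 'b)"
      using mF mI by (intro integrable_cong_AE ae borel_measurable_scaleR) auto
    moreover have "(\<integral>\<omega>. indicator E \<omega> *\<^sub>R (\<Prod>j\<in>J. f j (C j \<omega>)) \<partial>M) = (\<integral>\<omega>. 0 \<partial>M)"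
      using mF mI by (intro integral_cong_AE ae borel_measurable_scaleR) auto
    ultimately show ?thesis using True by simp
  next
    case False
    define m where "m = measure M E"
    have m: "0 < m" using False by (simp add: m_def zero_less_measure_iff)
    define M' where "M' = density M (\<lambda>\<omega>. ennreal (indicator E \<omega> / m))"
    have sM': "sets M' = sets M" "space M' = space M" by (auto simp: M'_def)
    let ?X = "\<lambda>\<omega>. \<lambda>j\<in>J. C j \<omega>"
    have mX: "?X \<in> measurable M' (PiM J (\<lambda>_. \<nu>))"
      using \<nu>(2) by (intro measurable_restrict) (simp add: M'_def cong: measurable_cong_sets)
    interpret P: product_sigma_finite "\<lambda>_::int. \<nu>" by (intro product_sigma_finite.intro \<nu>.sigma_finite_measure_axioms)
    have eqP: "distr M' (PiM J (\<lambda>_. \<nu>)) ?X = PiM J (\<lambda>_. \<nu>)"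
    proof (rule P.PiM_eqI[OF J])
      fix A assume A: "\<And>j. j \<in> J \<Longrightarrow> A j \<in> sets \<nu>"
      have S: "Pi\<^sub>E J A \<in> sets (PiM J (\<lambda>_. \<nu>))" using J A by (intro sets_PiM_I_finite) auto
      let ?V = "?X -` Pi\<^sub>E J A \<inter> space M'"
      have V: "?V \<in> sets M" using measurable_sets[OF mX S] sM' by simp
      have "E \<inter> ?V = {\<omega>\<in>space M. (\<lambda>k. R k \<omega>) \<in> B \<and> distinct_components (\<lambda>k. R k \<omega>) J \<and> (\<forall>j\<in>J. C j \<omega> \<in> A j)}"
        by (auto simp: E(1) sM' PiE_def Pi_def)
      then have mEV: "measure M (E \<inter> ?V) = m * (\<Prod>j\<in>J. measure \<nu> (A j))"
        using law[of A] A \<nu>(2) by (simp add: m_def)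
      have "emeasure (distr M' (PiM J (\<lambda>_. \<nu>)) ?X) (Pi\<^sub>E J A) = emeasure M' ?V"
        by (rule emeasure_distr[OF mX S])
      also have "\<dots> = (\<integral>\<^sup>+\<omega>. ennreal (indicator E \<omega> / m) * indicator ?V \<omega> \<partial>M)"
        unfolding M'_def using mI V by (intro emeasure_density) (auto simp: M'_def)
      also have "\<dots> = (\<integral>\<^sup>+\<omega>. ennreal (1 / m) * indicator (E \<inter> ?V) \<omega> \<partial>M)"
        by (intro nn_integral_cong) (auto simp: indicator_def)
      also have "\<dots> = ennreal (1 / m) * emeasure M (E \<inter> ?V)"
        using V E(2) by (intro nn_integral_cmult_indicator) auto
      also have "\<dots> = ennreal (\<Prod>j\<in>J. measure \<nu> (A j))"
        using m by (simp add: M.emeasure_eq_measure mEV prod_nonneg flip: ennreal_mult)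
      also have "\<dots> = (\<Prod>j\<in>J. emeasure \<nu> (A j))"
        by (simp add: \<nu>.emeasure_eq_measure prod_ennreal)
      finally show "emeasure (distr M' (PiM J (\<lambda>_. \<nu>)) ?X) (Pi\<^sub>E J A) = (\<Prod>j\<in>J. emeasure \<nu> (A j))" .
    qed auto
    define g where "g x = (\<Prod>j\<in>J. f j (x j))" for x
    have gi: "integrable (PiM J (\<lambda>_. \<nu>)) g"
      unfolding g_def by (rule P.product_integrable_prod[OF J f])
    have gv: "integral\<^sup>L (PiM J (\<lambda>_. \<nu>)) g = (\<Prod>j\<in>J. \<integral>x. f j x \<partial>\<nu>)"
      unfolding g_def by (rule P.product_integral_prod[OF J f])
    have gm: "g \<in> borel_measurable (PiM J (\<lambda>_. \<nu>))" using gi by (rule borel_measurable_integrable)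
    have gX: "g (?X \<omega>) = (\<Prod>j\<in>J. f j (C j \<omega>))" for \<omega> by (simp add: g_def cong: prod.cong)
    have i': "integrable M' (\<lambda>\<omega>. \<Prod>j\<in>J. f j (C j \<omega>))"
      using integrable_distr[OF mX, of g] gi by (simp only: eqP gX)
    have v': "(\<integral>\<omega>. (\<Prod>j\<in>J. f j (C j \<omega>)) \<partial>M') = (\<Prod>j\<in>J. \<integral>x. f j x \<partial>\<nu>)"
      using integral_distr[OF mX gm] gv by (simp only: eqP gX)
    have d1: "integrable M (\<lambda>\<omega>. (indicator E \<omega> / m) *\<^sub>R (\<Prod>j\<in>J. f j (C j \<omega>)))"
      using i' m mI mF unfolding M'_def by (subst (asm) integrable_density) auto
    have d2: "(\<integral>\<omega>. (\<Prod>j\<in>J. f j (C j \<omega>)) \<partial>M') = (\<integral>\<omega>. (indicator E \<omega> / m) *\<^sub>R (\<Prod>j\<in>J. f j (C j \<omega>)) \<partial>M)"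
      unfolding M'_def using m mI mF by (intro integral_density) auto
    have sc: "m *\<^sub>R ((indicator E \<omega> / m) *\<^sub>R z) = indicator E \<omega> *\<^sub>R z" for \<omega> and z :: 'b
      using m by simp
    have ?int using integrable_scaleR_right[OF d1, of m] by (simp only: sc)
    moreover have "(\<integral>\<omega>. indicator E \<omega> *\<^sub>R (\<Prod>j\<in>J. f j (C j \<omega>)) \<partial>M)
        = m *\<^sub>R (\<integral>\<omega>. (indicator E \<omega> / m) *\<^sub>R (\<Prod>j\<in>J. f j (C j \<omega>)) \<partial>M)"
      using integral_scaleR_right[of M m "\<lambda>\<omega>. (indicator E \<omega> / m) *\<^sub>R (\<Prod>j\<in>J. f j (C j \<omega>))"]
      by (simp only: sc)
    ultimately show ?thesis using d2 v' by (simp add: m_def)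
  qed
  then show ?int ?eq by auto
qed

lemma iid_jumps_law:
  assumes M: "prob_space M" and R: "iid_jumps M \<mu> R"
  shows "(\<lambda>\<omega> k. R k \<omega>) \<in> measurable M (jumps \<mu>)"
    and "distr M (jumps \<mu>) (\<lambda>\<omega> k. R k \<omega>) = jumps \<mu>"
proof -
  interpret prob_space M by fact
  have ind: "indep_vars (\<lambda>_. count_space UNIV) R UNIV" and law: "\<And>i. distr M (count_space UNIV) (R i) = measure_pmf \<mu>"
    using R by (auto simp: iid_jumps_def)
  have rv: "R i \<in> measurable M (count_space UNIV)" for i using ind by (auto simp: indep_vars_def)
  have r: "(\<lambda>\<omega>. \<lambda>k\<in>UNIV. R k \<omega>) = (\<lambda>\<omega> k. R k \<omega>)" by (simp add: restrict_def)
  have s: "sets (jumps \<mu>) = sets (PiM UNIV (\<lambda>_. count_space UNIV))" by (rule sets_jumps)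
  have "(\<lambda>\<omega>. \<lambda>k\<in>UNIV. R k \<omega>) \<in> measurable M (PiM UNIV (\<lambda>_. count_space UNIV))"
    by (intro measurable_restrict rv)
  then show "(\<lambda>\<omega> k. R k \<omega>) \<in> measurable M (jumps \<mu>)"
    using s unfolding r by (simp cong: measurable_cong_sets)
  have "distr M (PiM UNIV (\<lambda>_. count_space UNIV)) (\<lambda>\<omega>. \<lambda>k\<in>UNIV. R k \<omega>) = PiM UNIV (\<lambda>i. distr M (count_space UNIV) (R i))"
    using indep_vars_iff_distr_eq_PiM[where I = UNIV and M' = "\<lambda>_. count_space UNIV" and X = R] rv ind by simp
  also have "\<dots> = jumps \<mu>" by (simp add: law jumps_def)
  finally have "distr M (PiM UNIV (\<lambda>_. count_space UNIV)) (\<lambda>\<omega> k. R k \<omega>) = jumps \<mu>" unfolding r .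
  moreover have "distr M (jumps \<mu>) (\<lambda>\<omega> k. R k \<omega>) = distr M (PiM UNIV (\<lambda>_. count_space UNIV)) (\<lambda>\<omega> k. R k \<omega>)"
    by (intro distr_cong refl s)
  ultimately show "distr M (jumps \<mu>) (\<lambda>\<omega> k. R k \<omega>) = jumps \<mu>" by simp
qed

text \<open>
  For small arguments by a Taylor expansion with the third absolute moment, for the others because both terms are bounded
  by \<open>1\<close>.
\<close>
lemma char_error_cubic:
  assumes N: "prob_space N" and Y: "Y \<in> borel_measurable N"
    and m0: "prob_space.expectation N Y = 0" and m4: "integrable N (\<lambda>\<omega>. Y \<omega> ^ 4)"
    and \<tau>: "\<tau> = prob_space.expectation N (\<lambda>\<omega>. (Y \<omega>)\<^sup>2)"
  shows "integrable N Y" "integrable N (\<lambda>\<omega>. (Y \<omega>)\<^sup>2)"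
    and "\<exists>K\<ge>0. \<forall>x. cmod (char (distr N borel Y) x - of_real (exp (- (\<tau> * x\<^sup>2 / 2)))) \<le> K * \<bar>x\<bar> ^ 3"
proof -
  interpret prob_space N by fact
  note Y [measurable]
  have le: "\<bar>y\<bar> ^ k \<le> 1 + y ^ 4" if "k \<le> 4" for y :: real and k
  proof (cases "\<bar>y\<bar> \<le> 1")
    case True
    then have "\<bar>y\<bar> ^ k \<le> 1" by (intro power_le_one) auto
    moreover have "0 \<le> y ^ 4" by simp
    ultimately show ?thesis by linarith
  next
    case False
    then have "\<bar>y\<bar> ^ k \<le> \<bar>y\<bar> ^ 4" using that by (intro power_increasing) auto
    then show ?thesis by simp
  qed
  have ik: "integrable N (\<lambda>\<omega>. \<bar>Y \<omega>\<bar> ^ k)" if "k \<le> 4" for k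
  proof (rule Bochner_Integration.integrable_bound[where f = "\<lambda>\<omega>. 1 + Y \<omega> ^ 4"])
    show "AE \<omega> in N. norm (\<bar>Y \<omega>\<bar> ^ k) \<le> norm (1 + Y \<omega> ^ 4)"
    proof (rule AE_I2)
      fix \<omega>
      have "norm (\<bar>Y \<omega>\<bar> ^ k) = \<bar>Y \<omega>\<bar> ^ k" by simp
      also have "\<dots> \<le> 1 + Y \<omega> ^ 4" by (rule le[OF that])
      also have "\<dots> \<le> norm (1 + Y \<omega> ^ 4)" by (simp only: real_norm_def abs_ge_self)
      finally show "norm (\<bar>Y \<omega>\<bar> ^ k) \<le> norm (1 + Y \<omega> ^ 4)" .
    qed
  qed (use m4 in auto)
  show i2: "integrable N (\<lambda>\<omega>. (Y \<omega>)\<^sup>2)" using ik[of 2] by simp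
  have "integrable N (\<lambda>\<omega>. \<bar>Y \<omega>\<bar>)" using ik[of 1] by simp
  then show i1: "integrable N Y" by (rule integrable_abs_cancel[OF _ Y])
  have i3: "integrable N (\<lambda>\<omega>. \<bar>Y \<omega>\<bar> ^ 3)" by (rule ik) simp
  define T where "T = expectation (\<lambda>\<omega>. \<bar>Y \<omega>\<bar> ^ 3)"
  have T: "0 \<le> T" by (simp add: T_def)
  have \<tau>0: "0 \<le> \<tau>" by (simp add: \<tau>)
  have var: "variance Y = \<tau>" using m0 i2 i1 by (simp add: \<tau>)
  define K where "K = T / 6 + \<tau>\<^sup>2 + 2"
  interpret D: real_distribution "distr N borel Y" by (rule real_distribution_distr) simp
  have cube: "x\<^sup>2 * \<bar>x\<bar> = \<bar>x\<bar> ^ 3" for x :: real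
    unfolding power2_abs[symmetric, of x] by (simp add: power3_eq_cube power2_eq_square)
  have fourth: "(x\<^sup>2)\<^sup>2 = \<bar>x\<bar> ^ 3 * \<bar>x\<bar>" for x :: real
    unfolding cube[symmetric] by (simp add: power2_eq_square mult.assoc)
  have bound: "cmod (char (distr N borel Y) x - of_real (exp (- (\<tau> * x\<^sup>2 / 2)))) \<le> K * \<bar>x\<bar> ^ 3" for x
  proof (cases "\<bar>x\<bar> \<le> 1")
    case True
    have "cmod (char (distr N borel Y) x - (1 - x\<^sup>2 * \<tau> / 2))
        \<le> (x\<^sup>2 / 6) * expectation (\<lambda>\<omega>. min (6 * (Y \<omega>)\<^sup>2) (\<bar>x\<bar> * \<bar>Y \<omega>\<bar> ^ 3))"
      by (rule char_approx3'[OF Y i1 i2 m0 var refl])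
    also have "\<dots> \<le> (x\<^sup>2 / 6) * expectation (\<lambda>\<omega>. \<bar>x\<bar> * \<bar>Y \<omega>\<bar> ^ 3)"
      using i2 i3 by (intro mult_left_mono integral_mono integrable_min) auto
    also have "\<dots> = T / 6 * \<bar>x\<bar> ^ 3"
      by (simp add: T_def cube[symmetric])
    finally have 1: "cmod (char (distr N borel Y) x - (1 - x\<^sup>2 * \<tau> / 2)) \<le> T / 6 * \<bar>x\<bar> ^ 3" .
    define z where "z = \<tau> * x\<^sup>2 / 2"
    have z: "0 \<le> z" using \<tau>0 by (simp add: z_def)
    have e1: "1 - z \<le> exp (- z)" using exp_ge_add_one_self[of "- z"] by simp
    have e2: "exp (- z) \<le> 1 - z + z\<^sup>2"
    proof -
      have "exp (- z) * (1 + z) \<le> exp (- z) * exp z"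
        using exp_ge_add_one_self[of z] by (intro mult_left_mono) auto
      then have "exp (- z) * (1 + z) \<le> 1" by (simp flip: exp_add)
      then have "exp (- z) \<le> 1 / (1 + z)" using z by (simp add: field_simps)
      also have "\<dots> \<le> 1 - z + z\<^sup>2" using z by (simp add: field_simps power2_eq_square)
      finally show ?thesis .
    qed
    have "\<bar>(1 - z) - exp (- z)\<bar> \<le> z\<^sup>2" using e1 e2 by simp
    also have "z\<^sup>2 = \<tau>\<^sup>2 / 4 * (\<bar>x\<bar> ^ 3 * \<bar>x\<bar>)"
      unfolding fourth[symmetric] by (simp add: z_def power_mult_distrib power_divide)
    also have "\<dots> \<le> \<tau>\<^sup>2 / 4 * (\<bar>x\<bar> ^ 3 * 1)" using True by (intro mult_left_mono) auto
    also have "\<dots> \<le> \<tau>\<^sup>2 * \<bar>x\<bar> ^ 3" by (auto intro!: mult_right_mono)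
    finally have 2: "\<bar>(1 - z) - exp (- z)\<bar> \<le> \<tau>\<^sup>2 * \<bar>x\<bar> ^ 3" .
    have "cmod (of_real (1 - z) - of_real (exp (- z))) = \<bar>(1 - z) - exp (- z)\<bar>"
      by (metis norm_of_real of_real_diff real_norm_def)
    then have 3: "cmod ((1 - x\<^sup>2 * \<tau> / 2) - of_real (exp (- (\<tau> * x\<^sup>2 / 2)))) \<le> \<tau>\<^sup>2 * \<bar>x\<bar> ^ 3"
      using 2 by (simp add: z_def mult.commute)
    have "cmod (char (distr N borel Y) x - of_real (exp (- (\<tau> * x\<^sup>2 / 2))))
        \<le> cmod (char (distr N borel Y) x - (1 - x\<^sup>2 * \<tau> / 2)) + cmod ((1 - x\<^sup>2 * \<tau> / 2) - of_real (exp (- (\<tau> * x\<^sup>2 / 2))))"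
      using norm_triangle_ineq[of "char (distr N borel Y) x - (1 - x\<^sup>2 * \<tau> / 2)"
          "(1 - x\<^sup>2 * \<tau> / 2) - of_real (exp (- (\<tau> * x\<^sup>2 / 2)))"] by simp
    also have "\<dots> \<le> T / 6 * \<bar>x\<bar> ^ 3 + \<tau>\<^sup>2 * \<bar>x\<bar> ^ 3" using 1 3 by (rule add_mono)
    also have "\<dots> \<le> K * \<bar>x\<bar> ^ 3" by (simp add: K_def ring_distribs)
    finally show ?thesis .
  next
    case False
    have "cmod (char (distr N borel Y) x - of_real (exp (- (\<tau> * x\<^sup>2 / 2))))
        \<le> cmod (char (distr N borel Y) x) + cmod (of_real (exp (- (\<tau> * x\<^sup>2 / 2))))"
      by (rule norm_triangle_ineq4)
    also have "\<dots> \<le> 1 + 1"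
      using \<tau>0 by (intro add_mono D.cmod_char_le_1) simp
    also have "\<dots> \<le> 2 * \<bar>x\<bar> ^ 3" using False one_le_power[of "\<bar>x\<bar>" 3] by simp
    also have "\<dots> \<le> K * \<bar>x\<bar> ^ 3" using T by (intro mult_right_mono) (auto simp: K_def)
    finally show ?thesis .
  qed
  moreover have "0 \<le> K" using T by (simp add: K_def)
  ultimately show "\<exists>K\<ge>0. \<forall>x. cmod (char (distr N borel Y) x - of_real (exp (- (\<tau> * x\<^sup>2 / 2)))) \<le> K * \<bar>x\<bar> ^ 3"
    by blast
qed

section \<open>Clusters of a finite set of vertices\<close>

text \<open>
  The least element of every class of \<open>E\<close> in \<open>S\<close>.
\<close>
definition reps :: "int set \<Rightarrow> (int \<Rightarrow> int \<Rightarrow> bool) \<Rightarrow> int set" where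
  "reps S E = {j \<in> S. \<forall>i\<in>S. i < j \<longrightarrow> \<not> E i j}"

definition cluster_weight :: "int set \<Rightarrow> (int \<Rightarrow> int \<Rightarrow> bool) \<Rightarrow> (int \<Rightarrow> real) \<Rightarrow> int \<Rightarrow> real" where
  "cluster_weight S E b j = (\<Sum>i\<in>{i\<in>S. E i j}. b i)"

lemma sum_over_clusters:
  fixes g :: "int \<Rightarrow> 'b::comm_monoid_add"
  assumes S: "finite S" and refl: "\<And>i. E i i" and sym: "\<And>i j. E i j \<Longrightarrow> E j i"
    and trans: "\<And>i j k. E i j \<Longrightarrow> E j k \<Longrightarrow> E i k"
  shows "(\<Sum>i\<in>S. g i) = (\<Sum>j\<in>reps S E. \<Sum>i\<in>{i\<in>S. E i j}. g i)"
proof -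
  define h where "h i = Min {k\<in>S. E k i}" for i
  have h: "h i \<in> S" "E (h i) i" "\<And>k. k \<in> S \<Longrightarrow> E k i \<Longrightarrow> h i \<le> k" if "i \<in> S" for i
  proof -
    have "h i \<in> {k\<in>S. E k i}" unfolding h_def using S that refl by (intro Min_in) auto
    then show "h i \<in> S" "E (h i) i" by auto
    show "h i \<le> k" if "k \<in> S" "E k i" for k unfolding h_def using S that by (intro Min_le) auto
  qed
  have hr: "h i \<in> reps S E" if i: "i \<in> S" for i
  proof -
    have "\<not> E k (h i)" if "k \<in> S" "k < h i" for k
      using h[OF i] that trans[of k "h i" i] by force
    then show ?thesis using h[OF i] by (auto simp: reps_def)
  qed
  have fib: "{i\<in>S. h i = j} = {i\<in>S. E i j}" if j: "j \<in> reps S E" for j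
  proof (intro equalityI subsetI)
    fix i assume "i \<in> {i\<in>S. h i = j}" then show "i \<in> {i\<in>S. E i j}" using h sym by blast
  next
    fix i assume "i \<in> {i\<in>S. E i j}"
    then have i: "i \<in> S" "E i j" by auto
    have jS: "j \<in> S" using j by (simp add: reps_def)
    have "h i \<le> j" using h(3)[OF i(1) jS] sym i by blast
    moreover have "E (h i) j" using h(2)[OF i(1)] i(2) trans by blast
    ultimately have "h i = j" using j h(1)[OF i(1)] by (force simp: reps_def)
    then show "i \<in> {i\<in>S. h i = j}" using i by simp
  qed
  have "(\<Sum>j\<in>reps S E. \<Sum>i\<in>{i\<in>S. h i = j}. g i) = (\<Sum>i\<in>S. g i)"
    using S hr by (intro sum.group) (auto simp: reps_def)
  then show ?thesis using fib by simp
qed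

lemma finite_reps: "finite S \<Longrightarrow> finite (reps S E)"
  by (simp add: reps_def)

context
  fixes r :: "int \<Rightarrow> nat" and S :: "int set"
  assumes S: "finite S"
begin

lemma sum_over_linked:
  fixes g :: "int \<Rightarrow> 'b::comm_monoid_add"
  shows "(\<Sum>i\<in>S. g i) = (\<Sum>j\<in>reps S (linked r). \<Sum>i\<in>{i\<in>S. linked r i j}. g i)"
  by (rule sum_over_clusters[OF S]) (auto intro: linked_sym linked_trans)

lemma cluster_weight_eq:
  assumes "linked r i j"
  shows "(\<Sum>k\<in>S. b k * of_bool (linked r i k)) = cluster_weight S (linked r) b j"
proof -
  have "(\<Sum>k\<in>S. b k * of_bool (linked r i k)) = (\<Sum>k\<in>{k\<in>S. linked r k j}. b k * of_bool (linked r i k))"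
    using S assms by (intro sum.mono_neutral_right) (auto dest: linked_trans linked_sym)
  also have "\<dots> = (\<Sum>k\<in>{k\<in>S. linked r k j}. b k)"
    using assms by (intro sum.cong) (auto dest: linked_trans linked_sym)
  finally show ?thesis by (simp add: cluster_weight_def)
qed

lemma sum_colours_clusters:
  fixes c :: "int \<Rightarrow> real"
  assumes "\<And>i j. linked r i j \<Longrightarrow> c i = c j"
  shows "(\<Sum>i\<in>S. b i * c i) = (\<Sum>j\<in>reps S (linked r). cluster_weight S (linked r) b j * c j)"
proof -
  have *: "(\<Sum>i\<in>{i\<in>S. linked r i j}. b i * c i) = cluster_weight S (linked r) b j * c j" for j
    using assms by (auto simp: cluster_weight_def sum_distrib_right intro!: sum.cong)
  show ?thesis unfolding sum_over_linked[where g = "\<lambda>i. b i * c i"] by (intro sum.cong refl *)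
qed

lemma sum_squares_clusters:
  "(\<Sum>j\<in>reps S (linked r). (cluster_weight S (linked r) b j)\<^sup>2)
    = (\<Sum>i\<in>S. \<Sum>k\<in>S. b i * b k * of_bool (linked r i k))"
proof -
  have *: "(\<Sum>i\<in>{i\<in>S. linked r i j}. \<Sum>k\<in>S. b i * b k * of_bool (linked r i k))
      = (cluster_weight S (linked r) b j)\<^sup>2" for j
  proof -
    have "(\<Sum>i\<in>{i\<in>S. linked r i j}. \<Sum>k\<in>S. b i * b k * of_bool (linked r i k))
        = (\<Sum>i\<in>{i\<in>S. linked r i j}. b i * (\<Sum>k\<in>S. b k * of_bool (linked r i k)))"
      by (simp add: sum_distrib_left mult.assoc)
    also have "\<dots> = (\<Sum>i\<in>{i\<in>S. linked r i j}. b i * cluster_weight S (linked r) b j)"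
      by (intro sum.cong refl) (simp add: cluster_weight_eq)
    finally show ?thesis by (simp add: cluster_weight_def power2_eq_square sum_distrib_right)
  qed
  show ?thesis
    unfolding sum_over_linked[where g = "\<lambda>i. \<Sum>k\<in>S. b i * b k * of_bool (linked r i k)"]
    by (intro sum.cong refl *[symmetric])
qed

text \<open>
  Both sides count the ordered quadruples in one cluster.
\<close>
lemma sum_fourth_clusters:
  "(\<Sum>j\<in>reps S (linked r). (cluster_weight S (linked r) (\<lambda>_. 1) j) ^ 4)
    = (\<Sum>i\<in>S. \<Sum>j\<in>S. \<Sum>k\<in>S. \<Sum>l\<in>S. of_bool (linked r i j \<and> linked r i k \<and> linked r i l))"
proof -
  have "(\<Sum>j\<in>S. \<Sum>k\<in>S. \<Sum>l\<in>S. of_bool (linked r i j \<and> linked r i k \<and> linked r i l))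
      = (\<Sum>k\<in>S. 1 * of_bool (linked r i k) :: real) ^ 3" for i
  proof -
    define L :: "int \<Rightarrow> real" where "L k = of_bool (linked r i k)" for k
    have "(\<Sum>j\<in>S. \<Sum>k\<in>S. \<Sum>l\<in>S. of_bool (linked r i j \<and> linked r i k \<and> linked r i l))
        = (\<Sum>j\<in>S. \<Sum>k\<in>S. \<Sum>l\<in>S. L j * (L k * L l))"
      by (simp only: of_bool_conj L_def)
    also have "\<dots> = (\<Sum>k\<in>S. L k) * ((\<Sum>k\<in>S. L k) * (\<Sum>k\<in>S. L k))"
      by (simp only: sum_distrib_left[symmetric] sum_distrib_right[symmetric])
    finally show ?thesis by (simp add: L_def power3_eq_cube mult.assoc)
  qed
  then have "(\<Sum>i\<in>S. \<Sum>j\<in>S. \<Sum>k\<in>S. \<Sum>l\<in>S. of_bool (linked r i j \<and> linked r i k \<and> linked r i l))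
      = (\<Sum>i\<in>S. (\<Sum>k\<in>S. 1 * of_bool (linked r i k) :: real) ^ 3)" by simp
  also have "\<dots> = (\<Sum>j\<in>reps S (linked r). \<Sum>i\<in>{i\<in>S. linked r i j}. (\<Sum>k\<in>S. 1 * of_bool (linked r i k)) ^ 3)"
    by (rule sum_over_linked)
  also have "\<dots> = (\<Sum>j\<in>reps S (linked r). \<Sum>i\<in>{i\<in>S. linked r i j}. (cluster_weight S (linked r) (\<lambda>_. 1) j) ^ 3)"
    by (intro sum.cong refl arg_cong[where f = "\<lambda>x. x ^ 3"] cluster_weight_eq) auto
  also have "\<dots> = (\<Sum>j\<in>reps S (linked r). (cluster_weight S (linked r) (\<lambda>_. 1) j) ^ 4)"
    by (intro sum.cong refl) (simp add: cluster_weight_def power3_eq_cube power4_eq_xxxx)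
  finally show ?thesis by simp
qed

end

lemma integral_finite_pattern:
  fixes h :: "'p \<Rightarrow> 'b::{banach, second_countable_topology}"
  assumes P: "prob_space P" and fin: "finite U" and pat: "\<And>\<omega>. \<omega> \<in> space P \<Longrightarrow> pat \<omega> \<in> U"
    and m: "\<And>\<pi>. \<pi> \<in> U \<Longrightarrow> {\<omega>\<in>space P. pat \<omega> = \<pi>} \<in> sets P"
  shows "integrable P (\<lambda>\<omega>. h (pat \<omega>))"
    and "(\<integral>\<omega>. h (pat \<omega>) \<partial>P) = (\<Sum>\<pi>\<in>U. measure P {\<omega>\<in>space P. pat \<omega> = \<pi>} *\<^sub>R h \<pi>)"
proof -
  interpret prob_space P by fact
  have eq: "h (pat \<omega>) = (\<Sum>\<pi>\<in>U. indicator {\<omega>\<in>space P. pat \<omega> = \<pi>} \<omega> *\<^sub>R h \<pi>)" if "\<omega> \<in> space P" for \<omega>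
  proof -
    have "(\<Sum>\<pi>\<in>U. indicator {\<omega>\<in>space P. pat \<omega> = \<pi>} \<omega> *\<^sub>R h \<pi>) = (\<Sum>\<pi>\<in>U. if pat \<omega> = \<pi> then h \<pi> else 0)"
      using that by (intro sum.cong) (auto simp: indicator_def)
    then show ?thesis using fin pat[OF that] by simp
  qed
  have int: "integrable P (\<lambda>\<omega>. indicator {\<omega>\<in>space P. pat \<omega> = \<pi>} \<omega> *\<^sub>R h \<pi>)" if "\<pi> \<in> U" for \<pi>
    using m[OF that] by (intro integrable_scaleR_left) (simp add: emeasure_eq_measure)
  have "integrable P (\<lambda>\<omega>. \<Sum>\<pi>\<in>U. indicator {\<omega>\<in>space P. pat \<omega> = \<pi>} \<omega> *\<^sub>R h \<pi>)"
    by (intro Bochner_Integration.integrable_sum int)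
  then show "integrable P (\<lambda>\<omega>. h (pat \<omega>))"
    by (subst Bochner_Integration.integrable_cong[OF refl eq])
  have "(\<integral>\<omega>. h (pat \<omega>) \<partial>P) = (\<integral>\<omega>. (\<Sum>\<pi>\<in>U. indicator {\<omega>\<in>space P. pat \<omega> = \<pi>} \<omega> *\<^sub>R h \<pi>) \<partial>P)"
    by (intro Bochner_Integration.integral_cong refl eq)
  also have "\<dots> = (\<Sum>\<pi>\<in>U. (\<integral>\<omega>. indicator {\<omega>\<in>space P. pat \<omega> = \<pi>} \<omega> *\<^sub>R h \<pi> \<partial>P))"
    by (intro Bochner_Integration.integral_sum int)
  also have "\<dots> = (\<Sum>\<pi>\<in>U. measure P {\<omega>\<in>space P. pat \<omega> = \<pi>} *\<^sub>R h \<pi>)"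
    using m by (intro sum.cong refl) (simp add: emeasure_eq_measure)
  finally show "(\<integral>\<omega>. h (pat \<omega>) \<partial>P) = (\<Sum>\<pi>\<in>U. measure P {\<omega>\<in>space P. pat \<omega> = \<pi>} *\<^sub>R h \<pi>)" .
qed

text \<open>
  The partition of \<open>S\<close> into clusters. It takes finitely many values, so that conditioning on it is a finite sum.
\<close>
definition pattern :: "int set \<Rightarrow> (int \<Rightarrow> nat) \<Rightarrow> (int \<times> int) set" where
  "pattern S r = {(i, j) \<in> S \<times> S. linked r i j}"

lemma measurable_pattern:
  assumes "finite S"
  shows "{r. pattern S r = \<pi>} \<in> sets (jumps \<mu>)"
proof (cases "\<pi> \<subseteq> S \<times> S")
  case True
  then have "{r. pattern S r = \<pi>} = {r \<in> space (jumps \<mu>). \<forall>x\<in>S \<times> S. linked r (fst x) (snd x) \<longleftrightarrow> x \<in> \<pi>}"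
    by (auto simp: pattern_def)
  also have "\<dots> \<in> sets (jumps \<mu>)" using assms by measurable
  finally show ?thesis .
next
  case False
  then have "{r. pattern S r = \<pi>} = {}" by (auto simp: pattern_def)
  then show ?thesis by simp
qed

lemma reps_pattern: "reps S (linked r) = reps S (\<lambda>i j. (i, j) \<in> pattern S r)"
  by (auto simp: reps_def pattern_def)

lemma cluster_weight_pattern:
  "j \<in> S \<Longrightarrow> cluster_weight S (linked r) b j = cluster_weight S (\<lambda>i j. (i, j) \<in> pattern S r) b j"
  unfolding cluster_weight_def by (rule sum.cong) (auto simp: pattern_def)

text \<open>
  The constant \<open>K3\<close> measures the distance of the law of a colour from the Gaussian law with the same variance, in terms
  of characteristic functions.
\<close>
locale coloured_urn = heavy_tailed_jumps \<mu> a \<kappa> c0 + prob_space M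
  for \<mu> :: "nat pmf" and a \<kappa> c0 :: real and M :: "'w measure" +
  fixes R :: "int \<Rightarrow> 'w \<Rightarrow> nat" and C :: "int \<Rightarrow> 'w \<Rightarrow> real" and \<nu> :: "real measure" and \<tau> K3 :: real
  assumes iid: "iid_jumps M \<mu> R"
    and colouring: "component_colouring M R \<nu> C"
    and \<nu>: "real_distribution \<nu>"
    and mean: "integrable \<nu> (\<lambda>x. x)" "(\<integral>x. x \<partial>\<nu>) = 0"
    and second: "integrable \<nu> (\<lambda>x. x\<^sup>2)" "(\<integral>x. x\<^sup>2 \<partial>\<nu>) = \<tau>"
    and \<tau>_pos: "0 < \<tau>"
    and K3: "0 \<le> K3" "\<And>x. cmod (char \<nu> x - of_real (exp (- (\<tau> * x\<^sup>2 / 2)))) \<le> K3 * \<bar>x\<bar> ^ 3"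
begin

lemma \<nu>_prob: "prob_space \<nu>" "sets \<nu> = sets borel"
  using \<nu> by (auto simp: real_distribution_def real_distribution_axioms_def)

lemma measurable_colour [measurable]: "C i \<in> borel_measurable M"
  using colouring by (simp add: component_colouring_def)

abbreviation graph :: "'w \<Rightarrow> int \<Rightarrow> nat" where "graph \<omega> \<equiv> (\<lambda>k. R k \<omega>)"

lemma colour_linked: "\<omega> \<in> space M \<Longrightarrow> linked (graph \<omega>) i j \<Longrightarrow> C i \<omega> = C j \<omega>"
  using colouring by (simp add: component_colouring_def same_component_iff_linked)

lemma graph_event: "B \<in> sets (jumps \<mu>) \<Longrightarrow> {\<omega>\<in>space M. graph \<omega> \<in> B} \<in> sets M"
  using measurable_sets[OF iid_jumps_law(1)[OF prob_space_axioms iid], of B]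
  by (simp add: vimage_def Int_def conj_commute)

lemma graph_prob: "B \<in> sets (jumps \<mu>) \<Longrightarrow> measure M {\<omega>\<in>space M. graph \<omega> \<in> B} = measure (jumps \<mu>) B"
  using measure_distr[OF iid_jumps_law(1)[OF prob_space_axioms iid], of B] iid_jumps_law(2)[OF prob_space_axioms iid]
  by (simp add: vimage_def Int_def conj_commute)

lemma colour_expectation:
  fixes f :: "int \<Rightarrow> real \<Rightarrow> 'b::{real_normed_field, banach, second_countable_topology}"
  assumes J: "finite J" and B: "B \<in> sets (jumps \<mu>)"
    and dist: "\<And>r. r \<in> B \<Longrightarrow> distinct_components r J"
    and f: "\<And>j. j \<in> J \<Longrightarrow> integrable \<nu> (f j)"
  shows "integrable M (\<lambda>\<omega>. indicator {\<omega>\<in>space M. graph \<omega> \<in> B} \<omega> *\<^sub>R (\<Prod>j\<in>J. f j (C j \<omega>)))"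
    and "(\<integral>\<omega>. indicator {\<omega>\<in>space M. graph \<omega> \<in> B} \<omega> *\<^sub>R (\<Prod>j\<in>J. f j (C j \<omega>)) \<partial>M)
      = measure (jumps \<mu>) B *\<^sub>R (\<Prod>j\<in>J. \<integral>x. f j x \<partial>\<nu>)"
proof -
  have E: "{\<omega>\<in>space M. graph \<omega> \<in> B} = {\<omega>\<in>space M. graph \<omega> \<in> B \<and> distinct_components (graph \<omega>) J}"
    using dist by auto
  note * = colour_product_expectation[OF prob_space_axioms \<nu>_prob colouring J B[unfolded sets_jumps] E graph_event[OF B] f]
  show "integrable M (\<lambda>\<omega>. indicator {\<omega>\<in>space M. graph \<omega> \<in> B} \<omega> *\<^sub>R (\<Prod>j\<in>J. f j (C j \<omega>)))"
    by (rule *(1))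
  show "(\<integral>\<omega>. indicator {\<omega>\<in>space M. graph \<omega> \<in> B} \<omega> *\<^sub>R (\<Prod>j\<in>J. f j (C j \<omega>)) \<partial>M)
      = measure (jumps \<mu>) B *\<^sub>R (\<Prod>j\<in>J. \<integral>x. f j x \<partial>\<nu>)"
    using *(2) graph_prob[OF B] by simp
qed

text \<open>
  Vertices of one component have equal colours, and colours of different components are uncorrelated.
\<close>
lemma colour_moments:
  shows "integrable M (C i)" "expectation (C i) = 0" "integrable M (\<lambda>\<omega>. (C i \<omega>)\<^sup>2)"
    and "integrable M (\<lambda>\<omega>. C i \<omega> * C k \<omega>)" "expectation (\<lambda>\<omega>. C i \<omega> * C k \<omega>) = \<tau> * pair_prob i k"
proof -
  have UN: "UNIV \<in> sets (jumps \<mu>)" using sets.top[of "jumps \<mu>"] by simp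
  have pU: "measure (jumps \<mu>) UNIV = 1" using prob_space.prob_space[OF prob_space_jumps[of \<mu>]] by simp
  have one: "integrable M (\<lambda>\<omega>. f (C i \<omega>))" "expectation (\<lambda>\<omega>. f (C i \<omega>)) = (\<integral>x. f x \<partial>\<nu>)"
    if f: "integrable \<nu> f" for f :: "real \<Rightarrow> real" and i
  proof -
    note * = colour_expectation[of "{i}" UNIV "\<lambda>_. f", OF _ UN _ f]
    have eq: "indicator {\<omega>\<in>space M. graph \<omega> \<in> UNIV} \<omega> *\<^sub>R (\<Prod>j\<in>{i}. f (C j \<omega>)) = f (C i \<omega>)" if "\<omega> \<in> space M" for \<omega>
      using that by simp
    show "integrable M (\<lambda>\<omega>. f (C i \<omega>))"
      using *(1) by (subst Bochner_Integration.integrable_cong[OF refl eq[symmetric]]) (auto simp: distinct_components_def)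
    have "expectation (\<lambda>\<omega>. f (C i \<omega>))
        = (\<integral>\<omega>. indicator {\<omega>\<in>space M. graph \<omega> \<in> UNIV} \<omega> *\<^sub>R (\<Prod>j\<in>{i}. f (C j \<omega>)) \<partial>M)"
      by (intro Bochner_Integration.integral_cong refl eq[symmetric])
    also have "\<dots> = (\<integral>x. f x \<partial>\<nu>)"
      by (subst *(2)) (auto simp: distinct_components_def pU)
    finally show "expectation (\<lambda>\<omega>. f (C i \<omega>)) = (\<integral>x. f x \<partial>\<nu>)" .
  qed
  show "integrable M (C i)" "expectation (C i) = 0" using one[OF mean(1)] mean(2) by auto
  show i2: "integrable M (\<lambda>\<omega>. (C i \<omega>)\<^sup>2)" for i using one(1)[OF second(1)] .
  let ?B = "{r. linked r i k}"
  have B: "?B \<in> sets (jumps \<mu>)" using measurable_linked by (simp add: pred_def)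
  have "Measurable.pred (jumps \<mu>) (\<lambda>r. \<not> linked r i k)" by measurable
  then have Bc: "{r. \<not> linked r i k} \<in> sets (jumps \<mu>)" by (simp add: pred_def)
  have "integrable M (\<lambda>\<omega>. C i \<omega> * C k \<omega>) \<and> expectation (\<lambda>\<omega>. C i \<omega> * C k \<omega>) = \<tau> * pair_prob i k"
  proof (cases "i = k")
    case True
    moreover have "pair_prob k k = 1" by (simp add: pair_prob_def pU)
    ultimately show ?thesis using one[OF second(1), of i] second(2) by (simp add: power2_eq_square)
  next
    case False
    note L = colour_expectation[of "{i}" ?B "\<lambda>_ x. x\<^sup>2", OF _ B _ second(1)]
    note D = colour_expectation[of "{i, k}" "{r. \<not> linked r i k}" "\<lambda>_ x. x", OF _ Bc _ mean(1)]
    have dL: "distinct_components r {i}" for r by (simp add: distinct_components_def)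
    have dD: "distinct_components r {i, k}" if "r \<in> {r. \<not> linked r i k}" for r
      using that linked_sym by (auto simp: distinct_components_def same_component_iff_linked)
    have eq: "C i \<omega> * C k \<omega> = indicator {\<omega>\<in>space M. graph \<omega> \<in> ?B} \<omega> *\<^sub>R (\<Prod>j\<in>{i}. (C j \<omega>)\<^sup>2)
        + indicator {\<omega>\<in>space M. graph \<omega> \<in> {r. \<not> linked r i k}} \<omega> *\<^sub>R (\<Prod>j\<in>{i, k}. C j \<omega>)"
      if "\<omega> \<in> space M" for \<omega>
      using that False colour_linked[OF that, of i k] by (auto simp: indicator_def power2_eq_square)
    have int: "integrable M (\<lambda>\<omega>. C i \<omega> * C k \<omega>)"
      using L(1)[OF _ dL] D(1)[OF _ dD]
      by (subst Bochner_Integration.integrable_cong[OF refl eq]) (auto intro!: Bochner_Integration.integrable_add)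
    have "expectation (\<lambda>\<omega>. C i \<omega> * C k \<omega>) = (\<integral>\<omega>. indicator {\<omega>\<in>space M. graph \<omega> \<in> ?B} \<omega> *\<^sub>R (\<Prod>j\<in>{i}. (C j \<omega>)\<^sup>2)
        + indicator {\<omega>\<in>space M. graph \<omega> \<in> {r. \<not> linked r i k}} \<omega> *\<^sub>R (\<Prod>j\<in>{i, k}. C j \<omega>) \<partial>M)"
      by (intro Bochner_Integration.integral_cong refl eq)
    also have "\<dots> = (\<integral>\<omega>. indicator {\<omega>\<in>space M. graph \<omega> \<in> ?B} \<omega> *\<^sub>R (\<Prod>j\<in>{i}. (C j \<omega>)\<^sup>2) \<partial>M)
        + (\<integral>\<omega>. indicator {\<omega>\<in>space M. graph \<omega> \<in> {r. \<not> linked r i k}} \<omega> *\<^sub>R (\<Prod>j\<in>{i, k}. C j \<omega>) \<partial>M)"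
      by (intro Bochner_Integration.integral_add L(1) D(1) dL dD) auto
    also have "\<dots> = \<tau> * pair_prob i k"
      using L(2)[OF _ dL] D(2)[OF _ dD] False by (simp add: mean(2) second(2) pair_prob_def mult.commute)
    finally show ?thesis using int by simp
  qed
  then show "integrable M (\<lambda>\<omega>. C i \<omega> * C k \<omega>)" "expectation (\<lambda>\<omega>. C i \<omega> * C k \<omega>) = \<tau> * pair_prob i k"
    by auto
qed

text \<open>
  Condition on the pattern: given it, the sum is a sum of independent colours with the cluster weights as
  coefficients.
\<close>
lemma char_sum_eq:
  assumes S: "finite S"
  shows "expectation (\<lambda>\<omega>. iexp (\<theta> * (\<Sum>i\<in>S. b i * C i \<omega>)))
    = (\<integral>r. (\<Prod>j\<in>reps S (linked r). char \<nu> (\<theta> * cluster_weight S (linked r) b j)) \<partial>jumps \<mu>)"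
proof -
  let ?P = "Pow (S \<times> S)"
  define J where "J \<pi> = reps S (\<lambda>i j. (i, j) \<in> \<pi>)" for \<pi>
  define w where "w \<pi> j = cluster_weight S (\<lambda>i j. (i, j) \<in> \<pi>) b j" for \<pi> j
  define h where "h \<pi> = (\<Prod>j\<in>J \<pi>. char \<nu> (\<theta> * w \<pi> j))" for \<pi>
  define B where "B \<pi> = {r. pattern S r = \<pi>}" for \<pi>
  have B: "B \<pi> \<in> sets (jumps \<mu>)" for \<pi> unfolding B_def by (rule measurable_pattern[OF S])
  have finP: "finite ?P" using S by simp
  have patP: "pattern S r \<in> ?P" for r by (auto simp: pattern_def)
  have JS: "J \<pi> \<subseteq> S" for \<pi> by (auto simp: J_def reps_def)
  have fJ: "finite (J \<pi>)" for \<pi> using JS S by (rule finite_subset)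
  have rhs: "(\<Prod>j\<in>reps S (linked r). char \<nu> (\<theta> * cluster_weight S (linked r) b j)) = h (pattern S r)" for r
    unfolding h_def J_def w_def reps_pattern
    by (intro prod.cong refl) (simp add: cluster_weight_pattern reps_def)
  have "(\<integral>r. h (pattern S r) \<partial>jumps \<mu>) = (\<Sum>\<pi>\<in>?P. measure (jumps \<mu>) (B \<pi>) *\<^sub>R h \<pi>)"
    using integral_finite_pattern(2)[OF prob_space_jumps[of \<mu>] finP, where pat = "pattern S" and h = h] measurable_pattern[OF S] patP
    by (simp add: B_def)
  moreover have "expectation (\<lambda>\<omega>. iexp (\<theta> * (\<Sum>i\<in>S. b i * C i \<omega>))) = (\<Sum>\<pi>\<in>?P. measure (jumps \<mu>) (B \<pi>) *\<^sub>R h \<pi>)"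
  proof -
    let ?f = "\<lambda>\<pi> j x. iexp (\<theta> * w \<pi> j * x)"
    let ?E = "\<lambda>\<pi>. {\<omega>\<in>space M. graph \<omega> \<in> B \<pi>}"
    have fi: "integrable \<nu> (?f \<pi> j)" for \<pi> j
    proof -
      interpret \<nu>: real_distribution \<nu> by (rule \<nu>)
      show ?thesis
        by (rule \<nu>.integrable_const_bound[where B = 1])
          (auto simp: norm_exp_i_times cong: measurable_cong_sets)
    qed
    have dc: "distinct_components r (J \<pi>)" if "r \<in> B \<pi>" for r \<pi>
    proof -
      have "J \<pi> = reps S (linked r)" using that by (simp add: J_def B_def reps_pattern)
      then show ?thesis
        unfolding distinct_components_def same_component_iff_linked
        by (auto simp: reps_def dest: linked_sym)
    qed
    have eq: "iexp (\<theta> * (\<Sum>i\<in>S. b i * C i \<omega>)) = (\<Sum>\<pi>\<in>?P. indicator (?E \<pi>) \<omega> *\<^sub>R (\<Prod>j\<in>J \<pi>. ?f \<pi> j (C j \<omega>)))"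
      if \<omega>: "\<omega> \<in> space M" for \<omega>
    proof -
      let ?r = "graph \<omega>" let ?p = "pattern S (graph \<omega>)"
      have "(\<Sum>i\<in>S. b i * C i \<omega>) = (\<Sum>j\<in>reps S (linked ?r). cluster_weight S (linked ?r) b j * C j \<omega>)"
        by (rule sum_colours_clusters[OF S]) (rule colour_linked[OF \<omega>])
      also have "\<dots> = (\<Sum>j\<in>J ?p. w ?p j * C j \<omega>)"
        unfolding J_def w_def reps_pattern
        by (intro sum.cong refl) (simp add: cluster_weight_pattern reps_def)
      finally have "iexp (\<theta> * (\<Sum>i\<in>S. b i * C i \<omega>)) = (\<Prod>j\<in>J ?p. ?f ?p j (C j \<omega>))"
        using fJ[of ?p] by (simp add: sum_distrib_left mult.assoc exp_sum)
      also have "\<dots> = (\<Sum>\<pi>\<in>?P. if ?p = \<pi> then (\<Prod>j\<in>J \<pi>. ?f \<pi> j (C j \<omega>)) else 0)"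
        using finP patP[of ?r] by simp
      also have "\<dots> = (\<Sum>\<pi>\<in>?P. indicator (?E \<pi>) \<omega> *\<^sub>R (\<Prod>j\<in>J \<pi>. ?f \<pi> j (C j \<omega>)))"
        using \<omega> by (intro sum.cong) (auto simp: indicator_def B_def)
      finally show ?thesis .
    qed
    have "expectation (\<lambda>\<omega>. iexp (\<theta> * (\<Sum>i\<in>S. b i * C i \<omega>)))
        = expectation (\<lambda>\<omega>. \<Sum>\<pi>\<in>?P. indicator (?E \<pi>) \<omega> *\<^sub>R (\<Prod>j\<in>J \<pi>. ?f \<pi> j (C j \<omega>)))"
      by (intro Bochner_Integration.integral_cong refl eq)
    also have "\<dots> = (\<Sum>\<pi>\<in>?P. expectation (\<lambda>\<omega>. indicator (?E \<pi>) \<omega> *\<^sub>R (\<Prod>j\<in>J \<pi>. ?f \<pi> j (C j \<omega>))))"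
      by (intro Bochner_Integration.integral_sum colour_expectation(1) fJ B dc fi)
    also have "\<dots> = (\<Sum>\<pi>\<in>?P. measure (jumps \<mu>) (B \<pi>) *\<^sub>R (\<Prod>j\<in>J \<pi>. \<integral>x. ?f \<pi> j x \<partial>\<nu>))"
      by (intro sum.cong refl colour_expectation(2) fJ B dc fi)
    finally show ?thesis by (simp add: h_def char_def)
  qed
  ultimately show ?thesis by (simp add: rhs)
qed

end

section \<open>Approximation of the characteristic function\<close>

context heavy_tailed_jumps
begin

lemma integrable_event:
  assumes "Measurable.pred (jumps \<mu>) P"
  shows "integrable (jumps \<mu>) (\<lambda>r. of_bool (P r) :: real)"
    and "(\<integral>r. of_bool (P r) \<partial>jumps \<mu>) = measure (jumps \<mu>) {r. P r}"
proof -
  interpret J: prob_space "jumps \<mu>" by (rule prob_space_jumps)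
  have S: "{r. P r} \<in> sets (jumps \<mu>)" using assms by (simp add: pred_def)
  have eq: "of_bool (P r) = (indicator {r. P r} r :: real)" for r by (simp add: indicator_def)
  show "integrable (jumps \<mu>) (\<lambda>r. of_bool (P r) :: real)"
    unfolding eq using S by (simp add: J.emeasure_eq_measure)
  show "(\<integral>r. of_bool (P r) \<partial>jumps \<mu>) = measure (jumps \<mu>) {r. P r}"
    unfolding eq using S by simp
qed

lemmas integrable_linked = integrable_event[OF measurable_linked, folded pair_prob_def]

definition quad_sum :: "int set \<Rightarrow> real" where
  "quad_sum S = (\<Sum>i\<in>S. \<Sum>j\<in>S. \<Sum>k\<in>S. \<Sum>l\<in>S. quad_prob i j k l)"

lemma quad_prob_nonneg: "0 \<le> quad_prob i j k l"
  by (simp add: quad_prob_def)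

lemma (in -) expectation_abs_le_sqrt:
  fixes W :: "'x \<Rightarrow> real"
  assumes "prob_space P" "integrable P W" "integrable P (\<lambda>x. (W x)\<^sup>2)"
  shows "(\<integral>x. \<bar>W x\<bar> \<partial>P) \<le> sqrt (\<integral>x. (W x)\<^sup>2 \<partial>P)"
proof -
  interpret prob_space P by fact
  have "0 \<le> variance (\<lambda>x. \<bar>W x\<bar>)" by (rule variance_positive)
  also have "variance (\<lambda>x. \<bar>W x\<bar>) = expectation (\<lambda>x. \<bar>W x\<bar>\<^sup>2) - (expectation (\<lambda>x. \<bar>W x\<bar>))\<^sup>2"
    using assms by (intro variance_eq) auto
  finally show ?thesis by (intro real_le_rsqrt) simp
qed

text \<open>
  By \<open>two_pairs_prob\<close>, the variance of the number of connected pairs is at most the expected number of connected quadruples.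
  Only an upper bound on the covariances is available, which is why this is stated for sums without signs.
\<close>
lemma linked_pairs_concentrate:
  assumes S: "finite S" "S1 \<subseteq> S" "S2 \<subseteq> S"
  shows "(\<integral>r. \<bar>(\<Sum>i\<in>S1. \<Sum>j\<in>S2. of_bool (linked r i j)) - (\<Sum>i\<in>S1. \<Sum>j\<in>S2. pair_prob i j)\<bar> \<partial>jumps \<mu>)
    \<le> sqrt (quad_sum S)"
proof -
  interpret J: prob_space "jumps \<mu>" by (rule prob_space_jumps)
  define X where "X r = (\<Sum>i\<in>S1. \<Sum>j\<in>S2. of_bool (linked r i j) :: real)" for r
  define m where "m = (\<Sum>i\<in>S1. \<Sum>j\<in>S2. pair_prob i j)"
  have Xi: "integrable (jumps \<mu>) X" unfolding X_def[abs_def]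
    by (intro Bochner_Integration.integrable_sum integrable_linked)
  have XE: "J.expectation X = m" unfolding X_def[abs_def] m_def
    by (subst Bochner_Integration.integral_sum; (intro Bochner_Integration.integrable_sum integrable_linked)?)
       (simp add: Bochner_Integration.integral_sum integrable_linked)
  have X2: "(X r)\<^sup>2 = (\<Sum>i\<in>S1. \<Sum>k\<in>S1. \<Sum>j\<in>S2. \<Sum>l\<in>S2. of_bool (linked r i j \<and> linked r k l))" for r
    unfolding X_def power2_eq_square sum_product of_bool_conj ..
  have ev: "integrable (jumps \<mu>) (\<lambda>r. of_bool (linked r i j \<and> linked r k l) :: real)"
    "J.expectation (\<lambda>r. of_bool (linked r i j \<and> linked r k l)) = measure (jumps \<mu>) {r. linked r i j \<and> linked r k l}" for i j k l
    by (rule integrable_event, measurable)+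
  have X2i: "integrable (jumps \<mu>) (\<lambda>r. (X r)\<^sup>2)" unfolding X2
    by (intro Bochner_Integration.integrable_sum ev)
  have "J.expectation (\<lambda>r. (X r)\<^sup>2)
      = (\<Sum>i\<in>S1. \<Sum>k\<in>S1. \<Sum>j\<in>S2. \<Sum>l\<in>S2. measure (jumps \<mu>) {r. linked r i j \<and> linked r k l})"
    unfolding X2 by (simp add: Bochner_Integration.integral_sum ev)
  also have "\<dots> \<le> (\<Sum>i\<in>S1. \<Sum>k\<in>S1. \<Sum>j\<in>S2. \<Sum>l\<in>S2. pair_prob i j * pair_prob k l + quad_prob i j k l)"
    by (intro sum_mono two_pairs_prob)
  also have "\<dots> = m\<^sup>2 + (\<Sum>i\<in>S1. \<Sum>k\<in>S1. \<Sum>j\<in>S2. \<Sum>l\<in>S2. quad_prob i j k l)"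
    unfolding m_def power2_eq_square sum_product by (simp only: sum.distrib)
  also have "(\<Sum>i\<in>S1. \<Sum>k\<in>S1. \<Sum>j\<in>S2. \<Sum>l\<in>S2. quad_prob i j k l)
      \<le> (\<Sum>i\<in>S. \<Sum>k\<in>S. \<Sum>j\<in>S. \<Sum>l\<in>S. quad_prob i j k l)"
  proof -
    have up: "(\<Sum>x\<in>A. f x) \<le> (\<Sum>x\<in>S. g x)" if "A \<subseteq> S" "\<And>x. f x \<le> g x" "\<And>x. 0 \<le> g x" for A and f g :: "int \<Rightarrow> real"
    proof -
      have "(\<Sum>x\<in>A. f x) \<le> (\<Sum>x\<in>A. g x)" by (intro sum_mono that)
      also have "\<dots> \<le> (\<Sum>x\<in>S. g x)" using that S(1) by (intro sum_mono2) auto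
      finally show ?thesis .
    qed
    show ?thesis by (intro up S sum_nonneg quad_prob_nonneg order_refl)
  qed
  also have "\<dots> = quad_sum S"
    unfolding quad_sum_def by (intro sum.cong refl sum.swap)
  finally have "J.expectation (\<lambda>r. (X r)\<^sup>2) - m\<^sup>2 \<le> quad_sum S" by simp
  moreover have "J.variance X = J.expectation (\<lambda>r. (X r)\<^sup>2) - m\<^sup>2"
    using J.variance_eq[OF Xi X2i] by (simp add: XE)
  ultimately have v: "J.expectation (\<lambda>r. (X r - m)\<^sup>2) \<le> quad_sum S" by (simp add: XE)
  have "J.expectation (\<lambda>r. \<bar>X r - m\<bar>) \<le> sqrt (J.expectation (\<lambda>r. (X r - m)\<^sup>2))"
  proof (rule expectation_abs_le_sqrt[OF J.prob_space_axioms])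
    show "integrable (jumps \<mu>) (\<lambda>r. X r - m)" using Xi by simp
    show "integrable (jumps \<mu>) (\<lambda>r. (X r - m)\<^sup>2)"
      using Xi X2i by (simp add: power2_diff)
  qed
  also have "\<dots> \<le> sqrt (quad_sum S)" using v by simp
  finally show ?thesis by (simp add: X_def m_def)
qed

definition step_fun :: "'g set \<Rightarrow> ('g \<Rightarrow> real) \<Rightarrow> ('g \<Rightarrow> int set) \<Rightarrow> int \<Rightarrow> real" where
  "step_fun G \<beta> T i = (\<Sum>g\<in>G. \<beta> g * of_bool (i \<in> T g))"

definition pair_form :: "int set \<Rightarrow> (int \<Rightarrow> real) \<Rightarrow> real" where
  "pair_form S b = (\<Sum>i\<in>S. \<Sum>k\<in>S. b i * b k * pair_prob i k)"

lemma sum_step_fun_pairs: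
  fixes p :: "int \<Rightarrow> int \<Rightarrow> real"
  assumes S: "finite S" "\<And>g. g \<in> G \<Longrightarrow> T g \<subseteq> S"
  shows "(\<Sum>i\<in>S. \<Sum>k\<in>S. step_fun G \<beta> T i * step_fun G \<beta> T k * p i k)
    = (\<Sum>g\<in>G. \<Sum>h\<in>G. \<beta> g * \<beta> h * (\<Sum>i\<in>T g. \<Sum>k\<in>T h. p i k))"
proof -
  have "(\<Sum>i\<in>S. \<Sum>k\<in>S. step_fun G \<beta> T i * step_fun G \<beta> T k * p i k)
      = (\<Sum>i\<in>S. \<Sum>k\<in>S. \<Sum>g\<in>G. \<Sum>h\<in>G. \<beta> g * \<beta> h * (of_bool (i \<in> T g) * of_bool (k \<in> T h) * p i k))"
    unfolding step_fun_def sum_product unfolding sum_distrib_right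
    by (intro sum.cong refl) (simp only: mult_ac)
  also have "\<dots> = (\<Sum>i\<in>S. \<Sum>g\<in>G. \<Sum>k\<in>S. \<Sum>h\<in>G. \<beta> g * \<beta> h * (of_bool (i \<in> T g) * of_bool (k \<in> T h) * p i k))"
    by (intro sum.cong refl sum.swap)
  also have "\<dots> = (\<Sum>g\<in>G. \<Sum>i\<in>S. \<Sum>k\<in>S. \<Sum>h\<in>G. \<beta> g * \<beta> h * (of_bool (i \<in> T g) * of_bool (k \<in> T h) * p i k))"
    by (rule sum.swap)
  also have "\<dots> = (\<Sum>g\<in>G. \<Sum>i\<in>S. \<Sum>h\<in>G. \<Sum>k\<in>S. \<beta> g * \<beta> h * (of_bool (i \<in> T g) * of_bool (k \<in> T h) * p i k))"
    by (intro sum.cong refl sum.swap)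
  also have "\<dots> = (\<Sum>g\<in>G. \<Sum>h\<in>G. \<Sum>i\<in>S. \<Sum>k\<in>S. \<beta> g * \<beta> h * (of_bool (i \<in> T g) * of_bool (k \<in> T h) * p i k))"
    by (intro sum.cong refl sum.swap)
  also have "\<dots> = (\<Sum>g\<in>G. \<Sum>h\<in>G. \<beta> g * \<beta> h * (\<Sum>i\<in>T g. \<Sum>k\<in>T h. p i k))"
  proof (intro sum.cong refl)
    fix g h assume g: "g \<in> G" and h: "h \<in> G"
    have restr: "(\<Sum>i\<in>S. of_bool (i \<in> T g) * f i) = (\<Sum>i\<in>T g. f i)" if "g \<in> G" for g and f :: "int \<Rightarrow> real"
      using S that by (intro sum.mono_neutral_cong_right) auto
    have "(\<Sum>i\<in>S. \<Sum>k\<in>S. \<beta> g * \<beta> h * (of_bool (i \<in> T g) * of_bool (k \<in> T h) * p i k))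
        = \<beta> g * \<beta> h * (\<Sum>i\<in>S. of_bool (i \<in> T g) * (\<Sum>k\<in>S. of_bool (k \<in> T h) * p i k))"
      by (simp add: sum_distrib_left mult.assoc)
    then show "(\<Sum>i\<in>S. \<Sum>k\<in>S. \<beta> g * \<beta> h * (of_bool (i \<in> T g) * of_bool (k \<in> T h) * p i k))
        = \<beta> g * \<beta> h * (\<Sum>i\<in>T g. \<Sum>k\<in>T h. p i k)"
      by (simp only: restr[OF g] restr[OF h])
  qed
  finally show ?thesis .
qed

text \<open>
  Expand the step function into indicators, to reduce the signed form to \<open>linked_pairs_concentrate\<close>.
\<close>
lemma cluster_energy_concentrates:
  fixes \<beta> :: "'g \<Rightarrow> real"
  assumes S: "finite S" "\<And>g. g \<in> G \<Longrightarrow> T g \<subseteq> S"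
  defines "b \<equiv> step_fun G \<beta> T"
  shows "integrable (jumps \<mu>) (\<lambda>r. \<Sum>i\<in>S. \<Sum>k\<in>S. b i * b k * of_bool (linked r i k))"
    and "(\<integral>r. (\<Sum>i\<in>S. \<Sum>k\<in>S. b i * b k * of_bool (linked r i k)) \<partial>jumps \<mu>) = pair_form S b"
    and "(\<integral>r. \<bar>(\<Sum>i\<in>S. \<Sum>k\<in>S. b i * b k * of_bool (linked r i k)) - pair_form S b\<bar> \<partial>jumps \<mu>)
      \<le> (\<Sum>g\<in>G. \<bar>\<beta> g\<bar>)\<^sup>2 * sqrt (quad_sum S)"
proof -
  interpret J: prob_space "jumps \<mu>" by (rule prob_space_jumps)
  show int: "integrable (jumps \<mu>) (\<lambda>r. \<Sum>i\<in>S. \<Sum>k\<in>S. b i * b k * of_bool (linked r i k))"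
    by (intro Bochner_Integration.integrable_sum integrable_mult_right integrable_linked)
  show "(\<integral>r. (\<Sum>i\<in>S. \<Sum>k\<in>S. b i * b k * of_bool (linked r i k)) \<partial>jumps \<mu>) = pair_form S b"
    by (simp add: pair_form_def Bochner_Integration.integral_sum Bochner_Integration.integrable_sum integrable_linked)
  define X where "X g h r = (\<Sum>i\<in>T g. \<Sum>k\<in>T h. of_bool (linked r i k)) - (\<Sum>i\<in>T g. \<Sum>k\<in>T h. pair_prob i k)" for g h r
  have Xi: "integrable (jumps \<mu>) (X g h)" for g h
    unfolding X_def[abs_def]
    by (intro Bochner_Integration.integrable_diff Bochner_Integration.integrable_sum integrable_linked J.integrable_const)
  have eq: "(\<Sum>i\<in>S. \<Sum>k\<in>S. b i * b k * of_bool (linked r i k)) - pair_form S b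
      = (\<Sum>g\<in>G. \<Sum>h\<in>G. \<beta> g * \<beta> h * X g h r)" for r
  proof -
    have "(\<Sum>i\<in>S. \<Sum>k\<in>S. b i * b k * of_bool (linked r i k))
        = (\<Sum>g\<in>G. \<Sum>h\<in>G. \<beta> g * \<beta> h * (\<Sum>i\<in>T g. \<Sum>k\<in>T h. of_bool (linked r i k)))"
      unfolding b_def by (rule sum_step_fun_pairs[OF S])
    moreover have "pair_form S b = (\<Sum>g\<in>G. \<Sum>h\<in>G. \<beta> g * \<beta> h * (\<Sum>i\<in>T g. \<Sum>k\<in>T h. pair_prob i k))"
      unfolding b_def pair_form_def by (rule sum_step_fun_pairs[OF S])
    ultimately show ?thesis by (simp only: X_def right_diff_distrib sum_subtractf)
  qed
  have "(\<integral>r. \<bar>(\<Sum>i\<in>S. \<Sum>k\<in>S. b i * b k * of_bool (linked r i k)) - pair_form S b\<bar> \<partial>jumps \<mu>)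
      \<le> (\<integral>r. (\<Sum>g\<in>G. \<Sum>h\<in>G. \<bar>\<beta> g\<bar> * \<bar>\<beta> h\<bar> * \<bar>X g h r\<bar>) \<partial>jumps \<mu>)"
  proof (rule integral_mono)
    show "integrable (jumps \<mu>) (\<lambda>r. \<bar>(\<Sum>i\<in>S. \<Sum>k\<in>S. b i * b k * of_bool (linked r i k)) - pair_form S b\<bar>)"
      using int by simp
    show "integrable (jumps \<mu>) (\<lambda>r. \<Sum>g\<in>G. \<Sum>h\<in>G. \<bar>\<beta> g\<bar> * \<bar>\<beta> h\<bar> * \<bar>X g h r\<bar>)"
      by (intro Bochner_Integration.integrable_sum integrable_mult_right integrable_abs Xi)
    show "\<bar>(\<Sum>i\<in>S. \<Sum>k\<in>S. b i * b k * of_bool (linked r i k)) - pair_form S b\<bar>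
        \<le> (\<Sum>g\<in>G. \<Sum>h\<in>G. \<bar>\<beta> g\<bar> * \<bar>\<beta> h\<bar> * \<bar>X g h r\<bar>)" for r
      unfolding eq by (intro order_trans[OF sum_abs] sum_mono) (simp add: abs_mult)
  qed
  also have "\<dots> = (\<Sum>g\<in>G. \<Sum>h\<in>G. \<bar>\<beta> g\<bar> * \<bar>\<beta> h\<bar> * (\<integral>r. \<bar>X g h r\<bar> \<partial>jumps \<mu>))"
    by (simp add: Bochner_Integration.integral_sum Bochner_Integration.integrable_sum Xi)
  also have "\<dots> \<le> (\<Sum>g\<in>G. \<Sum>h\<in>G. \<bar>\<beta> g\<bar> * \<bar>\<beta> h\<bar> * sqrt (quad_sum S))"
    unfolding X_def by (intro sum_mono mult_left_mono linked_pairs_concentrate S) auto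
  also have "\<dots> = (\<Sum>g\<in>G. \<bar>\<beta> g\<bar>)\<^sup>2 * sqrt (quad_sum S)"
    unfolding power2_eq_square sum_product unfolding sum_distrib_right ..
  finally show "(\<integral>r. \<bar>(\<Sum>i\<in>S. \<Sum>k\<in>S. b i * b k * of_bool (linked r i k)) - pair_form S b\<bar> \<partial>jumps \<mu>)
      \<le> (\<Sum>g\<in>G. \<bar>\<beta> g\<bar>)\<^sup>2 * sqrt (quad_sum S)" .
qed

lemma quad_sum_nonneg: "0 \<le> quad_sum S"
  unfolding quad_sum_def by (intro sum_nonneg quad_prob_nonneg)

lemma quad_sum_expectation:
  "integrable (jumps \<mu>) (\<lambda>r. \<Sum>i\<in>S. \<Sum>j\<in>S. \<Sum>k\<in>S. \<Sum>l\<in>S. of_bool (linked r i j \<and> linked r i k \<and> linked r i l) :: real)"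
  "(\<integral>r. (\<Sum>i\<in>S. \<Sum>j\<in>S. \<Sum>k\<in>S. \<Sum>l\<in>S. of_bool (linked r i j \<and> linked r i k \<and> linked r i l)) \<partial>jumps \<mu>) = quad_sum S"
proof -
  have ev: "integrable (jumps \<mu>) (\<lambda>r. of_bool (linked r i j \<and> linked r i k \<and> linked r i l) :: real)"
    "(\<integral>r. of_bool (linked r i j \<and> linked r i k \<and> linked r i l) \<partial>jumps \<mu>) = quad_prob i j k l" for i j k l
    unfolding quad_prob_def by (rule integrable_event, measurable)+
  show "integrable (jumps \<mu>) (\<lambda>r. \<Sum>i\<in>S. \<Sum>j\<in>S. \<Sum>k\<in>S. \<Sum>l\<in>S. of_bool (linked r i j \<and> linked r i k \<and> linked r i l) :: real)"
    by (intro Bochner_Integration.integrable_sum ev)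
  show "(\<integral>r. (\<Sum>i\<in>S. \<Sum>j\<in>S. \<Sum>k\<in>S. \<Sum>l\<in>S. of_bool (linked r i j \<and> linked r i k \<and> linked r i l)) \<partial>jumps \<mu>) = quad_sum S"
    unfolding quad_sum_def
    by (simp add: Bochner_Integration.integral_sum Bochner_Integration.integrable_sum ev del: of_bool_conj)
qed

end

context coloured_urn
begin

lemma cubic_le:
  fixes x \<delta> :: real
  assumes "0 < \<delta>"
  shows "\<bar>x\<bar> ^ 3 \<le> \<delta> * x\<^sup>2 + x ^ 4 / \<delta>"
proof -
  have "0 \<le> x\<^sup>2 * ((\<bar>x\<bar> - \<delta>)\<^sup>2 + \<delta> * \<bar>x\<bar>)" using assms by (intro mult_nonneg_nonneg add_nonneg_nonneg) auto
  also have "\<dots> = x\<^sup>2 * \<bar>x\<bar>\<^sup>2 - \<delta> * (x\<^sup>2 * \<bar>x\<bar>) + \<delta> * \<delta> * x\<^sup>2"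
    by (simp add: power2_diff algebra_simps) (simp add: power2_eq_square)
  also have "x\<^sup>2 * \<bar>x\<bar>\<^sup>2 = x ^ 4" by (simp add: power2_eq_square power4_eq_xxxx)
  also have "x\<^sup>2 * \<bar>x\<bar> = \<bar>x\<bar> ^ 3"
    unfolding power2_abs[symmetric, of x] by (simp add: power3_eq_cube power2_eq_square)
  finally have "\<delta> * \<bar>x\<bar> ^ 3 \<le> \<delta> * (\<delta> * x\<^sup>2 + x ^ 4 / \<delta>)" using assms by (simp add: algebra_simps)
  then show ?thesis using assms by simp
qed

text \<open>
  With \<open>Z\<close> the sum of the squared cluster weights, given the graph the characteristic function is a product over the
  clusters. Replacing every factor by the Gaussian one costs a sum of third powers of the weights, which \<open>cubic_le\<close>
  splits into second and fourth powers. The remaining factor \<open>exp (- (\<tau> * \<theta>\<^sup>2 * Z / 2))\<close> is compared with its value at the mean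
  of \<open>Z\<close>. The number \<open>\<delta>\<close> bounds the relative fluctuation and serves in \<open>cubic_le\<close> as well, which makes the whole error
  linear in \<open>\<delta>\<close>.
\<close>
lemma char_estimate:
  fixes \<beta> :: "'g \<Rightarrow> real"
  assumes S: "finite S" "\<And>g. g \<in> G \<Longrightarrow> T g \<subseteq> S"
  defines "b \<equiv> step_fun G \<beta> T" and "B \<equiv> (\<Sum>g\<in>G. \<bar>\<beta> g\<bar>)"
  assumes m: "0 < pair_form S b" and \<delta>: "0 < \<delta>" "sqrt (quad_sum S) \<le> \<delta> * pair_form S b"
  shows "cmod (expectation (\<lambda>\<omega>. iexp (s / sqrt (\<tau> * pair_form S b) * (\<Sum>i\<in>S. b i * C i \<omega>))) - of_real (exp (- (s\<^sup>2 / 2))))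
    \<le> (K3 * (s\<^sup>2 / \<tau> + s ^ 4 * B ^ 4 / \<tau>\<^sup>2) + s\<^sup>2 * B\<^sup>2 / 2) * \<delta>"
proof -
  interpret J: prob_space "jumps \<mu>" by (rule prob_space_jumps)
  interpret \<nu>: real_distribution \<nu> by (rule \<nu>)
  define m where "m = pair_form S b"
  have m0: "0 < m" using assms(5) by (simp add: m_def)
  define \<theta> where "\<theta> = s / sqrt (\<tau> * m)"
  have \<theta>2: "\<theta>\<^sup>2 * m = s\<^sup>2 / \<tau>" using m0 \<tau>_pos by (simp add: \<theta>_def power_divide)
  have \<theta>4: "\<theta> ^ 4 * m\<^sup>2 = s ^ 4 / \<tau>\<^sup>2"
  proof -
    have "\<theta> ^ 4 * m\<^sup>2 = (\<theta>\<^sup>2 * m)\<^sup>2" by (simp add: power_mult_distrib flip: power_mult)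
    then show ?thesis by (simp add: \<theta>2 power_divide flip: power_mult)
  qed
  define F where "F = quad_sum S"
  have F0: "0 \<le> F" unfolding F_def by (rule quad_sum_nonneg)
  have sF: "sqrt F \<le> \<delta> * m" using \<delta> by (simp add: F_def m_def)
  have F2: "F \<le> \<delta>\<^sup>2 * m\<^sup>2" using power_mono[OF sF, of 2] F0 by (simp add: power_mult_distrib)
  define Z where "Z r = (\<Sum>i\<in>S. \<Sum>k\<in>S. b i * b k * of_bool (linked r i k))" for r
  define N4 where "N4 r = (\<Sum>i\<in>S. \<Sum>j\<in>S. \<Sum>k\<in>S. \<Sum>l\<in>S. of_bool (linked r i j \<and> linked r i k \<and> linked r i l) :: real)" for r
  have Zi: "integrable (jumps \<mu>) Z" and ZE: "J.expectation Z = m"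
    and ZV: "J.expectation (\<lambda>r. \<bar>Z r - m\<bar>) \<le> B\<^sup>2 * sqrt F"
    using cluster_energy_concentrates[where \<beta> = \<beta> and G = G and T = T and S = S] S unfolding Z_def m_def b_def B_def F_def by blast+
  have N4i: "integrable (jumps \<mu>) N4" and N4E: "J.expectation N4 = F"
    using quad_sum_expectation[of S] by (simp_all add: N4_def[abs_def] F_def del: of_bool_conj)
  define Jr where "Jr r = reps S (linked r)" for r
  define w where "w r j = cluster_weight S (linked r) b j" for r j
  have fJ: "finite (Jr r)" for r unfolding Jr_def by (rule finite_reps[OF S(1)])
  have Zw: "(\<Sum>j\<in>Jr r. (w r j)\<^sup>2) = Z r" for r
    unfolding Jr_def w_def Z_def by (rule sum_squares_clusters[OF S(1)])
  have Z0: "0 \<le> Z r" for r unfolding Zw[symmetric] by (intro sum_nonneg) auto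
  have bB: "\<bar>b i\<bar> \<le> B" for i
    unfolding b_def B_def step_fun_def by (rule order_trans[OF sum_abs]) (auto intro!: sum_mono simp: abs_mult)
  have w4: "(\<Sum>j\<in>Jr r. (w r j) ^ 4) \<le> B ^ 4 * N4 r" for r
  proof -
    have "\<bar>w r j\<bar> \<le> B * cluster_weight S (linked r) (\<lambda>_. 1) j" for j
      unfolding w_def cluster_weight_def sum_distrib_left
      by (rule order_trans[OF sum_abs]) (intro sum_mono, simp add: bB)
    then have "\<bar>w r j\<bar> ^ 4 \<le> (B * cluster_weight S (linked r) (\<lambda>_. 1) j) ^ 4" for j
      by (intro power_mono) auto
    then have "(\<Sum>j\<in>Jr r. (w r j) ^ 4) \<le> (\<Sum>j\<in>Jr r. B ^ 4 * (cluster_weight S (linked r) (\<lambda>_. 1) j) ^ 4)"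
      by (intro sum_mono) (simp add: power_mult_distrib)
    also have "\<dots> = B ^ 4 * N4 r"
      unfolding sum_distrib_left[symmetric] Jr_def N4_def by (subst sum_fourth_clusters[OF S(1)]) (rule refl)
    finally show ?thesis .
  qed
  define \<Psi> where "\<Psi> r = (\<Prod>j\<in>Jr r. char \<nu> (\<theta> * w r j))" for r
  have \<Psi>m: "integrable (jumps \<mu>) \<Psi>"
  proof -
    define h where "h \<pi> = (\<Prod>j\<in>reps S (\<lambda>i j. (i, j) \<in> \<pi>). char \<nu> (\<theta> * cluster_weight S (\<lambda>i j. (i, j) \<in> \<pi>) b j))" for \<pi>
    have eq: "\<Psi> = (\<lambda>r. h (pattern S r))"
      unfolding \<Psi>_def Jr_def w_def reps_pattern h_def
      by (intro ext prod.cong refl) (simp add: cluster_weight_pattern reps_def)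
    show ?thesis unfolding eq
    proof (rule integral_finite_pattern(1)[OF J.prob_space_axioms, where U = "Pow (S \<times> S)"])
      show "finite (Pow (S \<times> S))" using S by simp
      show "{r \<in> space (jumps \<mu>). pattern S r = \<pi>} \<in> sets (jumps \<mu>)" for \<pi> using measurable_pattern[OF S(1)] by simp
    qed (auto simp: pattern_def)
  qed
  have pw: "cmod (\<Psi> r - of_real (exp (- (s\<^sup>2 / 2))))
      \<le> K3 * (\<delta> * \<theta>\<^sup>2 * Z r + \<theta> ^ 4 * (B ^ 4 * N4 r) / \<delta>) + \<tau> * \<theta>\<^sup>2 / 2 * \<bar>Z r - m\<bar>" for r
  proof -
    define g where "g j = complex_of_real (exp (- (\<tau> * (\<theta> * w r j)\<^sup>2 / 2)))" for j
    have gprod: "(\<Prod>j\<in>Jr r. g j) = of_real (exp (- (\<tau> * \<theta>\<^sup>2 / 2 * Z r)))"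
    proof -
      have "(\<Prod>j\<in>Jr r. exp (- (\<tau> * (\<theta> * w r j)\<^sup>2 / 2))) = exp (\<Sum>j\<in>Jr r. - (\<tau> * (\<theta> * w r j)\<^sup>2 / 2))"
        using fJ by (rule exp_sum[symmetric])
      also have "(\<Sum>j\<in>Jr r. - (\<tau> * (\<theta> * w r j)\<^sup>2 / 2)) = - (\<tau> * \<theta>\<^sup>2 / 2 * Z r)"
        unfolding Zw[symmetric] sum_distrib_left sum_negf[symmetric]
        by (intro sum.cong refl) (simp add: power_mult_distrib)
      finally show ?thesis unfolding g_def of_real_prod[symmetric] by (simp only:)
    qed
    have "cmod (\<Psi> r - (\<Prod>j\<in>Jr r. g j)) \<le> (\<Sum>j\<in>Jr r. cmod (char \<nu> (\<theta> * w r j) - g j))"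
      unfolding \<Psi>_def
      by (rule norm_prod_diff) (use \<tau>_pos in \<open>auto simp: g_def intro: \<nu>.cmod_char_le_1\<close>)
    also have "\<dots> \<le> (\<Sum>j\<in>Jr r. K3 * (\<delta> * (\<theta> * w r j)\<^sup>2 + (\<theta> * w r j) ^ 4 / \<delta>))"
    proof (rule sum_mono)
      fix j
      have "cmod (char \<nu> (\<theta> * w r j) - g j) \<le> K3 * \<bar>\<theta> * w r j\<bar> ^ 3" unfolding g_def by (rule K3(2))
      also have "\<dots> \<le> K3 * (\<delta> * (\<theta> * w r j)\<^sup>2 + (\<theta> * w r j) ^ 4 / \<delta>)"
        by (intro mult_left_mono cubic_le \<delta>(1) K3(1))
      finally show "cmod (char \<nu> (\<theta> * w r j) - g j) \<le> K3 * (\<delta> * (\<theta> * w r j)\<^sup>2 + (\<theta> * w r j) ^ 4 / \<delta>)" .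
    qed
    also have "\<dots> = K3 * (\<delta> * \<theta>\<^sup>2 * Z r + \<theta> ^ 4 * (\<Sum>j\<in>Jr r. (w r j) ^ 4) / \<delta>)"
      unfolding Zw[symmetric]
      by (simp add: sum_distrib_left sum_divide_distrib sum.distrib power_mult_distrib distrib_left mult.assoc)
    also have "\<dots> \<le> K3 * (\<delta> * \<theta>\<^sup>2 * Z r + \<theta> ^ 4 * (B ^ 4 * N4 r) / \<delta>)"
      using K3(1) \<delta>(1) w4 by (intro mult_left_mono add_left_mono divide_right_mono) auto
    finally have 1: "cmod (\<Psi> r - (\<Prod>j\<in>Jr r. g j)) \<le> K3 * (\<delta> * \<theta>\<^sup>2 * Z r + \<theta> ^ 4 * (B ^ 4 * N4 r) / \<delta>)" .
    have expd: "\<bar>exp (- x) - exp (- y)\<bar> \<le> \<bar>x - y\<bar>" if "0 \<le> x" "0 \<le> y" for x y :: real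
    proof -
      have *: "exp (- x) - exp (- y) \<le> y - x" if "0 \<le> x" "x \<le> y" for x y :: real
      proof -
        have "1 - (y - x) \<le> exp (- (y - x))" using exp_ge_add_one_self[of "- (y - x)"] by linarith
        then have "exp (- x) * (1 - exp (- (y - x))) \<le> 1 * (y - x)"
          using that by (intro mult_mono) auto
        moreover have "exp (- x) * exp (- (y - x)) = exp (- y)" by (simp flip: exp_add)
        ultimately show ?thesis by (simp add: right_diff_distrib)
      qed
      show ?thesis using *[of x y] *[of y x] that by (cases "x \<le> y") (auto simp: abs_real_def)
    qed
    have s2: "s\<^sup>2 / 2 = \<tau> * \<theta>\<^sup>2 / 2 * m" using \<theta>2 \<tau>_pos by (simp add: field_simps)
    have "\<bar>exp (- (\<tau> * \<theta>\<^sup>2 / 2 * Z r)) - exp (- (s\<^sup>2 / 2))\<bar> \<le> \<bar>\<tau> * \<theta>\<^sup>2 / 2 * Z r - \<tau> * \<theta>\<^sup>2 / 2 * m\<bar>"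
      unfolding s2 using Z0[of r] \<tau>_pos m0 by (intro expd mult_nonneg_nonneg) auto
    also have "\<dots> = \<tau> * \<theta>\<^sup>2 / 2 * \<bar>Z r - m\<bar>"
      unfolding right_diff_distrib[symmetric] abs_mult using \<tau>_pos by simp
    finally have 2: "cmod ((\<Prod>j\<in>Jr r. g j) - of_real (exp (- (s\<^sup>2 / 2)))) \<le> \<tau> * \<theta>\<^sup>2 / 2 * \<bar>Z r - m\<bar>"
      unfolding gprod of_real_diff[symmetric] norm_of_real .
    have "cmod (\<Psi> r - of_real (exp (- (s\<^sup>2 / 2)))) \<le> cmod (\<Psi> r - (\<Prod>j\<in>Jr r. g j)) + cmod ((\<Prod>j\<in>Jr r. g j) - of_real (exp (- (s\<^sup>2 / 2))))"
      using norm_triangle_ineq[of "\<Psi> r - (\<Prod>j\<in>Jr r. g j)" "(\<Prod>j\<in>Jr r. g j) - of_real (exp (- (s\<^sup>2 / 2)))"] by simp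
    also have "\<dots> \<le> K3 * (\<delta> * \<theta>\<^sup>2 * Z r + \<theta> ^ 4 * (B ^ 4 * N4 r) / \<delta>) + \<tau> * \<theta>\<^sup>2 / 2 * \<bar>Z r - m\<bar>"
      by (rule add_mono[OF 1 2])
    finally show ?thesis .
  qed
  have eqE: "expectation (\<lambda>\<omega>. iexp (\<theta> * (\<Sum>i\<in>S. b i * C i \<omega>))) = J.expectation \<Psi>"
    unfolding \<Psi>_def[abs_def] Jr_def w_def by (rule char_sum_eq[OF S(1)])
  have "cmod (J.expectation \<Psi> - of_real (exp (- (s\<^sup>2 / 2)))) = cmod (J.expectation (\<lambda>r. \<Psi> r - of_real (exp (- (s\<^sup>2 / 2)))))"
    using \<Psi>m J.prob_space by simp
  also have "\<dots> \<le> J.expectation (\<lambda>r. cmod (\<Psi> r - of_real (exp (- (s\<^sup>2 / 2)))))"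
    by (rule integral_norm_bound)
  also have "\<dots> \<le> J.expectation (\<lambda>r. K3 * (\<delta> * \<theta>\<^sup>2 * Z r + \<theta> ^ 4 * (B ^ 4 * N4 r) / \<delta>) + \<tau> * \<theta>\<^sup>2 / 2 * \<bar>Z r - m\<bar>)"
  proof (rule integral_mono[OF _ _ pw])
    show "integrable (jumps \<mu>) (\<lambda>r. cmod (\<Psi> r - of_real (exp (- (s\<^sup>2 / 2)))))"
      using \<Psi>m by (intro integrable_norm Bochner_Integration.integrable_diff) auto
    show "integrable (jumps \<mu>) (\<lambda>r. K3 * (\<delta> * \<theta>\<^sup>2 * Z r + \<theta> ^ 4 * (B ^ 4 * N4 r) / \<delta>) + \<tau> * \<theta>\<^sup>2 / 2 * \<bar>Z r - m\<bar>)"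
      using Zi N4i by auto
  qed
  also have "\<dots> = K3 * (\<delta> * \<theta>\<^sup>2 * m + \<theta> ^ 4 * (B ^ 4 * F) / \<delta>) + \<tau> * \<theta>\<^sup>2 / 2 * J.expectation (\<lambda>r. \<bar>Z r - m\<bar>)"
    using Zi N4i by (simp add: ZE N4E)
  also have "\<dots> \<le> K3 * (\<delta> * \<theta>\<^sup>2 * m + \<theta> ^ 4 * (B ^ 4 * (\<delta>\<^sup>2 * m\<^sup>2)) / \<delta>) + \<tau> * \<theta>\<^sup>2 / 2 * (B\<^sup>2 * (\<delta> * m))"
  proof (intro add_mono mult_left_mono divide_right_mono order_refl F2)
    show "J.expectation (\<lambda>r. \<bar>Z r - m\<bar>) \<le> B\<^sup>2 * (\<delta> * m)"
      by (rule order_trans[OF ZV]) (intro mult_left_mono sF, simp)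
  qed (use K3(1) \<delta>(1) \<tau>_pos in auto)
  also have "\<dots> = (K3 * (\<theta>\<^sup>2 * m + (\<theta> ^ 4 * m\<^sup>2) * B ^ 4) + \<tau> * (\<theta>\<^sup>2 * m) * B\<^sup>2 / 2) * \<delta>"
    using \<delta>(1) by (simp add: field_simps power2_eq_square)
  also have "\<dots> = (K3 * (s\<^sup>2 / \<tau> + s ^ 4 * B ^ 4 / \<tau>\<^sup>2) + s\<^sup>2 * B\<^sup>2 / 2) * \<delta>"
    unfolding \<theta>2 \<theta>4 using \<tau>_pos by simp
  finally show ?thesis unfolding eqE[symmetric] \<theta>_def m_def .
qed

end

section \<open>Regularly varying tails and asymptotic Gaussianity\<close>

text \<open>
  Slow variation gives the limit \<open>2 powr (- \<alpha>)\<close> for the ratio of the tails at \<open>2 * n\<close> and \<open>n\<close>. It is strictly between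
  \<open>2 powr (- a)\<close> and \<open>1\<close> for every \<open>a\<close> above \<open>\<alpha>\<close>.
\<close>
lemma regularly_varying_tail:
  fixes \<alpha> :: real and L :: "real \<Rightarrow> real"
  assumes \<alpha>: "0 < \<alpha>" "\<alpha> < 1 / 2" and L: "\<And>x. L x > 0" "slowly_varying L"
    and \<mu>0: "pmf \<mu> 0 = 0"
    and tail: "(\<lambda>n. measure_pmf.prob \<mu> {n..}) \<sim>[sequentially] (\<lambda>n. real n powr (- \<alpha>) * L (real n))"
    and gcd: "Gcd {n. pmf \<mu> n > 0} = 1"
  shows "\<exists>a \<kappa> c0. heavy_tailed_jumps \<mu> a \<kappa> c0"
proof -
  define f where "f n = real n powr (- \<alpha>) * L (real n)" for n
  have fpos: "0 < f n" if "1 \<le> n" for n using L(1) that by (simp add: f_def)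
  have "((\<lambda>n. if tail \<mu> n = 0 \<and> f n = 0 then 1 else tail \<mu> n / f n) \<longlongrightarrow> 1) sequentially"
    using tail unfolding asymp_equiv_def tail_def f_def .
  then have lim: "(\<lambda>n. tail \<mu> n / f n) \<longlonglongrightarrow> 1"
    by (rule Lim_transform_eventually)
      (use eventually_ge_at_top[of 1] in \<open>eventually_elim, use fpos in force\<close>)
  have ev_pos: "\<forall>\<^sub>F n in sequentially. 0 < tail \<mu> n"
    using order_tendstoD(1)[OF lim zero_less_one] eventually_ge_at_top[of 1]
  proof eventually_elim
    case (elim n)
    then show ?case using fpos[of n] by (simp add: zero_less_divide_iff)
  qed
  have pos: "0 < tail \<mu> n" for n
  proof -
    obtain N where "\<And>n. n \<ge> N \<Longrightarrow> 0 < tail \<mu> n" using ev_pos unfolding eventually_sequentially by auto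
    then have "0 < tail \<mu> (max n N)" by simp
    also have "\<dots> \<le> tail \<mu> n" by (rule tail_antimono) simp
    finally show ?thesis .
  qed
  have ratio: "(\<lambda>n. tail \<mu> (2 * n) / tail \<mu> n) \<longlonglongrightarrow> 2 powr (- \<alpha>)"
  proof -
    have sub: "filterlim (\<lambda>n::nat. 2 * n) sequentially sequentially"
      by (rule filterlim_subseq) (simp add: strict_mono_def)
    have "((\<lambda>x. L (2 * x) / L x) \<longlongrightarrow> 1) at_top" using L(2) by (simp add: slowly_varying_def)
    then have Ll: "(\<lambda>n. L (2 * real n) / L (real n)) \<longlonglongrightarrow> 1"
      by (rule filterlim_compose) (rule filterlim_real_sequentially)
    have "(\<lambda>n. (tail \<mu> (2 * n) / f (2 * n)) * (2 powr (- \<alpha>) * (L (2 * real n) / L (real n))) * inverse (tail \<mu> n / f n))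
        \<longlonglongrightarrow> 1 * (2 powr (- \<alpha>) * 1) * inverse 1"
      by (intro tendsto_intros Ll lim filterlim_compose[OF lim sub]) auto
    moreover have "\<forall>\<^sub>F n in sequentially.
        (tail \<mu> (2 * n) / f (2 * n)) * (2 powr (- \<alpha>) * (L (2 * real n) / L (real n))) * inverse (tail \<mu> n / f n)
        = tail \<mu> (2 * n) / tail \<mu> n"
      using eventually_ge_at_top[of 1]
    proof eventually_elim
      case (elim n)
      have f2: "f (2 * n) = f n * (2 powr (- \<alpha>) * (L (2 * real n) / L (real n)))"
        using L(1)[of "real n"] by (simp add: f_def powr_mult)
      have "0 < f n" "0 < 2 powr (- \<alpha>) * (L (2 * real n) / L (real n))"
        using fpos[OF elim] L(1) by auto
      moreover have "u / (x * y) * y * inverse (v / x) = u / v" if "0 < x" "0 < y" for u v x y :: real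
        using that by (simp add: field_simps)
      ultimately show ?case unfolding f2 by blast
    qed
    ultimately show ?thesis by (simp add: Lim_transform_eventually)
  qed
  define a where "a = (\<alpha> + 1 / 2) / 2"
  have a: "0 < a" "a < 1 / 2" "\<alpha> < a" using \<alpha> by (auto simp: a_def)
  have dbl: "\<forall>\<^sub>F n in sequentially. 2 powr (- a) * tail \<mu> n \<le> tail \<mu> (2 * n)"
    using order_tendstoD(1)[OF ratio, of "2 powr (- a)"]
  proof (rule eventually_mono)
    show "2 powr (- a) < 2 powr (- \<alpha>)" using a by (intro powr_less_mono) auto
    fix n assume "2 powr (- a) < tail \<mu> (2 * n) / tail \<mu> n"
    then show "2 powr (- a) * tail \<mu> n \<le> tail \<mu> (2 * n)" using pos[of n] by (simp add: field_simps)
  qed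
  obtain \<kappa> where \<kappa>: "0 < \<kappa>" "\<forall>n\<ge>1. \<forall>x\<ge>n. \<kappa> * (real n / real x) powr a * tail \<mu> n \<le> tail \<mu> x"
    using potter_from_doubling[of "tail \<mu>" a, OF tail_antimono pos tail_le_1 a(1) dbl] by blast
  \<comment> \<open>Any number strictly between the limit of the ratios and \<open>1\<close>.\<close>
  define \<rho> where "\<rho> = (1 + 2 powr (- \<alpha>)) / 2"
  have p1: "2 powr (- \<alpha>) < (1::real)" using powr_less_mono[of "- \<alpha>" 0 "2::real"] \<alpha> by simp
  have \<rho>: "2 powr (- \<alpha>) < \<rho>" "\<rho> < 1" using p1 by (auto simp: \<rho>_def)
  have drop: "\<forall>\<^sub>F n in sequentially. (1 - \<rho>) * tail \<mu> n \<le> tail \<mu> n - tail \<mu> (2 * n)"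
    using order_tendstoD(2)[OF ratio \<rho>(1)]
  proof eventually_elim
    case (elim n)
    then show ?case using pos[of n] by (simp add: field_simps)
  qed
  have "heavy_tailed_jumps \<mu> a \<kappa> (1 - \<rho>)"
    by unfold_locales (use \<mu>0 gcd pos a \<kappa> \<rho> drop in auto)
  then show ?thesis by blast
qed

context coloured_urn
begin

lemma pair_form_lower:
  fixes b :: "int \<Rightarrow> real"
  assumes n: "n1 < n2" "n2 \<le> N"
    and b1: "\<And>i. int n1 < i \<Longrightarrow> i \<le> int n2 \<Longrightarrow> b i = \<beta>"
    and b0: "\<And>i. int n2 < i \<Longrightarrow> b i = 0"
  shows "\<beta>\<^sup>2 * \<kappa> ^ 4 / (12 * enn2real Q) * (real (n2 - n1) / real N) ^ 3 * scale N \<le> pair_form {1..int N} b"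
proof -
  have Q0: "0 < enn2real Q"
    using Q_finite Q_ge_1 by (auto simp: enn2real_positive_iff intro: less_le_trans[of 0 1])
  have "\<beta>\<^sup>2 * \<kappa> ^ 4 / 12 * (real (n2 - n1) / real N) ^ 3 * scale N
      \<le> (\<Sum>i\<in>{1..int N}. \<Sum>j\<in>{1..int N}. b i * b j * enn2real (meet i j))"
    by (rule quadratic_form_lower[OF n b1 b0])
  also have "\<dots> = enn2real Q * pair_form {1..int N} b"
    unfolding pair_form_def sum_distrib_left pair_prob_meet[symmetric]
    by (intro sum.cong refl) (simp only: mult_ac)
  finally have "(\<beta>\<^sup>2 * \<kappa> ^ 4 / 12 * (real (n2 - n1) / real N) ^ 3 * scale N) / enn2real Q
      \<le> pair_form {1..int N} b"
    using Q0 by (simp only: pos_divide_le_eq mult.commute[of "pair_form _ _"])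
  then show ?thesis by (simp add: mult_ac)
qed

lemma quad_sum_negligible:
  assumes "0 < e"
  shows "\<forall>\<^sub>F n in sequentially. quad_sum {1..int n} \<le> e * (scale n)\<^sup>2"
  using fourfold_negligible[OF assms]
proof eventually_elim
  case (elim n)
  have "ennreal (quad_sum {1..int n}) \<le> fourfold n"
    unfolding quad_sum_def by (rule quad_prob_sum)
  then have "ennreal (quad_sum {1..int n}) \<le> ennreal (e * (scale n)\<^sup>2)" using elim by (rule order_trans)
  then show ?case using assms by (subst (asm) ennreal_le_iff) auto
qed

lemma sum_colours_moments:
  fixes b :: "int \<Rightarrow> real"
  assumes S: "finite S"
  shows "(\<lambda>\<omega>. \<Sum>i\<in>S. b i * C i \<omega>) \<in> borel_measurable M"
    and "integrable M (\<lambda>\<omega>. (\<Sum>i\<in>S. b i * C i \<omega>)\<^sup>2)"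
    and "expectation (\<lambda>\<omega>. \<Sum>i\<in>S. b i * C i \<omega>) = 0"
    and "variance (\<lambda>\<omega>. \<Sum>i\<in>S. b i * C i \<omega>) = \<tau> * pair_form S b"
proof -
  show "(\<lambda>\<omega>. \<Sum>i\<in>S. b i * C i \<omega>) \<in> borel_measurable M" by measurable
  have sq: "(\<Sum>i\<in>S. b i * C i \<omega>)\<^sup>2 = (\<Sum>i\<in>S. \<Sum>k\<in>S. b i * b k * (C i \<omega> * C k \<omega>))" for \<omega>
    by (simp add: power2_eq_square sum_product mult_ac)
  show "integrable M (\<lambda>\<omega>. (\<Sum>i\<in>S. b i * C i \<omega>)\<^sup>2)" unfolding sq
    by (intro Bochner_Integration.integrable_sum integrable_mult_right colour_moments)
  show E0: "expectation (\<lambda>\<omega>. \<Sum>i\<in>S. b i * C i \<omega>) = 0"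
    by (simp add: Bochner_Integration.integral_sum colour_moments)
  have "expectation (\<lambda>\<omega>. (\<Sum>i\<in>S. b i * C i \<omega>)\<^sup>2) = \<tau> * pair_form S b"
    unfolding sq
    by (simp add: Bochner_Integration.integral_sum Bochner_Integration.integrable_sum colour_moments
        pair_form_def sum_distrib_left mult_ac)
  then show "variance (\<lambda>\<omega>. \<Sum>i\<in>S. b i * C i \<omega>) = \<tau> * pair_form S b" by (simp add: E0)
qed

lemma colour_sum_eq: "colour_sum C n \<omega> = (\<Sum>i\<in>{1..int n}. 1 * C i \<omega>)"
  using sum_int_interval[of "\<lambda>i. C i \<omega>" n] by (simp add: colour_sum_def)

text \<open>
  The variance of a linear combination is \<open>\<tau> * pair_form S b\<close> and hence at least of the order of \<open>scale\<close>, while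
  the number of connected quadruples is of smaller order than its square. So \<open>char_estimate\<close> applies with any \<open>\<delta> > 0\<close>, and the
  claim follows from Levy's continuity theorem.
\<close>
theorem colour_sums_asymptotically_gaussian:
  fixes t :: "nat \<Rightarrow> real"
  assumes d: "1 \<le> d" and t: "\<And>g. g \<in> {1..d} \<Longrightarrow> 0 < t g" "strict_mono_on {1..d} t"
  shows "asymptotically_gaussian M d (\<lambda>n g. colour_sum C (nat \<lfloor>t g * real n\<rfloor>))"
proof -
  define k where "k g n = nat \<lfloor>t g * real n\<rfloor>" for g n
  define N where "N n = k d n" for n
  define T where "T n g = {1..int (k g n)}" for n g
  define S where "S n = {1..int (N n)}" for n
  have tle: "t g \<le> t h" if "g \<in> {1..d}" "h \<in> {1..d}" "g \<le> h" for g h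
    using strict_mono_onD[OF t(2), of g h] that by (cases "g = h") auto
  have kmono: "k g n \<le> k h n" if "g \<in> {1..d}" "h \<in> {1..d}" "g \<le> h" for g h n
    unfolding k_def using tle[OF that] by (intro nat_mono floor_mono mult_right_mono) auto
  have TS: "T n g \<subseteq> S n" if "g \<in> {1..d}" for n g
    using kmono[of g d n] that d by (auto simp: T_def S_def N_def)
  have fS: "finite (S n)" for n by (simp add: S_def)
  have td: "0 < t d" using t(1)[of d] d by simp
  have Nlim: "filterlim N sequentially sequentially"
  proof -
    have "filterlim (\<lambda>n. t d * real n) at_top sequentially"
      using td by (intro filterlim_tendsto_pos_mult_at_top[OF tendsto_const]) (auto intro: filterlim_real_sequentially)
    then have "filterlim (\<lambda>n. nat \<lfloor>t d * real n\<rfloor>) sequentially sequentially"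
      by (intro filterlim_compose[OF filterlim_nat_sequentially] filterlim_compose[OF filterlim_floor_sequentially])
    then show ?thesis by (simp add: N_def[abs_def] k_def)
  qed
  have V: "(\<Sum>g=1..d. \<beta> g * colour_sum C (k g n) \<omega>) = (\<Sum>i\<in>S n. step_fun {1..d} \<beta> (T n) i * C i \<omega>)"
    for \<beta> n \<omega>
  proof -
    have "(\<Sum>i\<in>S n. step_fun {1..d} \<beta> (T n) i * C i \<omega>)
        = (\<Sum>i\<in>S n. \<Sum>g=1..d. \<beta> g * (of_bool (i \<in> T n g) * C i \<omega>))"
      unfolding step_fun_def sum_distrib_right mult.assoc ..
    also have "\<dots> = (\<Sum>g=1..d. \<Sum>i\<in>S n. \<beta> g * (of_bool (i \<in> T n g) * C i \<omega>))"
      by (rule sum.swap)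
    also have "\<dots> = (\<Sum>g=1..d. \<beta> g * colour_sum C (k g n) \<omega>)"
    proof (intro sum.cong refl)
      fix g assume g: "g \<in> {1..d}"
      have "(\<Sum>i\<in>S n. of_bool (i \<in> T n g) * C i \<omega>) = (\<Sum>i\<in>T n g. C i \<omega>)"
        using TS[OF g] fS by (intro sum.mono_neutral_cong_right) auto
      then show "(\<Sum>i\<in>S n. \<beta> g * (of_bool (i \<in> T n g) * C i \<omega>)) = \<beta> g * colour_sum C (k g n) \<omega>"
        by (simp add: colour_sum_eq T_def flip: sum_distrib_left)
    qed
    finally show ?thesis by simp
  qed
  have lower: "\<exists>c>0. \<forall>\<^sub>F n in sequentially. c * scale (N n) \<le> pair_form (S n) (step_fun {1..d} \<beta> (T n))"
    if \<beta>: "\<exists>g\<in>{1..d}. \<beta> g \<noteq> 0" for \<beta> :: "nat \<Rightarrow> real"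
  proof -
    \<comment> \<open>Above the vertex \<open>k g n\<close> the step function vanishes, and between \<open>k (g - 1) n\<close> and \<open>k g n\<close> it equals \<open>\<beta> g\<close>.\<close>
    define g where "g = Max {g\<in>{1..d}. \<beta> g \<noteq> 0}"
    have "g \<in> {g\<in>{1..d}. \<beta> g \<noteq> 0}" unfolding g_def using \<beta> by (intro Max_in) auto
    then have g: "g \<in> {1..d}" "\<beta> g \<noteq> 0" by auto
    have g_max: "\<beta> h = 0" if "h \<in> {1..d}" "g < h" for h
    proof (rule ccontr)
      assume "\<beta> h \<noteq> 0"
      then have "h \<le> g" unfolding g_def using that by (intro Max_ge) auto
      then show False using that by simp
    qed
    define t1 where "t1 = (if g = 1 then 0 else t (g - 1))"
    have t1: "0 \<le> t1" "t1 < t g"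
    proof -
      have "0 < t (g - 1)" "t (g - 1) < t g" if "g \<noteq> 1"
        using that g t(1)[of "g - 1"] strict_mono_onD[OF t(2), of "g - 1" g] by (auto simp: Suc_le_eq)
      then show "0 \<le> t1" "t1 < t g" using t(1)[OF g(1)] by (auto simp: t1_def less_imp_le)
    qed
    define k1 where "k1 n = nat \<lfloor>t1 * real n\<rfloor>" for n
    \<comment> \<open>Half of the limiting proportion of the last interval in the window; the other half absorbs the rounding.\<close>
    define \<rho> where "\<rho> = (t g - t1) / (2 * t d)"
    have \<rho>: "0 < \<rho>" using t1 td by (simp add: \<rho>_def)
    have Q0: "0 < enn2real Q"
      using Q_finite Q_ge_1 by (auto simp: enn2real_positive_iff intro: less_le_trans[of 0 1])
    define c where "c = (\<beta> g)\<^sup>2 * \<kappa> ^ 4 / (12 * enn2real Q) * \<rho> ^ 3"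
    have c: "0 < c" using g \<kappa> Q0 \<rho> by (simp add: c_def)
    have "\<forall>\<^sub>F n in sequentially. 2 / (t g - t1) + 1 \<le> real n"
      by (rule eventually_compose_filterlim[OF eventually_ge_at_top filterlim_real_sequentially])
    then have "\<forall>\<^sub>F n in sequentially. c * scale (N n) \<le> pair_form (S n) (step_fun {1..d} \<beta> (T n))"
    proof eventually_elim
      case (elim n)
      have n0: "0 < real n" using elim t1 by (smt (verit) divide_pos_pos)
      have "2 / (t g - t1) \<le> real n" using elim by simp
      then have big: "2 \<le> (t g - t1) * real n" using t1 by (simp add: field_simps)
      have kg: "t g * real n - 1 \<le> real (k g n)" unfolding k_def using t(1)[OF g(1)] n0 by linarith
      have k1': "real (k1 n) \<le> t1 * real n" unfolding k1_def using t1 n0 by (simp add: of_nat_floor)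
      have diff: "(t g - t1) * real n / 2 \<le> real (k g n) - real (k1 n)"
        using kg k1' big left_diff_distrib[of "t g" t1 "real n"] by linarith
      then have lt: "k1 n < k g n" using big by linarith
      have kN: "k g n \<le> N n" unfolding N_def using g d by (intro kmono) auto
      have Nn: "real (N n) \<le> t d * real n" unfolding N_def k_def using td n0 by (simp add: of_nat_floor)
      have N0: "0 < real (N n)" using lt kN by simp
      have ratio: "\<rho> \<le> real (k g n - k1 n) / real (N n)"
      proof -
        have "\<rho> * real (N n) \<le> \<rho> * (t d * real n)" using Nn \<rho> by (intro mult_left_mono) auto
        also have "\<dots> = (t g - t1) * real n / 2" using td by (simp add: \<rho>_def)
        also have "\<dots> \<le> real (k g n - k1 n)" using diff lt by (simp add: of_nat_diff)
        finally show ?thesis using N0 by (simp add: field_simps)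
      qed
      have b1: "step_fun {1..d} \<beta> (T n) i = \<beta> g" if i: "int (k1 n) < i" "i \<le> int (k g n)" for i
      proof -
        have "step_fun {1..d} \<beta> (T n) i = (\<Sum>h\<in>{1..d}. if h = g then \<beta> g else 0)"
          unfolding step_fun_def
        proof (intro sum.cong refl)
          fix h assume h: "h \<in> {1..d}"
          consider "h < g" | "h = g" | "g < h" by linarith
          then show "\<beta> h * of_bool (i \<in> T n h) = (if h = g then \<beta> g else 0)"
          proof cases
            case 1
            then have g1: "g \<noteq> 1" "g - 1 \<in> {1..d}" "h \<le> g - 1" using h g by auto
            have "k h n \<le> k (g - 1) n" using g1 h by (intro kmono) auto
            also have "\<dots> = k1 n" using g1 by (simp add: k_def k1_def t1_def)
            finally show ?thesis using i 1 by (auto simp: T_def)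
          next
            case 2
            then show ?thesis using i by (auto simp: T_def)
          next
            case 3
            then show ?thesis using g_max[OF h] by simp
          qed
        qed
        then show ?thesis using g by simp
      qed
      have b0: "step_fun {1..d} \<beta> (T n) i = 0" if i: "int (k g n) < i" for i
        unfolding step_fun_def
      proof (intro sum.neutral ballI)
        fix h assume h: "h \<in> {1..d}"
        show "\<beta> h * of_bool (i \<in> T n h) = 0"
        proof (cases "g < h")
          case True
          then show ?thesis using g_max[OF h] by simp
        next
          case False
          then have "k h n \<le> k g n" using h g by (intro kmono) auto
          then show ?thesis using i by (auto simp: T_def)
        qed
      qed
      have "c * scale (N n) \<le> (\<beta> g)\<^sup>2 * \<kappa> ^ 4 / (12 * enn2real Q) * (real (k g n - k1 n) / real (N n)) ^ 3 * scale (N n)"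
        unfolding c_def
      proof (intro mult_right_mono mult_left_mono power_mono ratio)
        show "0 \<le> scale (N n)" using N0 scale_pos[of "N n"] by simp
      qed (use \<rho> Q0 \<kappa> in auto)
      also have "\<dots> \<le> pair_form (S n) (step_fun {1..d} \<beta> (T n))"
        unfolding S_def by (rule pair_form_lower[OF lt kN b1 b0])
      finally show ?case .
    qed
    then show ?thesis using c by blast
  qed
  have gauss: "(\<forall>\<^sub>F n in sequentially. variance (\<lambda>\<omega>. \<Sum>g=1..d. \<beta> g * colour_sum C (k g n) \<omega>) > 0) \<and>
      weak_conv_m (\<lambda>n. distr M borel (\<lambda>\<omega>. (\<Sum>g=1..d. \<beta> g * colour_sum C (k g n) \<omega>)
          / sqrt (variance (\<lambda>\<omega>. \<Sum>g=1..d. \<beta> g * colour_sum C (k g n) \<omega>)))) std_normal_distribution"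
    if \<beta>: "\<exists>g\<in>{1..d}. \<beta> g \<noteq> 0" for \<beta> :: "nat \<Rightarrow> real"
  proof -
    define b where "b n = step_fun {1..d} \<beta> (T n)" for n
    define m where "m n = pair_form (S n) (b n)" for n
    define B where "B = (\<Sum>g=1..d. \<bar>\<beta> g\<bar>)"
    obtain c where c: "0 < c" and ev: "\<forall>\<^sub>F n in sequentially. c * scale (N n) \<le> m n"
      using lower[OF \<beta>] unfolding m_def b_def by blast
    have N1: "\<forall>\<^sub>F n in sequentially. 1 \<le> N n"
      by (rule eventually_compose_filterlim[OF eventually_ge_at_top Nlim])
    have mpos: "\<forall>\<^sub>F n in sequentially. 0 < m n"
      using ev N1
    proof eventually_elim
      case (elim n)
      have "0 < c * scale (N n)" using c scale_pos[OF elim(2)] by simp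
      then show ?case using elim(1) by simp
    qed
    have var: "variance (\<lambda>\<omega>. \<Sum>g=1..d. \<beta> g * colour_sum C (k g n) \<omega>) = \<tau> * m n" for n
      unfolding V m_def b_def by (rule sum_colours_moments(4)[OF fS])
    have meas: "(\<lambda>\<omega>. \<Sum>g=1..d. \<beta> g * colour_sum C (k g n) \<omega>) \<in> borel_measurable M" for n
      unfolding V by (rule sum_colours_moments(1)[OF fS])
    define W where "W n \<omega> = (\<Sum>g=1..d. \<beta> g * colour_sum C (k g n) \<omega>) / sqrt (\<tau> * m n)" for n \<omega>
    have Wm: "W n \<in> borel_measurable M" for n unfolding W_def using meas by measurable
    have "weak_conv_m (\<lambda>n. distr M borel (W n)) std_normal_distribution"
    proof (rule levy_continuity)
      show "real_distribution (distr M borel (W n))" for n by (rule real_distribution_distr[OF Wm])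
      show "real_distribution std_normal_distribution" by (rule real_dist_normal_dist)
      fix s
      have cW: "char (distr M borel (W n)) s
          = expectation (\<lambda>\<omega>. iexp (s / sqrt (\<tau> * m n) * (\<Sum>i\<in>S n. b n i * C i \<omega>)))" for n
      proof -
        have "s * W n \<omega> = s / sqrt (\<tau> * m n) * (\<Sum>i\<in>S n. b n i * C i \<omega>)" for \<omega>
          unfolding W_def V b_def by simp
        moreover have "char (distr M borel (W n)) s = expectation (\<lambda>\<omega>. iexp (s * W n \<omega>))"
          unfolding char_def using Wm[of n] by (subst integral_distr) auto
        ultimately show ?thesis by (simp only:)
      qed
      define A where "A = K3 * (s\<^sup>2 / \<tau> + s ^ 4 * B ^ 4 / \<tau>\<^sup>2) + s\<^sup>2 * B\<^sup>2 / 2"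
      have A0: "0 \<le> A" using K3(1) \<tau>_pos by (auto simp: A_def intro!: add_nonneg_nonneg mult_nonneg_nonneg)
      have "(\<lambda>n. char (distr M borel (W n)) s) \<longlonglongrightarrow> of_real (exp (- (s\<^sup>2 / 2)))"
      proof (rule tendstoI)
        fix \<epsilon> :: real assume \<epsilon>: "0 < \<epsilon>"
        define \<delta> where "\<delta> = \<epsilon> / (A + 1)"
        have \<delta>: "0 < \<delta>" using \<epsilon> A0 by (simp add: \<delta>_def)
        have "\<forall>\<^sub>F n in sequentially. quad_sum {1..int n} \<le> (\<delta> * c)\<^sup>2 * (scale n)\<^sup>2"
          by (rule quad_sum_negligible) (use \<delta> c in auto)
        then have "\<forall>\<^sub>F n in sequentially. quad_sum (S n) \<le> (\<delta> * c)\<^sup>2 * (scale (N n))\<^sup>2"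
          unfolding S_def by (rule eventually_compose_filterlim[OF _ Nlim])
        then show "\<forall>\<^sub>F n in sequentially. dist (char (distr M borel (W n)) s) (of_real (exp (- (s\<^sup>2 / 2)))) < \<epsilon>"
          using ev mpos N1
        proof eventually_elim
          case (elim n)
          have sc: "0 < scale (N n)" by (rule scale_pos[OF elim(4)])
          have "sqrt (quad_sum (S n)) \<le> sqrt ((\<delta> * c * scale (N n))\<^sup>2)"
            using elim(1) by (simp add: power_mult_distrib)
          also have "\<dots> = \<delta> * (c * scale (N n))" using \<delta> c sc by simp
          also have "\<dots> \<le> \<delta> * m n" using elim(2) \<delta> by (intro mult_left_mono) auto
          finally have "sqrt (quad_sum (S n)) \<le> \<delta> * m n" .
          then have "cmod (char (distr M borel (W n)) s - of_real (exp (- (s\<^sup>2 / 2)))) \<le> A * \<delta>"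
            unfolding cW A_def B_def m_def b_def
            using elim(3) \<delta> by (intro char_estimate fS TS) (auto simp: m_def b_def)
          also have "\<dots> < \<epsilon>"
            using A0 \<epsilon> by (simp add: \<delta>_def field_simps)
          finally show ?case by (simp add: dist_norm)
        qed
      qed
      then show "(\<lambda>n. char (distr M borel (W n)) s) \<longlonglongrightarrow> char std_normal_distribution s"
        by (simp add: char_std_normal_distribution)
    qed
    moreover have "\<forall>\<^sub>F n in sequentially. 0 < \<tau> * m n"
      using mpos by eventually_elim (simp add: \<tau>_pos)
    ultimately show ?thesis unfolding var W_def[abs_def] by blast
  qed
  show ?thesis
    unfolding asymptotically_gaussian_def Let_def k_def[symmetric]
  proof (intro conjI allI ballI impI)
    fix n g
    have eq: "colour_sum C (k g n) = (\<lambda>\<omega>. \<Sum>i\<in>{1..int (k g n)}. 1 * C i \<omega>)" by (intro ext colour_sum_eq)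
    show "colour_sum C (k g n) \<in> borel_measurable M" "integrable M (\<lambda>\<omega>. (colour_sum C (k g n) \<omega>)\<^sup>2)"
      "expectation (colour_sum C (k g n)) = 0"
      unfolding eq by (rule sum_colours_moments; simp)+
  next
    fix \<beta> :: "nat \<Rightarrow> real" assume \<beta>: "\<exists>g\<in>{1..d}. \<beta> g \<noteq> 0"
    show "\<forall>\<^sub>F n in sequentially. 0 < variance (\<lambda>\<omega>. \<Sum>g=1..d. \<beta> g * colour_sum C (k g n) \<omega>)"
      using gauss[OF \<beta>] by blast
    show "weak_conv_m (\<lambda>n. distr M borel (\<lambda>\<omega>. (\<Sum>g=1..d. \<beta> g * colour_sum C (k g n) \<omega>)
          / sqrt (variance (\<lambda>\<omega>. \<Sum>g=1..d. \<beta> g * colour_sum C (k g n) \<omega>)))) std_normal_distribution"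
      using gauss[OF \<beta>] by blast
  qed
qed

end

theorem theorem1p1:
  fixes \<alpha> :: real and L :: "real \<Rightarrow> real" and \<mu> :: "nat pmf"
    and N :: "'y measure" and Y :: "'y \<Rightarrow> real"
    and M :: "'w measure" and R :: "int \<Rightarrow> 'w \<Rightarrow> nat" and C :: "int \<Rightarrow> 'w \<Rightarrow> real"
    and d :: nat and t :: "nat \<Rightarrow> real"
  assumes \<alpha>: "0 < \<alpha>" "\<alpha> < 1 / 2"
    and L: "\<And>x. L x > 0" "slowly_varying L"
    and \<mu>_pos: "pmf \<mu> 0 = 0"
    and \<mu>_tail: "(\<lambda>n. measure_pmf.prob \<mu> {n..}) \<sim>[sequentially]
                   (\<lambda>n. real n powr (- \<alpha>) * L (real n))"
    and \<mu>_gcd: "Gcd {n. pmf \<mu> n > 0} = 1"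
    and Y: "prob_space N" "Y \<in> borel_measurable N"
    and AB: "(\<exists>p \<xi>. 0 < p \<and> p < 1 \<and> \<xi> \<in> borel_measurable N \<and>
                measure N {\<omega>\<in>space N. \<xi> \<omega> = 1} = p \<and>
                measure N {\<omega>\<in>space N. \<xi> \<omega> = - 1} = 1 - p \<and>
                (\<forall>\<omega>\<in>space N. Y \<omega> = \<xi> \<omega> - (2 * p - 1)))
           \<or> ((renewal_weight \<mu> \<sim>[sequentially]
                 (\<lambda>n. 1 / (Gamma \<alpha> * Gamma (1 - \<alpha>)) * (real n powr (\<alpha> - 1) / L (real n)))) \<and>
              prob_space.expectation N Y = 0 \<and>
              integrable N (\<lambda>\<omega>. Y \<omega> ^ 4) \<and>
              0 < prob_space.expectation N (\<lambda>\<omega>. Y \<omega> ^ 4))"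
    and M: "prob_space M"
    and R: "iid_jumps M \<mu> R"
    and C: "component_colouring M R (distr N borel Y) C"
    and d: "d \<ge> 1"
    and t: "\<And>g. g \<in> {1..d} \<Longrightarrow> 0 < t g" "strict_mono_on {1..d} t"
  shows "asymptotically_gaussian M d (\<lambda>n g. colour_sum C (nat \<lfloor>t g * real n\<rfloor>))"
proof -
  interpret N: prob_space N by (rule Y(1))
  note Y(2) [measurable]
  have mean4: "N.expectation Y = 0 \<and> integrable N (\<lambda>\<omega>. Y \<omega> ^ 4) \<and> \<not> (AE \<omega> in N. Y \<omega> = 0)"
    using AB
  proof
    assume "\<exists>p \<xi>. 0 < p \<and> p < 1 \<and> \<xi> \<in> borel_measurable N \<and>
        measure N {\<omega>\<in>space N. \<xi> \<omega> = 1} = p \<and> measure N {\<omega>\<in>space N. \<xi> \<omega> = - 1} = 1 - p \<and>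
        (\<forall>\<omega>\<in>space N. Y \<omega> = \<xi> \<omega> - (2 * p - 1))"
    then obtain p \<xi> where p: "0 < p" "p < 1" and \<xi> [measurable]: "\<xi> \<in> borel_measurable N"
      and up: "measure N {\<omega>\<in>space N. \<xi> \<omega> = 1} = p" and down: "measure N {\<omega>\<in>space N. \<xi> \<omega> = - 1} = 1 - p"
      and Yx: "\<And>\<omega>. \<omega> \<in> space N \<Longrightarrow> Y \<omega> = \<xi> \<omega> - (2 * p - 1)" by blast
    let ?U = "{\<omega>\<in>space N. \<xi> \<omega> = 1}" let ?D = "{\<omega>\<in>space N. \<xi> \<omega> = - 1}"
    have sets: "?U \<in> sets N" "?D \<in> sets N" by measurable
    have "measure N (?U \<union> ?D) = 1"
      using sets up down by (subst N.finite_measure_Union) auto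
    then have "AE \<omega> in N. \<omega> \<in> ?U \<union> ?D"
      using sets by (subst N.prob_eq_1[symmetric]) auto
    then have pm: "AE \<omega> in N. \<xi> \<omega> = 1 \<or> \<xi> \<omega> = - 1" by eventually_elim auto
    have "N.expectation Y = (\<integral>\<omega>. indicator ?U \<omega> - indicator ?D \<omega> - (2 * p - 1) \<partial>N)"
    proof (rule integral_cong_AE)
      show "AE \<omega> in N. Y \<omega> = indicator ?U \<omega> - indicator ?D \<omega> - (2 * p - 1)"
        using pm AE_space by eventually_elim (auto simp: Yx indicator_def)
    qed (use sets in measurable)
    also have "\<dots> = 0"
      using sets up down by (simp add: N.prob_space N.emeasure_eq_measure)
    finally have mean: "N.expectation Y = 0" .
    have "AE \<omega> in N. norm (Y \<omega> ^ 4) \<le> 2 ^ 4"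
      using pm AE_space
    proof eventually_elim
      case (elim \<omega>)
      have "\<bar>Y \<omega>\<bar> \<le> 2" using elim p by (auto simp: Yx)
      then have "\<bar>Y \<omega>\<bar> ^ 4 \<le> 2 ^ 4" by (intro power_mono) auto
      then show ?case by (simp add: power_abs)
    qed
    then have i4: "integrable N (\<lambda>\<omega>. Y \<omega> ^ 4)"
      by (rule N.integrable_const_bound) measurable
    have "\<not> (AE \<omega> in N. Y \<omega> = 0)"
    proof
      assume "AE \<omega> in N. Y \<omega> = 0"
      then have "AE \<omega> in N. \<omega> \<notin> ?U" using AE_space
      proof eventually_elim
        case (elim \<omega>)
        then show ?case using p by (auto simp: Yx)
      qed
      then have "measure N ?U = 0" using sets by (simp add: N.prob_eq_0)
      then show False using up p by simp
    qed
    with mean i4 show ?thesis by blast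
  next
    assume B: "(renewal_weight \<mu> \<sim>[sequentially]
        (\<lambda>n. 1 / (Gamma \<alpha> * Gamma (1 - \<alpha>)) * (real n powr (\<alpha> - 1) / L (real n)))) \<and>
      N.expectation Y = 0 \<and> integrable N (\<lambda>\<omega>. Y \<omega> ^ 4) \<and> 0 < N.expectation (\<lambda>\<omega>. Y \<omega> ^ 4)"
    have "\<not> (AE \<omega> in N. Y \<omega> = 0)"
    proof
      assume "AE \<omega> in N. Y \<omega> = 0"
      then have "N.expectation (\<lambda>\<omega>. Y \<omega> ^ 4) = N.expectation (\<lambda>\<omega>. 0)"
        by (intro integral_cong_AE) (auto elim: eventually_mono)
      then show False using B by simp
    qed
    with B show ?thesis by blast
  qed
  define \<tau> where "\<tau> = N.expectation (\<lambda>\<omega>. (Y \<omega>)\<^sup>2)"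
  note cubic = char_error_cubic[OF Y(1,2) _ _ \<tau>_def]
  have i1: "integrable N Y" and i2: "integrable N (\<lambda>\<omega>. (Y \<omega>)\<^sup>2)" using cubic mean4 by auto
  obtain K where K: "0 \<le> K" "\<And>x. cmod (char (distr N borel Y) x - of_real (exp (- (\<tau> * x\<^sup>2 / 2)))) \<le> K * \<bar>x\<bar> ^ 3"
    using cubic(3) mean4 by blast
  have "0 \<le> \<tau>" by (simp add: \<tau>_def)
  moreover have "\<tau> \<noteq> 0"
    using mean4 i2 unfolding \<tau>_def by (subst integral_nonneg_eq_0_iff_AE) auto
  ultimately have \<tau>: "0 < \<tau>" by simp
  obtain a \<kappa> c0 where heavy: "heavy_tailed_jumps \<mu> a \<kappa> c0"
    using regularly_varying_tail[OF \<alpha> L \<mu>_pos \<mu>_tail \<mu>_gcd] by blast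
  have "coloured_urn \<mu> a \<kappa> c0 M R C (distr N borel Y) \<tau> K"
  proof (intro coloured_urn.intro coloured_urn_axioms.intro heavy M R C \<tau> K N.real_distribution_distr)
    show "integrable (distr N borel Y) (\<lambda>x. x)" using i1 by (subst integrable_distr_eq) auto
    show "(\<integral>x. x \<partial>distr N borel Y) = 0" using mean4 by (subst integral_distr) auto
    show "integrable (distr N borel Y) (\<lambda>x. x\<^sup>2)" using i2 by (subst integrable_distr_eq) auto
    show "(\<integral>x. x\<^sup>2 \<partial>distr N borel Y) = \<tau>" by (subst integral_distr) (auto simp: \<tau>_def)
  qed (rule Y(2))
  then show ?thesis
    by (rule coloured_urn.colour_sums_asymptotically_gaussian[OF _ d t])
qed

end
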